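(* Let $a,c,d$ be positive integers. There exists a homogeneous regular sequence $g_1,g_2,f_1,f_2$ in $\mathbb{C}[x_1,x_2,x_3,x_4]$ of type $S^{(2,2)}\oplus S^{(4)}\oplus S^{(4)}$ with degrees $(a,a,c,d)$ if and only if either (1) $a=2$ or $a=4$, and $(c,d)\neq(1,1)$; or (2) $a\ge 5$ and $(a-2,a-4,c,d)$ is a regular degree sequence for $n=4$.
   Context: Let $R=\mathbb{C}[x_1,x_2,x_3,x_4]$ with $\mathfrak{S}_4$ permuting the variables. A homogeneous regular sequence $g_1,g_2,f_1,f_2$ (i.e. homogeneous polynomials whose only common zero is the origin) is of type $S^{(2,2)}\oplus S^{(4)}\oplus S^{(4)}$ with degrees $(a,a,c,d)$ if $\deg g_1=\deg g_2=a$, the span of $g_1,g_2$ is $\mathfrak{S}_4$-stable and isomorphic to the irreducible 2-dimensional representation $S^{(2,2)}$ of $\mathfrak{S}_4$ (corresponding to the partition $(2,2)$), and $f_1,f_2$ are symmetric polynomials with $\deg f_1=c$, $\deg f_2=d$. An unordered sequence $(d_1,d_2,d_3,d_4)$ of positive integers is a regular degree sequence (for $n=4$) if there is a homogeneous regular sequence of four symmetric polynomials in $R$ of degrees $d_1,\dots,d_4$. *)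

theory Defs
  imports Complex_Main "HOL-Library.Numeral_Type"
begin

text \<open>Polynomials in C[x_1,...,x_4]: variables are indexed by the 4-element type 4
  (elements 0,1,2,3).  A polynomial is its coefficient function on exponent vectors.
  For homogeneous polynomials (the only ones used) the support is automatically finite.\<close>

type_synonym expo = "4 \<Rightarrow> nat"
type_synonym cpoly = "expo \<Rightarrow> complex"

definition total_deg :: "expo \<Rightarrow> nat" where
  "total_deg e = (\<Sum>i\<in>UNIV. e i)"

definition homog_of_deg :: "nat \<Rightarrow> cpoly \<Rightarrow> bool" where
  "homog_of_deg d p \<longleftrightarrow> (\<exists>e. p e \<noteq> 0) \<and> (\<forall>e. p e \<noteq> 0 \<longrightarrow> total_deg e = d)"

definition peval :: "cpoly \<Rightarrow> (4 \<Rightarrow> complex) \<Rightarrow> complex" where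
  "peval p x = (\<Sum>e\<in>{e. p e \<noteq> 0}. p e * (\<Prod>i\<in>UNIV. x i ^ e i))"

definition perm_act :: "(4 \<Rightarrow> 4) \<Rightarrow> cpoly \<Rightarrow> cpoly" where
  "perm_act \<sigma> p = (\<lambda>e. p (e \<circ> \<sigma>))"

definition symmetric_poly :: "cpoly \<Rightarrow> bool" where
  "symmetric_poly p \<longleftrightarrow> (\<forall>\<sigma>. bij \<sigma> \<longrightarrow> perm_act \<sigma> p = p)"

definition only_origin :: "cpoly list \<Rightarrow> bool" where
  "only_origin ps \<longleftrightarrow> (\<forall>x. (\<forall>p\<in>set ps. peval p x = 0) \<longrightarrow> x = (\<lambda>_. 0))"

definition regular_degseq :: "nat \<Rightarrow> nat \<Rightarrow> nat \<Rightarrow> nat \<Rightarrow> bool" where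
  "regular_degseq d1 d2 d3 d4 \<longleftrightarrow> 0 < d1 \<and> 0 < d2 \<and> 0 < d3 \<and> 0 < d4 \<and>
     (\<exists>f1 f2 f3 f4. homog_of_deg d1 f1 \<and> homog_of_deg d2 f2 \<and> homog_of_deg d3 f3 \<and>
        homog_of_deg d4 f4 \<and> symmetric_poly f1 \<and> symmetric_poly f2 \<and> symmetric_poly f3 \<and>
        symmetric_poly f4 \<and> only_origin [f1, f2, f3, f4])"

definition lc :: "complex \<Rightarrow> cpoly \<Rightarrow> complex \<Rightarrow> cpoly \<Rightarrow> cpoly" where
  "lc \<alpha> p \<beta> q = (\<lambda>e. \<alpha> * p e + \<beta> * q e)"

definition lin_indep2 :: "cpoly \<Rightarrow> cpoly \<Rightarrow> bool" where
  "lin_indep2 p q \<longleftrightarrow> (\<forall>\<alpha> \<beta>. lc \<alpha> p \<beta> q = (\<lambda>_. 0) \<longrightarrow> \<alpha> = 0 \<and> \<beta> = 0)"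

text \<open>The Specht module S^(2,2), realised by the Specht polynomials
  (x_a - x_c)(x_b - x_d) of the standard tableaux [[0,1],[2,3]] and [[0,2],[1,3]].\<close>
definition sq :: "4 \<Rightarrow> 4 \<Rightarrow> expo" where
  "sq i j = (\<lambda>k. if k = i \<or> k = j then 1 else 0)"

definition mono_ind :: "expo \<Rightarrow> cpoly" where
  "mono_ind e0 = (\<lambda>e. if e = e0 then 1 else 0)"

definition specht :: "4 \<Rightarrow> 4 \<Rightarrow> 4 \<Rightarrow> 4 \<Rightarrow> cpoly" where
  "specht a b c d = (\<lambda>e. mono_ind (sq a b) e - mono_ind (sq a d) e
                        - mono_ind (sq c b) e + mono_ind (sq c d) e)"

definition spechtA :: cpoly where "spechtA = specht 0 1 2 3"
definition spechtB :: cpoly where "spechtB = specht 0 2 1 3"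

text \<open>span{g1,g2} is S_4-stable, 2-dimensional and isomorphic to S^(2,2): there is a
  basis h1,h2 of span{g1,g2} on which every permutation acts by the same matrix as on
  the basis spechtA, spechtB of the Specht module (i.e. an equivariant linear isomorphism).\<close>
definition rep_S22 :: "cpoly \<Rightarrow> cpoly \<Rightarrow> bool" where
  "rep_S22 g1 g2 \<longleftrightarrow> lin_indep2 g1 g2 \<and>
     (\<forall>\<sigma>. bij \<sigma> \<longrightarrow> (\<exists>\<alpha> \<beta> \<gamma> \<delta>. perm_act \<sigma> g1 = lc \<alpha> g1 \<beta> g2 \<and> perm_act \<sigma> g2 = lc \<gamma> g1 \<delta> g2)) \<and>
     (\<exists>p q r t. p * t - q * r \<noteq> 0 \<and>
        (\<forall>\<sigma> \<alpha> \<beta> \<gamma> \<delta>. bij \<sigma> \<longrightarrow>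
           perm_act \<sigma> spechtA = lc \<alpha> spechtA \<beta> spechtB \<longrightarrow>
           perm_act \<sigma> spechtB = lc \<gamma> spechtA \<delta> spechtB \<longrightarrow>
           perm_act \<sigma> (lc p g1 q g2) = lc \<alpha> (lc p g1 q g2) \<beta> (lc r g1 t g2) \<and>
           perm_act \<sigma> (lc r g1 t g2) = lc \<gamma> (lc p g1 q g2) \<delta> (lc r g1 t g2)))"

definition type_S22_44_seq :: "nat \<Rightarrow> nat \<Rightarrow> nat \<Rightarrow> cpoly \<Rightarrow> cpoly \<Rightarrow> cpoly \<Rightarrow> cpoly \<Rightarrow> bool" where
  "type_S22_44_seq a c d g1 g2 f1 f2 \<longleftrightarrow>
     homog_of_deg a g1 \<and> homog_of_deg a g2 \<and> homog_of_deg c f1 \<and> homog_of_deg d f2 \<and>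
     rep_S22 g1 g2 \<and> symmetric_poly f1 \<and> symmetric_poly f2 \<and>
     only_origin [g1, g2, f1, f2]"

end

theory Submission
  imports Defs "Subresultants.Subresultant_Gcd"
    "HOL-Computational_Algebra.Field_as_Ring"
    "HOL-Computational_Algebra.Fundamental_Theorem_Algebra"
begin

text \<open>
  Write \<open>y\<^sub>1 = x\<^sub>0x\<^sub>1 + x\<^sub>2x\<^sub>3\<close>, \<open>y\<^sub>2 = x\<^sub>0x\<^sub>2 + x\<^sub>1x\<^sub>3\<close>, \<open>y\<^sub>3 = x\<^sub>0x\<^sub>3 + x\<^sub>1x\<^sub>2\<close>, so that the Specht
  polynomials are \<open>A = y\<^sub>1 - y\<^sub>3\<close> and \<open>B = y\<^sub>2 - y\<^sub>3\<close>.  Divisibility by the linear factors forced by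
  transpositions shows that every equivariant pair has the form \<open>h\<^sub>1 = A (F + G (y\<^sub>1 + y\<^sub>3))\<close>,
  \<open>h\<^sub>2 = B (F + G (y\<^sub>2 + y\<^sub>3))\<close> with symmetric \<open>F\<close>, \<open>G\<close> of degrees \<open>a - 2\<close>, \<open>a - 4\<close>.  A common zero
  of \<open>F, G, f\<^sub>1, f\<^sub>2\<close> is one of \<open>h\<^sub>1, h\<^sub>2, f\<^sub>1, f\<^sub>2\<close>, which gives the regular degree sequence; small
  degrees are excluded because two forms on a three-dimensional space have a common zero.
  Conversely, only a few arithmetic consequences of \<open>(a - 2, a - 4, c, d)\<close> being a regular degree
  sequence are needed (a degree divisible by 3, one divisible by 4, two even ones, at most one of
  \<open>c, d\<close> equal to 1): in each resulting case explicit \<open>F, G, f\<^sub>1, f\<^sub>2\<close> in the elementary symmetric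
  polynomials are given.  Besides the origin, the zeros of \<open>h\<^sub>1, h\<^sub>2\<close> are the zeros of \<open>F, G\<close>, points with
  three equal coordinates, and points \<open>(p, p, r, t)\<close> with \<open>F + G (p (r + t) + p\<^sup>2 + r t) = 0\<close>.
\<close>

subsection \<open>Points of four-space\<close>

text \<open>The equivariant pairs form a free module of rank 2 over the symmetric polynomial
  functions. Its generators are A, B in degree 2 and y1^2 - y3^2, y2^2 - y3^2 in degree 4, whence
  the degrees a - 2 and a - 4. The obstacle in the converse is that regularity of F, G, f1, f2 is
  not enough: on x0 = x1 the form h2 vanishes identically, so F + G (y1 + y3) must not vanish at the
  common zeros of f1 and f2 there. Since only the degrees are prescribed, F, G, f1, f2 may be chosen
  afresh. Mostly the choice is such that on each family of dangerous points a single term survives,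
  or all terms are positive integer multiples of one power of p; where this is out of reach, a
  generic scalar is inserted. The arithmetic conditions come from eigenvectors of permutations: a
  symmetric form can be nonzero at an eigenvector only if its degree is a multiple of the order of
  the eigenvalue. All dimension arguments reduce to two forms on a three-dimensional space, treated
  by a resultant and the fundamental theorem of algebra.\<close>

lemma UNIV_four: "(UNIV :: 4 set) = {0, 1, 2, 3}"
proof -
  have "x \<in> {0, 1, 2, 3}" for x :: 4
  proof (cases x rule: bit0.cases)
    case (1 z)
    then have "z = 0 \<or> z = 1 \<or> z = 2 \<or> z = 3" by auto
    then show ?thesis using 1 by auto
  qed
  then show ?thesis by blast
qed

lemma four_neq [simp]:
  "(0::4) \<noteq> 1" "(0::4) \<noteq> 2" "(0::4) \<noteq> 3" "(1::4) \<noteq> 2" "(1::4) \<noteq> 3" "(2::4) \<noteq> 3"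
  by simp_all

lemma all_four: "(\<forall>i::4. P i) \<longleftrightarrow> P 0 \<and> P 1 \<and> P 2 \<and> P 3"
proof
  assume *: "P 0 \<and> P 1 \<and> P 2 \<and> P 3"
  show "\<forall>i. P i"
  proof
    fix i :: 4
    have "i \<in> {0, 1, 2, 3}" using UNIV_four by blast
    with * show "P i" by blast
  qed
qed blast

lemma sum_four: "(\<Sum>i\<in>(UNIV::4 set). f i) = f 0 + f 1 + f 2 + (f 3 :: 'a::comm_monoid_add)"
  unfolding UNIV_four by (simp add: add.assoc)

lemma prod_four: "(\<Prod>i\<in>(UNIV::4 set). f i) = f 0 * f 1 * f 2 * (f 3 :: 'a::comm_monoid_mult)"
  unfolding UNIV_four by (simp add: mult.assoc)

definition pt :: "'a \<Rightarrow> 'a \<Rightarrow> 'a \<Rightarrow> 'a \<Rightarrow> 4 \<Rightarrow> 'a" where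
  "pt a b c d = (\<lambda>i. if i = 0 then a else if i = 1 then b else if i = 2 then c else d)"

lemma pt_simps [simp]: "pt a b c d 0 = a" "pt a b c d 1 = b" "pt a b c d 2 = c" "pt a b c d 3 = d"
  by (simp_all add: pt_def)

lemma bij_four:
  fixes \<sigma> :: "4 \<Rightarrow> 4"
  assumes "bij \<sigma>"
  shows "(\<sigma> 0, \<sigma> 1, \<sigma> 2, \<sigma> 3) \<in>
    {(0,1,2,3), (0,1,3,2), (0,2,1,3), (0,2,3,1), (0,3,1,2), (0,3,2,1),
     (1,0,2,3), (1,0,3,2), (1,2,0,3), (1,2,3,0), (1,3,0,2), (1,3,2,0),
     (2,0,1,3), (2,0,3,1), (2,1,0,3), (2,1,3,0), (2,3,0,1), (2,3,1,0),
     (3,0,1,2), (3,0,2,1), (3,1,0,2), (3,1,2,0), (3,2,0,1), (3,2,1,0)}"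
proof -
  have r: "i \<in> {0, 1, 2, 3}" for i :: 4
    using UNIV_four by blast
  have "inj \<sigma>" using assms by (rule bij_is_inj)
  then have "\<sigma> 0 \<noteq> \<sigma> 1" "\<sigma> 0 \<noteq> \<sigma> 2" "\<sigma> 0 \<noteq> \<sigma> 3" "\<sigma> 1 \<noteq> \<sigma> 2" "\<sigma> 1 \<noteq> \<sigma> 3" "\<sigma> 2 \<noteq> \<sigma> 3"
    by (simp_all add: inj_eq)
  then show ?thesis
    using r[of "\<sigma> 0"] r[of "\<sigma> 1"] r[of "\<sigma> 2"] r[of "\<sigma> 3"] by (elim insertE emptyE) simp_all
qed

subsection \<open>Polynomial functions and forms\<close>

text \<open>Functions instead of coefficient families: products and substitutions become pointwise,
  and claims can be proved by structural induction. \<open>form_peval\<close> and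
  \<open>form_imp_peval\<close> translate between the two views.\<close>

inductive polyfun :: "((4 \<Rightarrow> complex) \<Rightarrow> complex) \<Rightarrow> bool" where
  const: "polyfun (\<lambda>x. c)"
| var: "polyfun (\<lambda>x. x i)"
| add: "polyfun f \<Longrightarrow> polyfun g \<Longrightarrow> polyfun (\<lambda>x. f x + g x)"
| mult: "polyfun f \<Longrightarrow> polyfun g \<Longrightarrow> polyfun (\<lambda>x. f x * g x)"

named_theorems polyfun_intros
lemmas [polyfun_intros] = polyfun.intros

lemma polyfun_minus [polyfun_intros]: "polyfun f \<Longrightarrow> polyfun (\<lambda>x. - f x)"
  using polyfun.mult[OF polyfun.const[of "-1"], of f] by simp

lemma polyfun_diff [polyfun_intros]: "polyfun f \<Longrightarrow> polyfun g \<Longrightarrow> polyfun (\<lambda>x. f x - g x)"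
  using polyfun.add[OF _ polyfun_minus, of f g] by simp

lemma polyfun_power [polyfun_intros]: "polyfun f \<Longrightarrow> polyfun (\<lambda>x. f x ^ n)"
  by (induction n) (simp_all add: polyfun.intros)

lemma polyfun_sum [polyfun_intros]:
  "(\<And>i. i \<in> S \<Longrightarrow> polyfun (f i)) \<Longrightarrow> polyfun (\<lambda>x. \<Sum>i\<in>S. f i x)"
  by (induction S rule: infinite_finite_induct) (simp_all add: polyfun.intros)

lemma polyfun_prod [polyfun_intros]:
  "(\<And>i. i \<in> S \<Longrightarrow> polyfun (f i)) \<Longrightarrow> polyfun (\<lambda>x. \<Prod>i\<in>S. f i x)"
  by (induction S rule: infinite_finite_induct) (simp_all add: polyfun.intros)

lemma polyfun_compose: "polyfun f \<Longrightarrow> (\<And>i. polyfun (\<lambda>x. L x i)) \<Longrightarrow> polyfun (\<lambda>x. f (L x))"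
  by (induction rule: polyfun.induct) (simp_all add: polyfun.intros)

text \<open>The zero function is a form of every degree, in contrast to \<open>homog_of_deg\<close>;
  sums and differences then need no side conditions.\<close>

definition form :: "nat \<Rightarrow> ((4 \<Rightarrow> complex) \<Rightarrow> complex) \<Rightarrow> bool" where
  "form m f \<longleftrightarrow> polyfun f \<and> (\<forall>c x. f (\<lambda>i. c * x i) = c ^ m * f x)"

abbreviation monom_val :: "expo \<Rightarrow> (4 \<Rightarrow> complex) \<Rightarrow> complex" where
  "monom_val e x \<equiv> (\<Prod>i\<in>UNIV. x i ^ e i)"

lemma peval_superset: "finite S \<Longrightarrow> {e. p e \<noteq> 0} \<subseteq> S \<Longrightarrow> peval p x = (\<Sum>e\<in>S. p e * monom_val e x)"
  unfolding peval_def by (rule sum.mono_neutral_left) auto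

lemma finite_total_deg: "finite {e. total_deg e = m}"
proof -
  have "e \<in> PiE UNIV (\<lambda>_. {..m})" if "total_deg e = m" for e
    using that member_le_sum[of _ "UNIV :: 4 set" e] unfolding total_deg_def
    by (auto simp: PiE_UNIV_domain)
  then have "{e. total_deg e = m} \<subseteq> PiE UNIV (\<lambda>_. {..m})" by blast
  then show ?thesis by (rule finite_subset) (auto intro: finite_PiE)
qed

definition supp_deg :: "nat \<Rightarrow> cpoly \<Rightarrow> bool" where
  "supp_deg m p \<longleftrightarrow> (\<forall>e. p e \<noteq> 0 \<longrightarrow> total_deg e = m)"

lemma homog_of_deg_iff: "homog_of_deg m p \<longleftrightarrow> p \<noteq> (\<lambda>_. 0) \<and> supp_deg m p"
  unfolding homog_of_deg_def supp_deg_def by (auto simp: fun_eq_iff)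

lemma peval_supp_deg:
  "supp_deg m p \<Longrightarrow> peval p x = (\<Sum>e\<in>{e. total_deg e = m}. p e * monom_val e x)"
  by (rule peval_superset) (auto simp: finite_total_deg supp_deg_def)

lemma monom_val_scale: "monom_val e (\<lambda>i. c * x i) = c ^ total_deg e * monom_val e x"
  by (simp add: power_mult_distrib prod.distrib total_deg_def power_sum)

lemma form_peval: assumes "supp_deg m p" shows "form m (peval p)"
proof -
  have "polyfun (\<lambda>x. \<Sum>e\<in>{e. total_deg e = m}. p e * monom_val e x)"
    by (intro polyfun_intros)
  then have "polyfun (peval p)"
    using peval_supp_deg[OF assms] by presburger
  moreover have "peval p (\<lambda>i. c * x i) = c ^ m * peval p x" for c x
    unfolding peval_supp_deg[OF assms] monom_val_scale sum_distrib_left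
    by (rule sum.cong) auto
  ultimately show ?thesis by (simp add: form_def)
qed

lemma peval_single:
  "finite {e. (if e = u then c else 0 :: complex) \<noteq> 0}"
  "peval (\<lambda>e. if e = u then c else 0) x = c * monom_val u x"
proof -
  have s: "{e. (if e = u then c else 0 :: complex) \<noteq> 0} \<subseteq> {u}" by auto
  show "finite {e. (if e = u then c else 0 :: complex) \<noteq> 0}" by (rule finite_subset[OF s]) simp
  show "peval (\<lambda>e. if e = u then c else 0) x = c * monom_val u x"
    by (subst peval_superset[OF _ s]) auto
qed

lemma polyfun_imp_peval:
  assumes "polyfun f"
  shows "\<exists>p. finite {e. p e \<noteq> 0} \<and> f = peval p"
  using assms
proof induction
  case (const c)
  have "(\<lambda>x. c) = peval (\<lambda>e. if e = (\<lambda>_. 0) then c else 0)"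
    unfolding peval_single by simp
  then show ?case by (intro exI[of _ "\<lambda>e. if e = (\<lambda>_. 0) then c else 0"] conjI peval_single(1))
next
  case (var i)
  define u :: expo where "u = (\<lambda>j. if j = i then 1 else 0)"
  have "monom_val u x = x i" for x :: "4 \<Rightarrow> complex"
  proof -
    have "monom_val u x = (\<Prod>j\<in>UNIV. if j = i then x i else 1)"
      by (rule prod.cong) (auto simp: u_def)
    then show ?thesis by simp
  qed
  then have "(\<lambda>x. x i) = peval (\<lambda>e. if e = u then 1 else 0)"
    unfolding peval_single by simp
  then show ?case by (intro exI[of _ "\<lambda>e. if e = u then 1 else 0"] conjI peval_single(1))
next
  case (add f g)
  from add.IH obtain p q where p: "finite {e. p e \<noteq> 0}" "f = peval p"
    and q: "finite {e. q e \<noteq> 0}" "g = peval q"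
    by (elim exE conjE)
  let ?S = "{e. p e \<noteq> 0} \<union> {e. q e \<noteq> 0}"
  have s: "{e. p e + q e \<noteq> 0} \<subseteq> ?S" by auto
  have fin: "finite ?S" using p(1) q(1) by (rule finite_UnI)
  have "f x + g x = peval (\<lambda>e. p e + q e) x" for x
  proof -
    have "f x = (\<Sum>e\<in>?S. p e * monom_val e x)" "g x = (\<Sum>e\<in>?S. q e * monom_val e x)"
      unfolding p(2) q(2) by (rule peval_superset[OF fin], blast)+
    then show ?thesis
      by (simp only: peval_superset[OF fin s] sum.distrib distrib_right)
  qed
  then show ?case
    by (intro exI[of _ "\<lambda>e. p e + q e"] conjI ext finite_subset[OF s fin])
next
  case (mult f g)
  from mult.IH obtain p q where p: "finite {e. p e \<noteq> 0}" "f = peval p"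
    and q: "finite {e. q e \<noteq> 0}" "g = peval q"
    by (elim exE conjE)
  let ?P = "{e. p e \<noteq> 0}" and ?Q = "{e. q e \<noteq> 0}"
  let ?a = "\<lambda>(e, e'). (\<lambda>i. e i + e' i) :: expo"
  let ?r = "\<lambda>e. \<Sum>z\<in>{z \<in> ?P \<times> ?Q. ?a z = e}. p (fst z) * q (snd z)"
  let ?S = "?a ` (?P \<times> ?Q)"
  have fin: "finite ?S" using p q by simp
  have s: "{e. ?r e \<noteq> 0} \<subseteq> ?S"
  proof
    fix e assume "e \<in> {e. ?r e \<noteq> 0}"
    then have "?r e \<noteq> 0" by simp
    then have "{z \<in> ?P \<times> ?Q. ?a z = e} \<noteq> {}" by (metis (no_types, lifting) sum.empty)
    then show "e \<in> ?S" by blast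
  qed
  have "f x * g x = peval ?r x" for x
  proof -
    have "f x * g x = (\<Sum>z\<in>?P \<times> ?Q. p (fst z) * q (snd z) * monom_val (?a z) x)"
      unfolding p(2) q(2) peval_def sum_product sum.cartesian_product
      by (rule sum.cong) (auto simp: power_add prod.distrib)
    also have "\<dots> = (\<Sum>e\<in>?S. \<Sum>z\<in>{z \<in> ?P \<times> ?Q. ?a z = e}. p (fst z) * q (snd z) * monom_val (?a z) x)"
      using p q by (intro sum.group[symmetric]) auto
    also have "\<dots> = (\<Sum>e\<in>?S. ?r e * monom_val e x)"
      by (intro sum.cong[OF refl]) (simp add: sum_distrib_right)
    also have "\<dots> = peval ?r x"
      using peval_superset[OF fin s] by simp
    finally show ?thesis .
  qed
  then show ?case by (intro exI[of _ ?r] conjI ext finite_subset[OF s fin])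
qed

text \<open>A family representing \<open>f\<close> might contain terms of other degrees. At a fixed
  \<open>x\<close> both sides of the scaling law are polynomials in the scalar, and comparing
  coefficients of its \<open>m\<close>-th power shows that the terms of degree \<open>m\<close>
  alone already give \<open>f\<close>.\<close>

lemma form_imp_peval:
  assumes "form m f"
  obtains p where "supp_deg m p" "f = peval p"
proof -
  from assms obtain q where q: "finite {e. q e \<noteq> 0}" "f = peval q"
    using polyfun_imp_peval unfolding form_def by blast
  define p where "p e = (if total_deg e = m then q e else 0)" for e
  let ?S = "{e. q e \<noteq> 0}"
  have "f x = peval p x" for x
  proof -
    define P where "P = (\<Sum>e\<in>?S. monom (q e * monom_val e x) (total_deg e))"
    have "poly P c = poly (monom (f x) m) c" for c
    proof -
      have "poly P c = f (\<lambda>i. c * x i)"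
        unfolding q(2) peval_def monom_val_scale P_def
        by (simp add: poly_sum poly_monom mult_ac)
      then show ?thesis using assms by (simp add: form_def poly_monom mult.commute)
    qed
    then have "P = monom (f x) m" by (intro poly_eq_poly_eq_iff[THEN iffD1] ext)
    then have "f x = coeff P m" by simp
    also have "\<dots> = (\<Sum>e\<in>?S. p e * monom_val e x)"
      unfolding P_def coeff_sum by (rule sum.cong) (auto simp: p_def)
    also have "\<dots> = peval p x"
      using peval_superset[of ?S p x] q(1) by (auto simp: p_def subset_iff)
    finally show ?thesis .
  qed
  moreover have "supp_deg m p" by (auto simp: supp_deg_def p_def split: if_splits)
  ultimately show ?thesis using that by blast
qed

lemma form_intros:
  "form 0 (\<lambda>x. c)"
  "form 1 (\<lambda>x. x i)"
  "form m f \<Longrightarrow> form m g \<Longrightarrow> form m (\<lambda>x. f x + g x)"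
  "form m f \<Longrightarrow> form m g \<Longrightarrow> form m (\<lambda>x. f x - g x)"
  "form m f \<Longrightarrow> form n g \<Longrightarrow> form (m + n) (\<lambda>x. f x * g x)"
  "form m f \<Longrightarrow> form m (\<lambda>x. k * f x)"
  "form m (\<lambda>x. 0)"
  unfolding form_def by (auto intro!: polyfun_intros simp: algebra_simps power_add)

lemma form_power: "form m f \<Longrightarrow> form (m * n) (\<lambda>x. f x ^ n)"
  unfolding form_def by (auto intro!: polyfun_intros simp: power_mult_distrib power_mult)

lemma form_power': "form m f \<Longrightarrow> m * n = k \<Longrightarrow> form k (\<lambda>x. f x ^ n)"
  using form_power by blast

lemma form_mult': "form m f \<Longrightarrow> form n g \<Longrightarrow> m + n = k \<Longrightarrow> form k (\<lambda>x. f x * g x)"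
  using form_intros(5) by blast

lemma form_polyfun: "form m f \<Longrightarrow> polyfun f"
  by (simp add: form_def)

lemma form_scale: "form m f \<Longrightarrow> f (\<lambda>i. c * x i) = c ^ m * f x"
  by (simp add: form_def)

lemma form_zero: "form m f \<Longrightarrow> 0 < m \<Longrightarrow> f (\<lambda>_. 0) = 0"
  using form_scale[of m f 0] by (simp add: power_0_left)

section \<open>Restriction to lines, and divisibility by linear factors\<close>

lemma polyfun_line:
  "polyfun f \<Longrightarrow> \<exists>q. \<forall>t. f (\<lambda>i. x i + t * v i) = poly q t"
proof (induction rule: polyfun.induct)
  case (const c)
  show ?case by (rule exI[of _ "[:c:]"]) simp
next
  case (var i)
  show ?case by (rule exI[of _ "[:x i, v i:]"]) simp
next
  case (add f g)
  then obtain p q where "\<forall>t. f (\<lambda>i. x i + t * v i) = poly p t" "\<forall>t. g (\<lambda>i. x i + t * v i) = poly q t"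
    by blast
  then show ?case by (intro exI[of _ "p + q"]) simp
next
  case (mult f g)
  then obtain p q where "\<forall>t. f (\<lambda>i. x i + t * v i) = poly p t" "\<forall>t. g (\<lambda>i. x i + t * v i) = poly q t"
    by blast
  then show ?case by (intro exI[of _ "p * q"]) simp
qed

text \<open>Restrict to the line through \<open>a\<close> and \<open>b\<close>: univariate
  polynomials have no zero divisors, and the restriction of \<open>f\<close> is nonzero at the
  parameter of \<open>a\<close>.\<close>

lemma polyfun_mult_eq_0:
  assumes "polyfun f" "polyfun g" "\<And>x. f x * g x = 0" "f a \<noteq> 0"
  shows "g b = 0"
proof -
  obtain p q where p: "\<And>t. f (\<lambda>i. a i + t * (b i - a i)) = poly p t"
    and q: "\<And>t. g (\<lambda>i. a i + t * (b i - a i)) = poly q t"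
    using polyfun_line assms(1,2) by metis
  have "poly (p * q) t = poly 0 t" for t
    using assms(3)[of "\<lambda>i. a i + t * (b i - a i)"] by (simp add: p q)
  then have "p * q = 0" by (intro poly_eq_poly_eq_iff[THEN iffD1] ext)
  moreover have "p \<noteq> 0" using p[of 0] assms(4) by auto
  ultimately have "q = 0" by simp
  then show ?thesis using q[of 1] by simp
qed

text \<open>A factor theorem by structural induction; for products the difference telescopes through
  the mixed term \<open>f (x(i := x j)) * g x\<close>.\<close>

lemma polyfun_diff_dvd:
  "polyfun f \<Longrightarrow> \<exists>g. polyfun g \<and> (\<forall>x. f x - f (x(i := x j)) = (x i - x j) * g x)"
proof (induction rule: polyfun.induct)
  case (const c)
  show ?case by (rule exI[of _ "\<lambda>x. 0"]) (simp add: polyfun.intros)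
next
  case (var k)
  show ?case by (rule exI[of _ "\<lambda>x. if k = i then 1 else 0"]) (simp add: polyfun.intros)
next
  case (add f g)
  then obtain p q where *: "polyfun p" "\<forall>x. f x - f (x(i := x j)) = (x i - x j) * p x"
    "polyfun q" "\<forall>x. g x - g (x(i := x j)) = (x i - x j) * q x" by blast
  have "f x + g x - (f (x(i := x j)) + g (x(i := x j))) = (x i - x j) * (p x + q x)" for x
  proof -
    have "f x + g x - (f (x(i := x j)) + g (x(i := x j)))
      = (f x - f (x(i := x j))) + (g x - g (x(i := x j)))" by simp
    then show ?thesis by (simp only: * distrib_left)
  qed
  then show ?case using * by (intro exI[of _ "\<lambda>x. p x + q x"] conjI allI polyfun.intros)
next
  case (mult f g)
  then obtain p q where *: "polyfun p" "\<forall>x. f x - f (x(i := x j)) = (x i - x j) * p x"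
    "polyfun q" "\<forall>x. g x - g (x(i := x j)) = (x i - x j) * q x" by blast
  have "polyfun (\<lambda>x. f (x(i := x j)))"
  proof (rule polyfun_compose[OF mult.hyps(1)])
    show "polyfun (\<lambda>x. (x(i := x j)) k)" for k
      by (cases "k = i") (simp_all add: polyfun.intros)
  qed
  moreover have "f x * g x - f (x(i := x j)) * g (x(i := x j))
      = (x i - x j) * (p x * g x + f (x(i := x j)) * q x)" for x
  proof -
    have "f x * g x - f (x(i := x j)) * g (x(i := x j))
      = (f x - f (x(i := x j))) * g x + f (x(i := x j)) * (g x - g (x(i := x j)))"
      by (simp add: algebra_simps)
    then show ?thesis by (simp only: * algebra_simps)
  qed
  ultimately show ?case using * mult.hyps
    by (intro exI[of _ "\<lambda>x. p x * g x + f (x(i := x j)) * q x"] conjI allI polyfun.intros)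
qed

lemma polyfun_dvd:
  assumes "polyfun f" "\<And>x. x i = x j \<Longrightarrow> f x = 0" "i \<noteq> j"
  obtains g where "polyfun g" "\<And>x. f x = (x i - x j) * g x"
proof -
  obtain g where "polyfun g" "\<forall>x. f x - f (x(i := x j)) = (x i - x j) * g x"
    using polyfun_diff_dvd[OF assms(1)] by blast
  moreover have "f (x(i := x j)) = 0" for x
    by (rule assms(2)) (use assms(3) in simp)
  ultimately show ?thesis using that by simp
qed

text \<open>Kronecker substitution: on \<open>(t, t\<^sup>K, t\<^sup>K\<^sup>K, \<dots>)\<close> with \<open>K = m + 1\<close>, the monomials of degree \<open>m\<close> become
  distinct powers of \<open>t\<close>.\<close>

lemma peval_eq_0:
  assumes p: "supp_deg m p" and 0: "\<And>x. peval p x = 0"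
  shows "p = (\<lambda>_. 0)"
proof
  fix e
  let ?S = "{e. total_deg e = m}"
  define K where "K = Suc m"
  define code :: "expo \<Rightarrow> nat" where "code e = e 0 + K * (e 1 + K * (e 2 + K * e 3))" for e
  have inj: "inj_on code ?S"
  proof (rule inj_onI)
    fix e e' assume e: "e \<in> ?S" "e' \<in> ?S" and eq: "code e = code e'"
    have lt: "e i < K" "e' i < K" for i
      using e member_le_sum[of i "UNIV :: 4 set" e] member_le_sum[of i "UNIV :: 4 set" e']
      by (auto simp: total_deg_def K_def)
    have step: "a = a' \<and> b = b'" if "a + K * b = a' + K * b'" "a < K" "a' < K" for a a' b b'
    proof -
      have "(a + K * b) mod K = (a' + K * b') mod K" using that(1) by simp
      then have "a = a'" using that(2,3) by simp
      then show ?thesis using that by auto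
    qed
    have "e 0 = e' 0 \<and> e 1 = e' 1 \<and> e 2 = e' 2 \<and> e 3 = e' 3"
      using step[OF eq[unfolded code_def] lt] step[OF _ lt(1)[of 1] lt(2)[of 1]]
        step[OF _ lt(1)[of 2] lt(2)[of 2]] by blast
    then show "e = e'" by (simp add: fun_eq_iff all_four)
  qed
  define P where "P = (\<Sum>e\<in>?S. monom (p e) (code e))"
  have "poly P t = poly 0 t" for t
  proof -
    have "monom_val e (pt t (t ^ K) (t ^ (K * K)) (t ^ (K * K * K))) = t ^ code e" for e
      by (simp add: prod_four code_def power_add power_mult mult.assoc)
    then have "poly P t = peval p (pt t (t ^ K) (t ^ (K * K)) (t ^ (K * K * K)))"
      unfolding P_def peval_supp_deg[OF p] by (simp add: poly_sum poly_monom)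
    then show ?thesis using 0 by simp
  qed
  then have "P = 0" by (intro poly_eq_poly_eq_iff[THEN iffD1] ext)
  show "p e = 0"
  proof (cases "e \<in> ?S")
    case True
    have "coeff P (code e) = (\<Sum>e'\<in>?S. if e' = e then p e' else 0)"
      unfolding P_def coeff_sum using inj True by (intro sum.cong) (auto simp: inj_on_def)
    also have "\<dots> = p e" using True finite_total_deg by simp
    finally show ?thesis using \<open>P = 0\<close> by simp
  qed (use p in \<open>auto simp: supp_deg_def\<close>)
qed

section \<open>Linear combinations and permutations of coefficient families\<close>

lemma supp_deg_lc: "supp_deg m p \<Longrightarrow> supp_deg m q \<Longrightarrow> supp_deg m (lc \<alpha> p \<beta> q)"
  unfolding supp_deg_def lc_def by (metis add_0 mult_zero_right)

lemma peval_lc: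
  assumes "supp_deg m p" "supp_deg m q"
  shows "peval (lc \<alpha> p \<beta> q) x = \<alpha> * peval p x + \<beta> * peval q x"
  unfolding peval_supp_deg[OF assms(1)] peval_supp_deg[OF assms(2)]
    peval_supp_deg[OF supp_deg_lc[OF assms]]
  by (simp add: lc_def sum_distrib_left algebra_simps sum.distrib)

lemma peval_inj:
  assumes "supp_deg m p" "supp_deg m q" "\<And>x. peval p x = peval q x"
  shows "p = q"
proof -
  have "lc 1 p (-1) q = (\<lambda>_. 0)"
    using assms by (intro peval_eq_0[of m] supp_deg_lc) (simp_all add: peval_lc)
  then show ?thesis by (simp add: lc_def fun_eq_iff)
qed

lemma total_deg_comp: "bij \<sigma> \<Longrightarrow> total_deg (e \<circ> \<sigma>) = total_deg e"
  unfolding total_deg_def comp_def by (rule sum.reindex_bij_betw)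

lemma supp_deg_perm_act: "bij \<sigma> \<Longrightarrow> supp_deg m p \<Longrightarrow> supp_deg m (perm_act \<sigma> p)"
  using total_deg_comp by (fastforce simp: supp_deg_def perm_act_def)

lemma peval_perm_act:
  assumes "bij \<sigma>" "supp_deg m p"
  shows "peval (perm_act \<sigma> p) x = peval p (x \<circ> \<sigma>)"
proof -
  define \<tau> where "\<tau> = inv_into UNIV \<sigma>"
  have \<tau>: "bij \<tau>" "\<And>i. \<tau> (\<sigma> i) = i" "\<And>i. \<sigma> (\<tau> i) = i"
    using assms(1) by (auto simp: \<tau>_def bij_imp_bij_inv bij_is_inj bij_is_surj surj_f_inv_f)
  have "(\<Sum>e | total_deg e = m. p (e \<circ> \<sigma>) * monom_val e x)
      = (\<Sum>e | total_deg e = m. p e * monom_val e (x \<circ> \<sigma>))"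
  proof (rule sum.reindex_bij_witness[of _ "\<lambda>e. e \<circ> \<tau>" "\<lambda>e. e \<circ> \<sigma>"])
    fix e assume e: "e \<in> {e. total_deg e = m}"
    show "e \<circ> \<tau> \<in> {e. total_deg e = m}"
      using e total_deg_comp[OF \<tau>(1)] by simp
    show "e \<circ> \<tau> \<circ> \<sigma> = e" using \<tau> by (simp add: fun_eq_iff)
    show "e \<circ> \<sigma> \<in> {e. total_deg e = m}" using e total_deg_comp[OF assms(1)] by simp
    show "e \<circ> \<sigma> \<circ> \<tau> = e" using \<tau> by (simp add: fun_eq_iff)
    have "monom_val (e \<circ> \<sigma>) (x \<circ> \<sigma>) = monom_val e x"
      using prod.reindex_bij_betw[OF assms(1), of "\<lambda>i. x i ^ e i"] by simp
    then show "p (e \<circ> \<sigma>) * monom_val (e \<circ> \<sigma>) (x \<circ> \<sigma>) = p (e \<circ> \<sigma>) * monom_val e x" by simp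
  qed
  then show ?thesis
    unfolding peval_supp_deg[OF assms(2)] peval_supp_deg[OF supp_deg_perm_act[OF assms]]
    by (simp add: perm_act_def)
qed

subsection \<open>Common zeros of forms\<close>

text \<open>The restriction to a line is written out explicitly, so that its coefficients visibly
  depend polynomially on the base point \<open>x\<close> and the coefficient of degree
  \<open>m\<close> is the value at the direction \<open>v\<close>.\<close>

definition line_poly :: "nat \<Rightarrow> cpoly \<Rightarrow> (4 \<Rightarrow> complex) \<Rightarrow> (4 \<Rightarrow> complex) \<Rightarrow> complex poly" where
  "line_poly m p x v = (\<Sum>e | total_deg e = m. smult (p e) (\<Prod>i\<in>UNIV. [:x i, v i:] ^ e i))"

lemma poly_line_poly: "supp_deg m p \<Longrightarrow> poly (line_poly m p x v) t = peval p (\<lambda>i. x i + t * v i)"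
  by (simp add: line_poly_def peval_supp_deg poly_sum poly_prod)

text \<open>Upper bounds in place of exact degrees, because a factor \<open>[:x i, v i:]\<close> of
  \<open>line_poly\<close> drops to degree 0 when \<open>v i = 0\<close>.\<close>

lemma coeff_mult_bound:
  fixes P Q :: "'a::idom poly"
  assumes "degree P \<le> m" "degree Q \<le> n"
  shows "degree (P * Q) \<le> m + n" "coeff (P * Q) (m + n) = coeff P m * coeff Q n"
proof -
  show "degree (P * Q) \<le> m + n"
    using assms degree_mult_le[of P Q] by linarith
  show "coeff (P * Q) (m + n) = coeff P m * coeff Q n"
  proof (cases "degree P = m \<and> degree Q = n")
    case True
    then show ?thesis using coeff_mult_degree_sum[of P Q] by simp
  next
    case False
    then have "degree P < m \<or> degree Q < n" using assms by linarith
    moreover from this have "degree (P * Q) < m + n"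
      using assms degree_mult_le[of P Q] by linarith
    ultimately show ?thesis by (auto simp: coeff_eq_0)
  qed
qed

lemma coeff_power_bound:
  fixes P :: "'a::idom poly"
  assumes "degree P \<le> m"
  shows "degree (P ^ n) \<le> m * n \<and> coeff (P ^ n) (m * n) = coeff P m ^ n"
proof (induction n)
  case (Suc n)
  then show ?case
    using coeff_mult_bound[OF assms, of "P ^ n" "m * n"] by simp
qed simp

lemma coeff_prod_bound:
  fixes P :: "'b \<Rightarrow> 'a::idom poly"
  assumes "finite S" "\<And>i. i \<in> S \<Longrightarrow> degree (P i) \<le> d i"
  shows "degree (prod P S) \<le> sum d S \<and> coeff (prod P S) (sum d S) = (\<Prod>i\<in>S. coeff (P i) (d i))"
  using assms
proof (induction rule: finite_induct)
  case (insert i S)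
  then have "degree (prod P S) \<le> sum d S \<and> coeff (prod P S) (sum d S) = (\<Prod>i\<in>S. coeff (P i) (d i))"
    by blast
  then show ?case
    using coeff_mult_bound[of "P i" "d i" "prod P S" "sum d S"] insert by simp
qed simp

lemma line_poly_bound:
  assumes "supp_deg m p"
  shows "degree (line_poly m p x v) \<le> m" "coeff (line_poly m p x v) m = peval p v"
proof -
  have *: "degree (\<Prod>i\<in>UNIV. [:x i, v i:] ^ e i) \<le> m"
    "coeff (\<Prod>i\<in>UNIV. [:x i, v i:] ^ e i) m = monom_val e v"
    if "total_deg e = m" for e
  proof -
    have l: "degree [:x i, v i:] \<le> 1" for i by simp
    have "degree (\<Prod>i\<in>UNIV. [:x i, v i:] ^ e i) \<le> sum e UNIV
      \<and> coeff (\<Prod>i\<in>UNIV. [:x i, v i:] ^ e i) (sum e UNIV)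
        = (\<Prod>i\<in>UNIV. coeff ([:x i, v i:] ^ e i) (e i))"
      by (rule coeff_prod_bound) (use coeff_power_bound[OF l] in auto)
    moreover have "coeff ([:x i, v i:] ^ e i) (e i) = v i ^ e i" for i
      using coeff_power_bound[OF l[of i], of "e i"] by simp
    ultimately show "degree (\<Prod>i\<in>UNIV. [:x i, v i:] ^ e i) \<le> m"
      "coeff (\<Prod>i\<in>UNIV. [:x i, v i:] ^ e i) m = monom_val e v"
      using that by (simp_all add: total_deg_def)
  qed
  show "degree (line_poly m p x v) \<le> m"
    unfolding line_poly_def
    by (rule degree_sum_le) (use finite_total_deg * degree_smult_le in \<open>auto intro: order_trans\<close>)
  show "coeff (line_poly m p x v) m = peval p v"
    unfolding line_poly_def peval_supp_deg[OF assms] coeff_sum using * by simp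
qed

section \<open>Resultants of polynomials with varying coefficients\<close>

definition coeffs_polyfun :: "((4 \<Rightarrow> complex) \<Rightarrow> complex poly) \<Rightarrow> bool" where
  "coeffs_polyfun P \<longleftrightarrow> (\<forall>k. polyfun (\<lambda>x. coeff (P x) k))"

lemma coeffs_polyfun_intros:
  "coeffs_polyfun (\<lambda>x. Q)"
  "coeffs_polyfun (\<lambda>x. [:x i, c:])"
  "coeffs_polyfun P \<Longrightarrow> coeffs_polyfun (\<lambda>x. smult c (P x))"
proof -
  have "polyfun (\<lambda>x. coeff [:x i, c:] k)" for k
    by (cases k rule: nat.exhaust) (simp_all add: polyfun.intros)
  then show "coeffs_polyfun (\<lambda>x. [:x i, c:])" by (simp add: coeffs_polyfun_def)
qed (simp_all add: coeffs_polyfun_def polyfun.intros)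

lemma coeffs_polyfun_mult:
  "coeffs_polyfun P \<Longrightarrow> coeffs_polyfun Q \<Longrightarrow> coeffs_polyfun (\<lambda>x. P x * Q x)"
  by (simp add: coeffs_polyfun_def coeff_mult polyfun_sum polyfun.mult)

lemma coeffs_polyfun_power: "coeffs_polyfun P \<Longrightarrow> coeffs_polyfun (\<lambda>x. P x ^ n)"
  by (induction n) (simp_all add: coeffs_polyfun_mult coeffs_polyfun_intros(1))

lemma coeffs_polyfun_prod:
  "(\<And>i. i \<in> S \<Longrightarrow> coeffs_polyfun (P i)) \<Longrightarrow> coeffs_polyfun (\<lambda>x. \<Prod>i\<in>S. P i x)"
  by (induction S rule: infinite_finite_induct)
    (simp_all add: coeffs_polyfun_mult coeffs_polyfun_intros(1))

lemma coeffs_polyfun_sum: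
  "(\<And>i. i \<in> S \<Longrightarrow> coeffs_polyfun (P i)) \<Longrightarrow> coeffs_polyfun (\<lambda>x. \<Sum>i\<in>S. P i x)"
  by (simp add: coeffs_polyfun_def coeff_sum polyfun_sum)

lemma coeffs_polyfun_line_poly: "coeffs_polyfun (\<lambda>x. line_poly m p x v)"
  unfolding line_poly_def
  by (intro coeffs_polyfun_sum coeffs_polyfun_intros coeffs_polyfun_prod coeffs_polyfun_power)

text \<open>With both degrees independent of \<open>x\<close>, the Sylvester matrix has a fixed
  size, and its determinant is one fixed polynomial in entries that are polynomial in
  \<open>x\<close>.\<close>

lemma polyfun_resultant:
  assumes "coeffs_polyfun P" "coeffs_polyfun Q" "\<And>x. degree (P x) = m" "\<And>x. degree (Q x) = n"
  shows "polyfun (\<lambda>x. resultant (P x) (Q x))"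
proof -
  have e: "polyfun (\<lambda>x. sylvester_mat_sub m n (P x) (Q x) $$ (i, j))"
    if "i < m + n" "j < m + n" for i j
    using assms(1,2) that
    by (cases "i < n"; cases "i \<le> j \<and> j - i \<le> m"; cases "i - n \<le> j"; cases "j \<le> i")
      (simp_all add: sylvester_mat_sub_index coeffs_polyfun_def polyfun.intros)
  have "polyfun (\<lambda>x. \<Sum>\<pi> | \<pi> permutes {0..<m + n}. signof \<pi> *
      (\<Prod>i = 0..<m + n. sylvester_mat_sub m n (P x) (Q x) $$ (i, \<pi> i)))"
  proof (intro polyfun_sum polyfun.mult polyfun.const polyfun_prod e)
    fix \<pi> i assume "\<pi> \<in> {\<pi>. \<pi> permutes {0..<m + n}}" "i \<in> {0..<m + n}"
    then show "i < m + n" "\<pi> i < m + n"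
      using permutes_in_image[of \<pi> "{0..<m + n}" i] by auto
  qed
  moreover have "resultant (P x) (Q x) = (\<Sum>\<pi> | \<pi> permutes {0..<m + n}. signof \<pi> *
      (\<Prod>i = 0..<m + n. sylvester_mat_sub m n (P x) (Q x) $$ (i, \<pi> i)))" for x
    unfolding resultant_sub resultant_sub_def det_def using assms(3,4) by simp
  ultimately show ?thesis by simp
qed

text \<open>A vanishing resultant means a nonconstant gcd, and over the complex numbers that gcd has
  a root.\<close>

lemma resultant_eq_0_iff:
  fixes P Q :: "complex poly"
  assumes "degree P \<noteq> 0"
  shows "resultant P Q = 0 \<longleftrightarrow> (\<exists>t. poly P t = 0 \<and> poly Q t = 0)"
proof
  assume "resultant P Q = 0"
  then have d: "degree (gcd P Q) \<noteq> 0" by (simp add: resultant_0_gcd)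
  then have "\<not> constant (poly (gcd P Q))" by (simp add: constant_degree)
  then obtain t where "poly (gcd P Q) t = 0" using fundamental_theorem_of_algebra by blast
  then have "[:- t, 1:] dvd gcd P Q" by (simp add: poly_eq_0_iff_dvd)
  then show "\<exists>t. poly P t = 0 \<and> poly Q t = 0"
    by (auto simp: poly_eq_0_iff_dvd)
next
  assume "\<exists>t. poly P t = 0 \<and> poly Q t = 0"
  then obtain t where "[:- t, 1:] dvd P" "[:- t, 1:] dvd Q" by (auto simp: poly_eq_0_iff_dvd)
  then have "[:- t, 1:] dvd gcd P Q" by simp
  moreover have "gcd P Q \<noteq> 0" using assms by auto
  ultimately have "degree [:- t, 1:] \<le> degree (gcd P Q)" by (rule dvd_imp_degree_le)
  then show "resultant P Q = 0" by (simp add: resultant_0_gcd)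
qed

text \<open>A polynomial function of two variables has no isolated zeros: without further zeros it
  would be constant along all lines \<open>v = const \<noteq> 0\<close>, hence also along \<open>v = 0\<close>.\<close>

lemma polyfun_zero_not_isolated:
  assumes r: "polyfun r" and 0: "r (\<lambda>_. 0) = 0"
  shows "\<exists>u v. (u \<noteq> 0 \<or> v \<noteq> 0) \<and> r (\<lambda>i. u * a i + v * b i) = 0"
proof (rule ccontr)
  assume "\<not> ?thesis"
  then have nz: "r (\<lambda>i. u * a i + v * b i) \<noteq> 0" if "u \<noteq> 0 \<or> v \<noteq> 0" for u v
    using that by blast
  have c: "r (\<lambda>i. a i + v * b i) = r (\<lambda>i. v * b i)" if "v \<noteq> 0" for v
  proof -
    obtain q where q: "\<And>t. r (\<lambda>i. v * b i + t * a i) = poly q t"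
      using polyfun_line[OF r] by metis
    have "poly q t \<noteq> 0" for t
      using nz[of t v] that q[of t] by (simp add: add.commute)
    then have "constant (poly q)" using fundamental_theorem_of_algebra by blast
    then have "poly q 1 = poly q 0" by (simp add: Fundamental_Theorem_Algebra.constant_def)
    then show ?thesis using q[of 1] q[of 0] by (simp add: add.commute)
  qed
  obtain p where p: "\<And>t. r (\<lambda>i. a i + t * b i) = poly p t"
    using polyfun_line[OF r] by metis
  obtain q where q: "\<And>t. r (\<lambda>i. 0 + t * b i) = poly q t"
    using polyfun_line[OF r, of "\<lambda>_. 0"] by metis
  have "p = q"
  proof (rule ccontr)
    assume "p \<noteq> q"
    then have "finite {t. poly (p - q) t = 0}" by (intro poly_roots_finite) simp
    moreover have "- {0} \<subseteq> {t. poly (p - q) t = 0}"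
      using c p q by auto
    ultimately have "finite (- {0 :: complex})" by (rule finite_subset[rotated])
    then show False by (simp add: finite_compl infinite_UNIV_char_0)
  qed
  then have "r a = 0" using p[of 0] q[of 0] 0 by simp
  then show False using nz[of 1 0] by simp
qed

text \<open>Projection from \<open>c\<close>. The values \<open>f c\<close> and \<open>g c\<close>
  are the leading coefficients along lines of direction \<open>c\<close>; as they are nonzero, both
  degrees stay equal to \<open>m\<close>, and the resultant is a polynomial function of the base
  point. It vanishes at the origin, hence at a further point of the plane of \<open>a\<close> and
  \<open>b\<close>, and its vanishing there gives a common zero on the line through that
  point.\<close>

lemma form_common_zero_plane:
  assumes f: "form m f" and g: "form m g" and m: "0 < m" and fc: "f c \<noteq> 0" and gc: "g c \<noteq> 0"
  shows "\<exists>u v w. (u \<noteq> 0 \<or> v \<noteq> 0 \<or> w \<noteq> 0) \<and> f (\<lambda>i. u * a i + v * b i + w * c i) = 0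
    \<and> g (\<lambda>i. u * a i + v * b i + w * c i) = 0"
proof -
  obtain p where p: "supp_deg m p" "f = peval p" using form_imp_peval[OF f] .
  obtain q where q: "supp_deg m q" "g = peval q" using form_imp_peval[OF g] .
  let ?P = "\<lambda>x. line_poly m p x c" and ?Q = "\<lambda>x. line_poly m q x c"
  have dP: "degree (?P x) = m" for x
    using line_poly_bound[OF p(1), of x c] fc p(2) by (metis le_degree order_antisym)
  have dQ: "degree (?Q x) = m" for x
    using line_poly_bound[OF q(1), of x c] gc q(2) by (metis le_degree order_antisym)
  let ?r = "\<lambda>x. resultant (?P x) (?Q x)"
  have iff: "?r x = 0 \<longleftrightarrow> (\<exists>t. f (\<lambda>i. x i + t * c i) = 0 \<and> g (\<lambda>i. x i + t * c i) = 0)" for x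
    using m by (simp add: resultant_eq_0_iff dP poly_line_poly p q)
  have "?r (\<lambda>_. 0) = 0"
    \<comment> \<open>On the line through the origin the parameter 0 is a common root.\<close>
    unfolding iff using form_zero[OF f m] form_zero[OF g m] by (intro exI[of _ 0]) simp
  moreover have "polyfun ?r"
    by (intro polyfun_resultant[of _ _ m m] coeffs_polyfun_line_poly dP dQ)
  ultimately obtain u v where "u \<noteq> 0 \<or> v \<noteq> 0" "?r (\<lambda>i. u * a i + v * b i) = 0"
    using polyfun_zero_not_isolated[of ?r a b] by blast
  then show ?thesis unfolding iff by blast
qed

text \<open>Replacing \<open>f, g\<close> by \<open>f\<^sup>n, g\<^sup>m + k f\<^sup>n\<close> keeps the common zeros, equalises the degrees and makes
  both forms nonzero at \<open>c\<close>.\<close>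

lemma form_common_zero_aux:
  assumes f: "form m f" and g: "form n g" and m: "0 < m" and n: "0 < n" and fc: "f c \<noteq> 0"
  shows "\<exists>u v w. (u \<noteq> 0 \<or> v \<noteq> 0 \<or> w \<noteq> 0) \<and> f (\<lambda>i. u * a i + v * b i + w * c i) = 0
    \<and> g (\<lambda>i. u * a i + v * b i + w * c i) = 0"
proof -
  define k :: complex where "k = (if g c = 0 then 1 else 0)"
  define F where "F = (\<lambda>x. f x ^ n)"
  define G where "G = (\<lambda>x. g x ^ m + k * f x ^ n)"
  have F: "form (m * n) F" unfolding F_def by (rule form_power[OF f])
  have G: "form (m * n) G" unfolding G_def
    by (intro form_intros(3,6) form_power[OF f] form_power'[OF g] mult.commute)
  have "F c \<noteq> 0" "G c \<noteq> 0" "0 < m * n" using fc m n by (auto simp: F_def G_def k_def power_0_left)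
  from form_common_zero_plane[OF F G this(3,1,2), of a b] obtain u v w
    where *: "u \<noteq> 0 \<or> v \<noteq> 0 \<or> w \<noteq> 0" "F (\<lambda>i. u * a i + v * b i + w * c i) = 0"
      "G (\<lambda>i. u * a i + v * b i + w * c i) = 0" by blast
  then have "f (\<lambda>i. u * a i + v * b i + w * c i) = 0" "g (\<lambda>i. u * a i + v * b i + w * c i) = 0"
    using m n by (auto simp: F_def G_def power_0_left)
  with * show ?thesis by blast
qed

lemma form_common_zero:
  assumes f: "form m f" and g: "form n g" and m: "0 < m" and n: "0 < n"
  shows "\<exists>u v w. (u \<noteq> 0 \<or> v \<noteq> 0 \<or> w \<noteq> 0) \<and> f (\<lambda>i. u * a i + v * b i + w * c i) = 0
    \<and> g (\<lambda>i. u * a i + v * b i + w * c i) = 0"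
proof -
  consider "f c \<noteq> 0" | "g c \<noteq> 0" | "f c = 0" "g c = 0" by blast
  then show ?thesis
  proof cases
    case 1
    then show ?thesis by (rule form_common_zero_aux[OF f g m n])
  next
    case 2
    then show ?thesis using form_common_zero_aux[OF g f n m, of c a b] by blast
  next
    case 3
    \<comment> \<open>The point \<open>c\<close> itself is a common zero, with u = v = 0 and w =
      1.\<close>
    then show ?thesis by (intro exI[of _ 0] exI[of _ 1]) simp
  qed
qed

lemma form_zero_line:
  assumes f: "form m f" and m: "0 < m"
  shows "\<exists>u v. (u \<noteq> 0 \<or> v \<noteq> 0) \<and> f (\<lambda>i. u * a i + v * b i) = 0"
  by (rule polyfun_zero_not_isolated[OF form_polyfun[OF f] form_zero[OF f m]])

subsection \<open>Equivariant pairs\<close>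

text \<open>\<open>res1\<close>, \<open>res2\<close>, \<open>res3\<close> are the roots of the
  resolvent cubic of the quartic with roots \<open>x 0\<close>, ..., \<open>x 3\<close>.\<close>

definition res1 :: "(4 \<Rightarrow> complex) \<Rightarrow> complex" where "res1 x = x 0 * x 1 + x 2 * x 3"
definition res2 :: "(4 \<Rightarrow> complex) \<Rightarrow> complex" where "res2 x = x 0 * x 2 + x 1 * x 3"
definition res3 :: "(4 \<Rightarrow> complex) \<Rightarrow> complex" where "res3 x = x 0 * x 3 + x 1 * x 2"
definition SA :: "(4 \<Rightarrow> complex) \<Rightarrow> complex" where "SA x = res1 x - res3 x"
definition SB :: "(4 \<Rightarrow> complex) \<Rightarrow> complex" where "SB x = res2 x - res3 x"

lemma SA_factor: "SA x = (x 0 - x 2) * (x 1 - x 3)"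
  by (simp add: SA_def res1_def res3_def algebra_simps)
lemma SB_factor: "SB x = (x 0 - x 1) * (x 2 - x 3)"
  by (simp add: SB_def res2_def res3_def algebra_simps)
lemma SA_SB_factor: "SA x - SB x = (x 0 - x 3) * (x 1 - x 2)"
  by (simp add: SA_def SB_def res1_def res2_def algebra_simps)

lemma form_res: "form 2 res1" "form 2 res2" "form 2 res3" "form 2 SA" "form 2 SB"
proof -
  have q: "form 2 (\<lambda>x. x i * x j)" for i j
    by (rule form_mult'[OF form_intros(2) form_intros(2)]) simp
  show "form 2 res1" "form 2 res2" "form 2 res3"
    unfolding res1_def[abs_def] res2_def[abs_def] res3_def[abs_def] by (intro form_intros(3) q)+
  then show "form 2 SA" "form 2 SB"
    unfolding SA_def[abs_def] SB_def[abs_def] by (simp_all add: form_intros(4))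
qed

lemma supp_deg_mono_ind: "total_deg u = m \<Longrightarrow> supp_deg m (mono_ind u)"
  by (auto simp: supp_deg_def mono_ind_def split: if_splits)

lemma peval_mono_ind: "peval (mono_ind u) x = monom_val u x"
  using peval_single(2)[of u 1 x] by (simp add: mono_ind_def[abs_def])

lemma specht_lc:
  "specht a b c d = lc 1 (lc 1 (mono_ind (sq a b)) (- 1) (mono_ind (sq a d)))
    1 (lc (- 1) (mono_ind (sq c b)) 1 (mono_ind (sq c d)))"
  by (simp add: specht_def lc_def fun_eq_iff)

lemma total_deg_sq: "i \<noteq> j \<Longrightarrow> total_deg (sq i j) = 2"
proof -
  assume "i \<noteq> j"
  then have "sum (sq i j) UNIV = sum (\<lambda>k. (if k = i then 1 else 0) + (if k = j then 1 else 0)) UNIV"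
    by (intro sum.cong) (auto simp: sq_def)
  then show ?thesis by (simp add: total_deg_def sum.distrib)
qed

lemma specht_eval:
  "supp_deg 2 spechtA" "supp_deg 2 spechtB" "peval spechtA = SA" "peval spechtB = SB"
proof -
  have s: "supp_deg 2 (mono_ind (sq i j))" if "i \<noteq> j" for i j
    using that by (intro supp_deg_mono_ind total_deg_sq)
  have ne: "(1::4) \<noteq> 0" "(2::4) \<noteq> 0" "(3::4) \<noteq> 0" "(2::4) \<noteq> 1" "(3::4) \<noteq> 1" "(3::4) \<noteq> 2"
    using four_neq by metis+
  show "supp_deg 2 spechtA" "supp_deg 2 spechtB"
    unfolding spechtA_def spechtB_def specht_lc by (intro supp_deg_lc s four_neq ne)+
  have e: "peval (specht a b c d) x = peval (mono_ind (sq a b)) x - peval (mono_ind (sq a d)) x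
      - peval (mono_ind (sq c b)) x + peval (mono_ind (sq c d)) x"
    if "a \<noteq> b" "a \<noteq> d" "c \<noteq> b" "c \<noteq> d" for a b c d x
    unfolding specht_lc using that by (simp add: peval_lc[of 2] supp_deg_lc s)
  show "peval spechtA = SA"
    unfolding spechtA_def
    by (rule ext, subst e) (simp_all add: ne peval_mono_ind prod_four sq_def SA_factor algebra_simps)
  show "peval spechtB = SB"
    unfolding spechtB_def
    by (rule ext, subst e) (simp_all add: ne peval_mono_ind prod_four sq_def SB_factor algebra_simps)
qed

text \<open>The three functions correspond to the three splittings of the indices into two pairs.
  Every permutation permutes these splittings, and the six alternatives are the elements of the
  quotient S_3 of S_4.\<close>

lemma res_perm:
  assumes "bij \<sigma>"
  shows "(\<forall>x. res1 (x \<circ> \<sigma>) = res1 x \<and> res2 (x \<circ> \<sigma>) = res2 x \<and> res3 (x \<circ> \<sigma>) = res3 x)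
    \<or> (\<forall>x. res1 (x \<circ> \<sigma>) = res1 x \<and> res2 (x \<circ> \<sigma>) = res3 x \<and> res3 (x \<circ> \<sigma>) = res2 x)
    \<or> (\<forall>x. res1 (x \<circ> \<sigma>) = res2 x \<and> res2 (x \<circ> \<sigma>) = res1 x \<and> res3 (x \<circ> \<sigma>) = res3 x)
    \<or> (\<forall>x. res1 (x \<circ> \<sigma>) = res2 x \<and> res2 (x \<circ> \<sigma>) = res3 x \<and> res3 (x \<circ> \<sigma>) = res1 x)
    \<or> (\<forall>x. res1 (x \<circ> \<sigma>) = res3 x \<and> res2 (x \<circ> \<sigma>) = res1 x \<and> res3 (x \<circ> \<sigma>) = res2 x)
    \<or> (\<forall>x. res1 (x \<circ> \<sigma>) = res3 x \<and> res2 (x \<circ> \<sigma>) = res2 x \<and> res3 (x \<circ> \<sigma>) = res1 x)"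
proof -
  have c: "a * b + c * d = c * d + a * b" for a b c d :: complex by simp
  show ?thesis
    using bij_four[OF assms]
    by (elim insertE emptyE)
      (simp_all add: res1_def res2_def res3_def comp_def mult.commute add.commute)
qed

text \<open>The matrix of a permutation in the basis \<open>SA\<close>, \<open>SB\<close> is also its matrix on the second copy
  \<open>SA * (res1 + res3)\<close>, \<open>SB * (res2 + res3)\<close> of the Specht module.\<close>

lemma specht_matrix:
  assumes "bij \<sigma>"
  obtains \<alpha> \<beta> \<gamma> \<delta> where
    "\<And>x. SA (x \<circ> \<sigma>) = \<alpha> * SA x + \<beta> * SB x" "\<And>x. SB (x \<circ> \<sigma>) = \<gamma> * SA x + \<delta> * SB x"
    "\<And>x. SA (x \<circ> \<sigma>) * (res1 (x \<circ> \<sigma>) + res3 (x \<circ> \<sigma>)) =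
        \<alpha> * (SA x * (res1 x + res3 x)) + \<beta> * (SB x * (res2 x + res3 x))"
    "\<And>x. SB (x \<circ> \<sigma>) * (res2 (x \<circ> \<sigma>) + res3 (x \<circ> \<sigma>)) =
        \<gamma> * (SA x * (res1 x + res3 x)) + \<delta> * (SB x * (res2 x + res3 x))"
    "\<And>x. SA (x \<circ> \<sigma>) * SB (x \<circ> \<sigma>) * (SA (x \<circ> \<sigma>) - SB (x \<circ> \<sigma>)) =
        (\<alpha> * \<delta> - \<beta> * \<gamma>) * (SA x * SB x * (SA x - SB x))" "\<alpha> * \<delta> - \<beta> * \<gamma> \<noteq> 0"
  using res_perm[OF assms]
proof (elim disjE)
  assume "\<forall>x. res1 (x \<circ> \<sigma>) = res1 x \<and> res2 (x \<circ> \<sigma>) = res2 x \<and> res3 (x \<circ> \<sigma>) = res3 x"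
  then show thesis by (intro that[of 1 0 0 1]) (simp_all add: SA_def SB_def algebra_simps)
next
  assume "\<forall>x. res1 (x \<circ> \<sigma>) = res1 x \<and> res2 (x \<circ> \<sigma>) = res3 x \<and> res3 (x \<circ> \<sigma>) = res2 x"
  then show thesis by (intro that[of 1 "-1" 0 "-1"]) (simp_all add: SA_def SB_def algebra_simps)
next
  assume "\<forall>x. res1 (x \<circ> \<sigma>) = res2 x \<and> res2 (x \<circ> \<sigma>) = res1 x \<and> res3 (x \<circ> \<sigma>) = res3 x"
  then show thesis by (intro that[of 0 1 1 0]) (simp_all add: SA_def SB_def algebra_simps)
next
  assume "\<forall>x. res1 (x \<circ> \<sigma>) = res2 x \<and> res2 (x \<circ> \<sigma>) = res3 x \<and> res3 (x \<circ> \<sigma>) = res1 x"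
  then show thesis by (intro that[of "-1" 1 "-1" 0]) (simp_all add: SA_def SB_def algebra_simps)
next
  assume "\<forall>x. res1 (x \<circ> \<sigma>) = res3 x \<and> res2 (x \<circ> \<sigma>) = res1 x \<and> res3 (x \<circ> \<sigma>) = res2 x"
  then show thesis by (intro that[of 0 "-1" 1 "-1"]) (simp_all add: SA_def SB_def algebra_simps)
next
  assume "\<forall>x. res1 (x \<circ> \<sigma>) = res3 x \<and> res2 (x \<circ> \<sigma>) = res2 x \<and> res3 (x \<circ> \<sigma>) = res1 x"
  then show thesis by (intro that[of "-1" 0 "-1" 1]) (simp_all add: SA_def SB_def algebra_simps)
qed

lemma specht_matrix_unique:
  assumes "\<And>x. \<alpha> * SA x + \<beta> * SB x = \<alpha>' * SA x + \<beta>' * SB x"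
  shows "\<alpha> = \<alpha>'" "\<beta> = \<beta>'"
  \<comment> \<open>At these two points (\<open>SA\<close>, \<open>SB\<close>) takes the values (1,
    0) and (0, 1), so each evaluation isolates one coefficient.\<close>
  using assms[of "pt 1 1 0 0"] assms[of "pt 1 0 1 0"]
  by (simp_all add: SA_def SB_def res1_def res2_def res3_def)

text \<open>Quantifying over all matrices mirrors \<open>rep_S22\<close>. The condition is not
  vacuous: the matrix exists by \<open>specht_matrix\<close> and is unique by
  \<open>specht_matrix_unique\<close>.\<close>

definition equiv_pair ::
  "((4 \<Rightarrow> complex) \<Rightarrow> complex) \<Rightarrow> ((4 \<Rightarrow> complex) \<Rightarrow> complex) \<Rightarrow> bool" where
  "equiv_pair h1 h2 \<longleftrightarrow> (\<forall>\<sigma> \<alpha> \<beta> \<gamma> \<delta>. bij \<sigma> \<longrightarrow>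
     (\<forall>x. SA (x \<circ> \<sigma>) = \<alpha> * SA x + \<beta> * SB x) \<longrightarrow> (\<forall>x. SB (x \<circ> \<sigma>) = \<gamma> * SA x + \<delta> * SB x) \<longrightarrow>
     (\<forall>x. h1 (x \<circ> \<sigma>) = \<alpha> * h1 x + \<beta> * h2 x) \<and> (\<forall>x. h2 (x \<circ> \<sigma>) = \<gamma> * h1 x + \<delta> * h2 x))"

lemma equiv_pairD:
  assumes "equiv_pair h1 h2" "bij \<sigma>"
    "\<And>x. SA (x \<circ> \<sigma>) = \<alpha> * SA x + \<beta> * SB x" "\<And>x. SB (x \<circ> \<sigma>) = \<gamma> * SA x + \<delta> * SB x"
  shows "h1 (x \<circ> \<sigma>) = \<alpha> * h1 x + \<beta> * h2 x" "h2 (x \<circ> \<sigma>) = \<gamma> * h1 x + \<delta> * h2 x"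
  using assms unfolding equiv_pair_def by blast+

definition symf :: "((4 \<Rightarrow> complex) \<Rightarrow> complex) \<Rightarrow> bool" where
  "symf f \<longleftrightarrow> (\<forall>\<sigma>. bij \<sigma> \<longrightarrow> (\<forall>x. f (x \<circ> \<sigma>) = f x))"

lemma transpose_fixes: "x i = x j \<Longrightarrow> x \<circ> Transposition.transpose i j = x"
  by (auto simp: fun_eq_iff Transposition.transpose_def)

text \<open>A point with two equal coordinates is fixed by their transposition. Equivariance at that
  point becomes a linear relation between the two values: \<open>h1\<close> or \<open>h2\<close>
  equals its own negative, or \<open>h1\<close> equals \<open>h2\<close>.\<close>

lemma equiv_pair_transpose:
  assumes "equiv_pair h1 h2"
  shows "x 0 = x 2 \<Longrightarrow> h1 x = 0" "x 1 = x 3 \<Longrightarrow> h1 x = 0"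
    "x 0 = x 1 \<Longrightarrow> h2 x = 0" "x 2 = x 3 \<Longrightarrow> h2 x = 0"
    "x 0 = x 3 \<Longrightarrow> h1 x = h2 x" "x 1 = x 2 \<Longrightarrow> h1 x = h2 x"
proof -
  note S = SA_factor SB_factor Transposition.transpose_def comp_def algebra_simps
  have ne: "(1::4) \<noteq> 0" "(2::4) \<noteq> 0" "(3::4) \<noteq> 0" "(2::4) \<noteq> 1" "(3::4) \<noteq> 1" "(3::4) \<noteq> 2"
    using four_neq by metis+
  have t: "bij (Transposition.transpose i j)" for i j :: 4 by simp
  have z: "a = 0" if "a = - a" for a :: complex using that by simp
  show "h1 x = 0" if "x 0 = x 2"
  proof -
    have "h1 (x \<circ> Transposition.transpose 0 2) = (-1) * h1 x + (0) * h2 x"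
      by (rule equiv_pairD(1)[OF assms t, where \<alpha> = "-1" and \<beta> = 0 and \<gamma> = "-1" and \<delta> = 1]) (simp_all add: S ne)
    then show ?thesis using transpose_fixes[of x 0 2, OF that] z by simp
  qed
  show "h1 x = 0" if "x 1 = x 3"
  proof -
    have "h1 (x \<circ> Transposition.transpose 1 3) = (-1) * h1 x + (0) * h2 x"
      by (rule equiv_pairD(1)[OF assms t, where \<alpha> = "-1" and \<beta> = 0 and \<gamma> = "-1" and \<delta> = 1]) (simp_all add: S ne)
    then show ?thesis using transpose_fixes[of x 1 3, OF that] z by simp
  qed
  show "h2 x = 0" if "x 0 = x 1"
  proof -
    have "h2 (x \<circ> Transposition.transpose 0 1) = (0) * h1 x + (-1) * h2 x"
      by (rule equiv_pairD(2)[OF assms t, where \<alpha> = "1" and \<beta> = "-1" and \<gamma> = "0" and \<delta> = "-1"]) (simp_all add: S ne)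
    then show ?thesis using transpose_fixes[of x 0 1, OF that] z by simp
  qed
  show "h2 x = 0" if "x 2 = x 3"
  proof -
    have "h2 (x \<circ> Transposition.transpose 2 3) = (0) * h1 x + (-1) * h2 x"
      by (rule equiv_pairD(2)[OF assms t, where \<alpha> = "1" and \<beta> = "-1" and \<gamma> = "0" and \<delta> = "-1"]) (simp_all add: S ne)
    then show ?thesis using transpose_fixes[of x 2 3, OF that] z by simp
  qed
  show "h1 x = h2 x" if "x 0 = x 3"
  proof -
    have "h1 (x \<circ> Transposition.transpose 0 3) = (0) * h1 x + (1) * h2 x"
      by (rule equiv_pairD(1)[OF assms t, where \<alpha> = "0" and \<beta> = "1" and \<gamma> = "1" and \<delta> = "0"]) (simp_all add: S ne)
    then show ?thesis using transpose_fixes[of x 0 3, OF that] z by simp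
  qed
  show "h1 x = h2 x" if "x 1 = x 2"
  proof -
    have "h1 (x \<circ> Transposition.transpose 1 2) = (0) * h1 x + (1) * h2 x"
      by (rule equiv_pairD(1)[OF assms t, where \<alpha> = "0" and \<beta> = "1" and \<gamma> = "1" and \<delta> = "0"]) (simp_all add: S ne)
    then show ?thesis using transpose_fixes[of x 1 2, OF that] z by simp
  qed
qed

lemma polyfun_cancel:
  assumes "polyfun f" "polyfun g" "f a \<noteq> 0" "\<And>x. f x * g x = 0"
  shows "g = (\<lambda>_. 0)"
  using polyfun_mult_eq_0[OF assms(1,2,4,3)] by blast

lemma polyfun_update: "polyfun f \<Longrightarrow> polyfun (\<lambda>x. f (x(i := x j)))"
proof (erule polyfun_compose)
  show "polyfun (\<lambda>x. (x(i := x j)) k)" for k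
    by (cases "k = i") (simp_all add: polyfun.intros)
qed

lemma polyfun_comp_perm: "polyfun f \<Longrightarrow> polyfun (\<lambda>x. f (x \<circ> \<sigma>))"
  by (erule polyfun_compose) (simp add: polyfun.intros)

text \<open>After division by the first factor the quotient still vanishes where
  \<open>x k = x l\<close>: there the first factor is not identically zero, as \<open>k\<close>
  differs from \<open>i\<close> and \<open>j\<close>, so it cancels.\<close>

lemma polyfun_dvd2:
  assumes f: "polyfun f" and z: "\<And>x. x i = x j \<Longrightarrow> f x = 0" "\<And>x. x k = x l \<Longrightarrow> f x = 0"
    and ne: "i \<noteq> j" "k \<noteq> l" "k \<noteq> i" "k \<noteq> j"
  obtains g where "polyfun g" "\<And>x. f x = (x i - x j) * (x k - x l) * g x"
proof -
  obtain g where g: "polyfun g" "\<And>x. f x = (x i - x j) * g x"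
    using polyfun_dvd[OF f z(1) ne(1)] by blast
  have "(\<lambda>x. g (x(k := x l))) = (\<lambda>_. 0)"
  proof (rule polyfun_cancel[of "\<lambda>x. x i - x j" _ "\<lambda>m. if m = i then 1 else 0"])
    show "(x i - x j) * g (x(k := x l)) = 0" for x :: "4 \<Rightarrow> complex"
      using z(2)[of "x(k := x l)"] g(2)[of "x(k := x l)"] ne by simp
  qed (use ne in \<open>auto intro!: polyfun_intros polyfun_update g\<close>)
  from fun_cong[OF this] have "g x = 0" if "x k = x l" for x
    using that by (metis fun_upd_idem)
  then obtain h where "polyfun h" "\<And>x. g x = (x k - x l) * h x"
    using polyfun_dvd[OF g(1) _ ne(2)] by blast
  with g that show ?thesis by (simp add: mult.assoc)
qed

lemma polyfun_res: "polyfun res1" "polyfun res2" "polyfun res3" "polyfun SA" "polyfun SB"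
  using form_res form_polyfun by blast+

lemma res_scale:
  "res1 (\<lambda>i. c * x i) = c\<^sup>2 * res1 x" "res2 (\<lambda>i. c * x i) = c\<^sup>2 * res2 x"
  "res3 (\<lambda>i. c * x i) = c\<^sup>2 * res3 x" "SA (\<lambda>i. c * x i) = c\<^sup>2 * SA x" "SB (\<lambda>i. c * x i) = c\<^sup>2 * SB x"
  using form_res by (simp_all add: form_scale)

text \<open>The scaling laws carry \<open>c\<^sup>2\<close> and \<open>c ^ 4\<close> instead of
  naming the degrees a - 2 and a - 4. In this form they also make sense for a < 4, where they force
  \<open>G\<close>, or both functions, to vanish.\<close>

theorem equiv_pair_structure:
  assumes h1: "form a h1" and h2: "form a h2" and eq: "equiv_pair h1 h2"
  obtains F G where "polyfun F" "polyfun G" "symf F" "symf G"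
    "\<And>c x. c\<^sup>2 * F (\<lambda>i. c * x i) = c ^ a * F x" "\<And>c x. c ^ 4 * G (\<lambda>i. c * x i) = c ^ a * G x"
    "\<And>x. h1 x = SA x * (F x + G x * (res1 x + res3 x))"
    "\<And>x. h2 x = SB x * (F x + G x * (res2 x + res3 x))"
proof -
  note ne = four_neq four_neq[symmetric]
  note tr = equiv_pair_transpose[OF eq]
  note pf = form_polyfun[OF h1] form_polyfun[OF h2]
  obtain k1 where k1: "polyfun k1" "\<And>x. h1 x = SA x * k1 x"
    by (rule polyfun_dvd2[of h1 0 2 1 3, OF pf(1) tr(1,2) ne(2,5,7,4)]) (assumption | rule that | simp add: SA_factor)+
  obtain k2 where k2: "polyfun k2" "\<And>x. h2 x = SB x * k2 x"
    by (rule polyfun_dvd2[of h2 0 1 2 3, OF pf(2) tr(3,4) ne(1,6,8,10)]) (assumption | rule that | simp add: SB_factor)+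
  \<comment> \<open>Where \<open>x 0 = x 3\<close> or \<open>x 1 = x 2\<close>, both
    \<open>SA = SB\<close> and \<open>h1 = h2\<close> hold, so the cofactors agree there and their
    difference is divisible by \<open>SA - SB\<close>.\<close>
  define D where "D = (\<lambda>x. k1 x - k2 x)"
  have D: "polyfun D" unfolding D_def by (intro polyfun_intros k1 k2)
  have uSA: "polyfun (\<lambda>x. SA (x(i := x j)))" and uD: "polyfun (\<lambda>x. D (x(i := x j)))" for i j
    by (rule polyfun_update[OF polyfun_res(4)], rule polyfun_update[OF D])
  have SAD: "SA x * D x = 0" if "SA x = SB x" "h1 x = h2 x" for x
    using that k1(2)[of x] k2(2)[of x] by (simp add: D_def right_diff_distrib)
  have D1: "D x = 0" if "x 0 = x 3" for x
  proof -
    have "(\<lambda>x. D (x(0 := x 3))) = (\<lambda>_. 0)"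
    proof (rule polyfun_cancel[of "\<lambda>x. SA (x(0 := x 3))" _ "pt 0 1 1 0"])
      show "SA (x(0 := x 3)) * D (x(0 := x 3)) = 0" for x :: "4 \<Rightarrow> complex"
        using SAD[of "x(0 := x 3)"] tr(5)[of "x(0 := x 3)"] SA_SB_factor[of "x(0 := x 3)"] ne by simp
    qed (use ne in \<open>simp_all add: uSA uD SA_factor[of "(pt a b c d)(i := e)" for a b c d i e]\<close>)
    from fun_cong[OF this, of x] show ?thesis using that by (simp add: fun_upd_idem)
  qed
  have D2: "D x = 0" if "x 1 = x 2" for x
  proof -
    have "(\<lambda>x. D (x(1 := x 2))) = (\<lambda>_. 0)"
    proof (rule polyfun_cancel[of "\<lambda>x. SA (x(1 := x 2))" _ "pt 1 0 0 1"])
      show "SA (x(1 := x 2)) * D (x(1 := x 2)) = 0" for x :: "4 \<Rightarrow> complex"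
        using SAD[of "x(1 := x 2)"] tr(6)[of "x(1 := x 2)"] SA_SB_factor[of "x(1 := x 2)"] ne by simp
    qed (use ne in \<open>simp_all add: uSA uD SA_factor[of "(pt a b c d)(i := e)" for a b c d i e]\<close>)
    from fun_cong[OF this, of x] show ?thesis using that by (simp add: fun_upd_idem)
  qed
  obtain G where G: "polyfun G" "\<And>x. D x = (SA x - SB x) * G x"
    by (rule polyfun_dvd2[of D 0 3 1 2, OF D D1 D2 ne(3,4,7,5)]) (assumption | rule that | simp add: SA_SB_factor)+
  \<comment> \<open>Since \<open>SA - SB = res1 - res2\<close>, subtracting
    \<open>G * (res2 + res3)\<close> from \<open>k2\<close> yields the same
    \<open>F\<close>.\<close>
  define F where "F = (\<lambda>x. k1 x - G x * (res1 x + res3 x))"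
  have F: "polyfun F" unfolding F_def by (intro polyfun_intros k1 G polyfun_res)
  have k1F: "k1 x = F x + G x * (res1 x + res3 x)" for x by (simp add: F_def)
  have k2F: "k2 x = F x + G x * (res2 x + res3 x)" for x
    using G(2)[of x] unfolding D_def k1F SA_def SB_def by (simp add: algebra_simps)
  have h1F: "h1 x = SA x * (F x + G x * (res1 x + res3 x))" for x by (simp add: k1 k1F)
  have h2F: "h2 x = SB x * (F x + G x * (res2 x + res3 x))" for x by (simp add: k2 k2F)
  \<comment> \<open>Cramer's rule eliminates \<open>F\<close>. Under a permutation the right side
    and the product before \<open>G\<close> are both multiplied by the determinant of the matrix,
    hence \<open>G\<close> is invariant.\<close>
  have detG: "SA x * SB x * (SA x - SB x) * G x = h1 x * SB x - h2 x * SA x" for x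
    unfolding h1F h2F SA_def SB_def by (simp add: algebra_simps)
  have pp: "polyfun (\<lambda>x. SA (x \<circ> \<sigma>))" "polyfun (\<lambda>x. F (x \<circ> \<sigma>))" "polyfun (\<lambda>x. G (x \<circ> \<sigma>))" for \<sigma>
    using polyfun_comp_perm[OF polyfun_res(4)] polyfun_comp_perm[OF F] polyfun_comp_perm[OF G(1)] by blast+
  have symG: "symf G"
    unfolding symf_def
  proof (intro allI impI)
    fix \<sigma> :: "4 \<Rightarrow> 4" and x :: "4 \<Rightarrow> complex" assume \<sigma>: "bij \<sigma>"
    obtain \<alpha> \<beta> \<gamma> \<delta> where m: "\<And>x. SA (x \<circ> \<sigma>) = \<alpha> * SA x + \<beta> * SB x"
      "\<And>x. SB (x \<circ> \<sigma>) = \<gamma> * SA x + \<delta> * SB x"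
      "\<And>x. SA (x \<circ> \<sigma>) * SB (x \<circ> \<sigma>) * (SA (x \<circ> \<sigma>) - SB (x \<circ> \<sigma>)) =
        (\<alpha> * \<delta> - \<beta> * \<gamma>) * (SA x * SB x * (SA x - SB x))" "\<alpha> * \<delta> - \<beta> * \<gamma> \<noteq> 0"
      by (rule specht_matrix[OF \<sigma>]) (rule that)
    note h = equiv_pairD[OF eq \<sigma> m(1,2)]
    have "(\<lambda>x. (\<alpha> * \<delta> - \<beta> * \<gamma>) * (G (x \<circ> \<sigma>) - G x)) = (\<lambda>_. 0)"
    proof (rule polyfun_cancel[of "\<lambda>x. SA x * SB x * (SA x - SB x)" _ "pt 0 1 2 3"])
      fix x
      have "(\<alpha> * \<delta> - \<beta> * \<gamma>) * (SA x * SB x * (SA x - SB x)) * G (x \<circ> \<sigma>)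
          = h1 (x \<circ> \<sigma>) * SB (x \<circ> \<sigma>) - h2 (x \<circ> \<sigma>) * SA (x \<circ> \<sigma>)"
        using detG[of "x \<circ> \<sigma>"] m(3)[of x] by simp
      also have "\<dots> = (\<alpha> * \<delta> - \<beta> * \<gamma>) * (h1 x * SB x - h2 x * SA x)"
        unfolding h m(1,2) by (simp add: algebra_simps)
      also have "\<dots> = (\<alpha> * \<delta> - \<beta> * \<gamma>) * (SA x * SB x * (SA x - SB x) * G x)"
        using detG[of x] by simp
      finally show "SA x * SB x * (SA x - SB x) * ((\<alpha> * \<delta> - \<beta> * \<gamma>) * (G (x \<circ> \<sigma>) - G x)) = 0"
        by (simp add: algebra_simps)
    qed (auto intro!: polyfun_intros polyfun_res pp G simp: SA_factor SB_factor)
    then show "G (x \<circ> \<sigma>) = G x" using m(4) by (simp add: fun_eq_iff)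
  qed
  have symF: "symf F"
    unfolding symf_def
  proof (intro allI impI)
    fix \<sigma> :: "4 \<Rightarrow> 4" and x :: "4 \<Rightarrow> complex" assume \<sigma>: "bij \<sigma>"
    obtain \<alpha> \<beta> \<gamma> \<delta> where m: "\<And>x. SA (x \<circ> \<sigma>) = \<alpha> * SA x + \<beta> * SB x"
      "\<And>x. SB (x \<circ> \<sigma>) = \<gamma> * SA x + \<delta> * SB x"
      "\<And>x. SA (x \<circ> \<sigma>) * (res1 (x \<circ> \<sigma>) + res3 (x \<circ> \<sigma>)) =
        \<alpha> * (SA x * (res1 x + res3 x)) + \<beta> * (SB x * (res2 x + res3 x))" "\<alpha> * \<delta> - \<beta> * \<gamma> \<noteq> 0"
      by (rule specht_matrix[OF \<sigma>]) (rule that)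
    note h = equiv_pairD[OF eq \<sigma> m(1,2)]
    have "(\<lambda>x. F (x \<circ> \<sigma>) - F x) = (\<lambda>_. 0)"
    proof -
      \<comment> \<open>If \<open>SA\<close> vanished identically after the permutation, the first
        row of its matrix would be zero, contrary to the nonzero determinant.\<close>
      have nz: "\<exists>x. SA (x \<circ> \<sigma>) \<noteq> 0"
      proof (rule ccontr)
        assume "\<not> ?thesis"
        then have "\<alpha> * SA x + \<beta> * SB x = 0 * SA x + 0 * SB x" for x using m(1) by simp
        from specht_matrix_unique[OF this] m(4) show False by simp
      qed
      then obtain b where b: "SA (b \<circ> \<sigma>) \<noteq> 0" by blast
      show ?thesis
      proof (rule polyfun_cancel[of "\<lambda>x. SA (x \<circ> \<sigma>)", OF _ _ b])
        fix x
        have "SA (x \<circ> \<sigma>) * F (x \<circ> \<sigma>)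
            = h1 (x \<circ> \<sigma>) - G (x \<circ> \<sigma>) * (SA (x \<circ> \<sigma>) * (res1 (x \<circ> \<sigma>) + res3 (x \<circ> \<sigma>)))"
          unfolding h1F by (simp add: algebra_simps)
        also have "\<dots> = \<alpha> * h1 x + \<beta> * h2 x -
            G x * (\<alpha> * (SA x * (res1 x + res3 x)) + \<beta> * (SB x * (res2 x + res3 x)))"
          using symG \<sigma> by (simp add: h m(3) symf_def)
        also have "\<dots> = SA (x \<circ> \<sigma>) * F x"
          unfolding h1F h2F m(1) by (simp add: algebra_simps)
        finally show "SA (x \<circ> \<sigma>) * (F (x \<circ> \<sigma>) - F x) = 0" by (simp add: algebra_simps)
      qed (auto intro!: polyfun_intros polyfun_res pp F)
    qed
    then show "F (x \<circ> \<sigma>) = F x" by (simp add: fun_eq_iff)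
  qed
  have pc: "polyfun (\<lambda>x. f (\<lambda>i. c * x i))" if "polyfun f" for c f
    using that by (rule polyfun_compose) (intro polyfun.intros)
  note pc = pc[OF k1(1)] pc[OF k2(1)] pc[OF G(1)]
  have k1s: "c\<^sup>2 * k1 (\<lambda>i. c * x i) = c ^ a * k1 x" for c x
  proof -
    have "(\<lambda>x. c\<^sup>2 * k1 (\<lambda>i. c * x i) - c ^ a * k1 x) = (\<lambda>_. 0)"
    proof (rule polyfun_cancel[of SA _ "pt 0 1 2 3"])
      show "SA x * (c\<^sup>2 * k1 (\<lambda>i. c * x i) - c ^ a * k1 x) = 0" for x
        using form_scale[OF h1, of c x] by (simp add: k1 res_scale algebra_simps)
    qed (auto intro!: polyfun_intros polyfun_res pc k1 simp: SA_factor)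
    then show ?thesis by (simp add: fun_eq_iff)
  qed
  have k2s: "c\<^sup>2 * k2 (\<lambda>i. c * x i) = c ^ a * k2 x" for c x
  proof -
    have "(\<lambda>x. c\<^sup>2 * k2 (\<lambda>i. c * x i) - c ^ a * k2 x) = (\<lambda>_. 0)"
    proof (rule polyfun_cancel[of SB _ "pt 0 1 2 3"])
      show "SB x * (c\<^sup>2 * k2 (\<lambda>i. c * x i) - c ^ a * k2 x) = 0" for x
        using form_scale[OF h2, of c x] by (simp add: k2 res_scale algebra_simps)
    qed (auto intro!: polyfun_intros polyfun_res pc k2 simp: SB_factor)
    then show ?thesis by (simp add: fun_eq_iff)
  qed
  have c4: "c ^ 4 = c\<^sup>2 * c\<^sup>2" for c :: complex by (simp add: power2_eq_square power4_eq_xxxx)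
  have Gs: "c ^ 4 * G (\<lambda>i. c * x i) = c ^ a * G x" for c x
  proof -
    have "(\<lambda>x. c ^ 4 * G (\<lambda>i. c * x i) - c ^ a * G x) = (\<lambda>_. 0)"
    proof (rule polyfun_cancel[of "\<lambda>x. SA x - SB x" _ "pt 0 1 2 3"])
      fix x
      have "c ^ 4 * ((SA x - SB x) * G (\<lambda>i. c * x i)) = c\<^sup>2 * D (\<lambda>i. c * x i)"
        unfolding G(2)[of "\<lambda>i. c * x i"] res_scale c4
        by (simp only: right_diff_distrib left_diff_distrib mult_ac)
      also have "\<dots> = c ^ a * D x" using k1s[of c x] k2s[of c x] by (simp add: D_def algebra_simps)
      finally show "(SA x - SB x) * (c ^ 4 * G (\<lambda>i. c * x i) - c ^ a * G x) = 0"
        using G(2)[of x] by (simp add: algebra_simps)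
    qed (auto intro!: polyfun_intros polyfun_res pc G simp: SA_factor SB_factor)
    then show ?thesis by (simp add: fun_eq_iff)
  qed
  have Fs: "c\<^sup>2 * F (\<lambda>i. c * x i) = c ^ a * F x" for c x
  proof -
    have "c\<^sup>2 * F (\<lambda>i. c * x i) = c\<^sup>2 * k1 (\<lambda>i. c * x i) - c ^ 4 * G (\<lambda>i. c * x i) * (res1 x + res3 x)"
      unfolding F_def res_scale c4
      by (simp only: right_diff_distrib distrib_left distrib_right mult_ac)
    also have "\<dots> = c ^ a * F x" unfolding k1s Gs by (simp add: F_def algebra_simps)
    finally show ?thesis .
  qed
  show thesis using that[OF F G(1) symF symG Fs Gs h1F h2F] .
qed

subsection \<open>From a sequence of type \<open>S\<^sup>(\<^sup>2\<^sup>,\<^sup>2\<^sup>)\<close> to a regular degree sequence\<close>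

text \<open>On the line through 0 and \<open>x\<close> the scaling law is an identity of polynomials
  in the scalar. There a power of the variable may be cancelled, which settles the scalar 0 as well;
  and for \<open>a < k\<close> the left side has no term of degree \<open>a\<close>.\<close>

lemma polyfun_shifted_form:
  assumes f: "polyfun f" and s: "\<And>c x. c ^ k * f (\<lambda>i. c * x i) = c ^ a * f x"
  shows "k \<le> a \<Longrightarrow> form (a - k) f" "a < k \<Longrightarrow> f x = 0"
proof -
  have q: "\<exists>q. (\<forall>t. f (\<lambda>i. t * x i) = poly q t) \<and> monom 1 k * q = monom (f x) a" for x
  proof -
    obtain q where q: "\<And>t. f (\<lambda>i. 0 + t * x i) = poly q t"
      using polyfun_line[OF f, of "\<lambda>_. 0" x] by blast
    have "poly (monom 1 k * q) t = poly (monom (f x) a) t" for t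
      using s[of t x] q[of t] by (simp add: poly_monom mult.commute)
    then have "poly (monom 1 k * q) = poly (monom (f x) a)" ..
    then have "monom 1 k * q = monom (f x) a" by (simp add: poly_eq_poly_eq_iff)
    then show ?thesis using q by auto
  qed
  show "form (a - k) f" if "k \<le> a"
    unfolding form_def
  proof (intro conjI f allI)
    fix c x
    obtain q where q: "\<forall>t. f (\<lambda>i. t * x i) = poly q t" "monom 1 k * q = monom (f x) a"
      using q by blast
    then have "monom 1 k * q = monom 1 k * monom (f x) (a - k)"
      using that by (simp add: mult_monom)
    then have "q = monom (f x) (a - k)" by simp
    then show "f (\<lambda>i. c * x i) = c ^ (a - k) * f x"
      using q(1) by (simp add: poly_monom mult.commute)
  qed
  show "f x = 0" if "a < k"
  proof -
    obtain q where q: "monom 1 k * q = monom (f x) a" using q by blast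
    then have "coeff (monom 1 k * q) a = f x" by simp
    then show ?thesis using that by (simp add: coeff_monom_mult)
  qed
qed

section \<open>Symmetric linear forms\<close>

definition E1 :: "(4 \<Rightarrow> complex) \<Rightarrow> complex" where "E1 x = x 0 + x 1 + x 2 + x 3"

lemma symf_E1: "symf E1"
proof -
  have "E1 x = (\<Sum>i\<in>UNIV. x i)" for x by (simp add: E1_def sum_four)
  then show ?thesis unfolding symf_def
    by (auto intro: sum.reindex_bij_betw)
qed

lemma form_E1: "form 1 E1"
  unfolding E1_def[abs_def] by (intro form_intros(3) form_intros(2))

lemma form_one_add:
  assumes "form 1 f"
  shows "f (\<lambda>i. x i + y i) = f x + f y"
proof -
  obtain p where p: "supp_deg 1 p" "f = peval p" using form_imp_peval[OF assms] .
  let ?q = "line_poly 1 p x y"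
  have d: "degree ?q \<le> 1" and c: "coeff ?q 1 = f y" using line_poly_bound[OF p(1)] p(2) by auto
  have e: "poly ?q t = f (\<lambda>i. x i + t * y i)" for t using poly_line_poly[OF p(1)] p(2) by simp
  have "poly ?q t = coeff ?q 0 + coeff ?q 1 * t" for t
    using d by (cases ?q rule: pCons_cases) (auto elim: degree_eq_zeroE split: if_splits)
  then have "poly ?q 1 = poly ?q 0 + f y" using c by simp
  then show ?thesis using e[of 0] e[of 1] by simp
qed

text \<open>Averaging over a 4-cycle: four times \<open>f x\<close> is the value of \<open>f\<close>
  at the sum of the cyclic shifts of \<open>x\<close>, all of whose coordinates are
  \<open>E1 x\<close>. Addition in the index type is modulo 4, so \<open>i + 1\<close> is the
  cycle.\<close>

lemma symmetric_linear_form_zero: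
  assumes f: "form 1 f" and s: "symf f" and x: "E1 x = 0"
  shows "f x = 0"
proof -
  define \<tau> :: "4 \<Rightarrow> 4" where "\<tau> i = i + 1" for i
  have "bij \<tau>"
    unfolding \<tau>_def by (rule bij_betw_byWitness[of _ "\<lambda>i. i - 1"]) auto
  then have t: "f (y \<circ> \<tau>) = f y" for y using s by (simp add: symf_def)
  have "f x + f (x \<circ> \<tau>) + f (x \<circ> \<tau> \<circ> \<tau>) + f (x \<circ> \<tau> \<circ> \<tau> \<circ> \<tau>)
      = f (\<lambda>i. x i + (x \<circ> \<tau>) i + (x \<circ> \<tau> \<circ> \<tau>) i + (x \<circ> \<tau> \<circ> \<tau> \<circ> \<tau>) i)"
    by (simp only: form_one_add[OF f])
  also have "(\<lambda>i. x i + (x \<circ> \<tau>) i + (x \<circ> \<tau> \<circ> \<tau>) i + (x \<circ> \<tau> \<circ> \<tau> \<circ> \<tau>) i) = (\<lambda>_. 0)"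
  proof -
    have v: "(0::4) + 1 = 1" "(1::4) + 1 = 2" "(2::4) + 1 = 3" "(3::4) + 1 = 0" by simp_all
    have "x i + x (i + 1) + x (i + 1 + 1) + x (i + 1 + 1 + 1) = 0" for i
    proof -
      have "\<forall>i. x i + x (i + 1) + x (i + 1 + 1) + x (i + 1 + 1 + 1) = 0"
        unfolding all_four v using x by (simp add: E1_def algebra_simps)
      then show ?thesis by blast
    qed
    then show ?thesis by (simp add: \<tau>_def comp_def)
  qed
  also have "f (\<lambda>_. 0) = 0" using form_zero[OF f] by simp
  finally show ?thesis unfolding t by simp
qed

lemma symmetric_poly_symf:
  assumes "supp_deg m p"
  shows "symmetric_poly p \<longleftrightarrow> symf (peval p)"
proof
  assume "symmetric_poly p"
  then show "symf (peval p)"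
    unfolding symf_def symmetric_poly_def using peval_perm_act[OF _ assms] by metis
next
  assume s: "symf (peval p)"
  show "symmetric_poly p"
    unfolding symmetric_poly_def
  proof (intro allI impI)
    fix \<sigma> :: "4 \<Rightarrow> 4" assume "bij \<sigma>"
    then show "perm_act \<sigma> p = p"
      using s by (intro peval_inj[of m] supp_deg_perm_act assms)
        (simp_all add: peval_perm_act[OF _ assms] symf_def)
  qed
qed

lemma form_homog_polyE:
  assumes "form m f" "f a \<noteq> 0"
  obtains p where "homog_of_deg m p" "peval p = f"
proof -
  obtain p where p: "supp_deg m p" "f = peval p" using form_imp_peval[OF assms(1)] .
  have "p \<noteq> (\<lambda>_. 0)" using assms(2) p(2) by (auto simp: peval_def)
  with p that show ?thesis by (auto simp: homog_of_deg_iff)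
qed

lemma symf_homog_polyE:
  assumes "form m f" "f a \<noteq> 0" "symf f"
  obtains p where "homog_of_deg m p" "symmetric_poly p" "peval p = f"
proof -
  obtain p where p: "homog_of_deg m p" "peval p = f" using form_homog_polyE[OF assms(1,2)] .
  then show ?thesis using that symmetric_poly_symf[of m p] assms(3) by (simp add: homog_of_deg_iff)
qed

lemma homog_symf: "homog_of_deg m p \<Longrightarrow> symmetric_poly p \<Longrightarrow> form m (peval p) \<and> symf (peval p)"
  using form_peval symmetric_poly_symf by (auto simp: homog_of_deg_iff)

text \<open>\<open>homog_of_deg\<close> requires a nonzero polynomial, whereas \<open>F\<close> or
  \<open>G\<close> may vanish identically. Replacing the zero form by a power of \<open>E1\<close>
  only shrinks the common zero set.\<close>

lemma form_nonzero_variant: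
  assumes "form m f" "symf f"
  obtains f' a where "form m f'" "symf f'" "f' a \<noteq> 0" "\<And>x. f' x = 0 \<Longrightarrow> f x = 0"
proof (cases "\<exists>a. f a \<noteq> 0")
  case True
  then show ?thesis using that assms by blast
next
  case False
  have "form m (\<lambda>x. E1 x ^ m)" using form_power[OF form_E1, of m] by simp
  moreover have "symf (\<lambda>x. E1 x ^ m)" using symf_E1 by (simp add: symf_def)
  moreover have "E1 (pt 1 0 0 0) ^ m \<noteq> 0" by (simp add: E1_def)
  ultimately show ?thesis using that False by blast
qed

lemma regular_degseqI:
  assumes "form d1 f1" "form d2 f2" "form d3 f3" "form d4 f4"
    and "symf f1" "symf f2" "symf f3" "symf f4"
    and "0 < d1" "0 < d2" "0 < d3" "0 < d4"
    and z: "\<And>x. f1 x = 0 \<Longrightarrow> f2 x = 0 \<Longrightarrow> f3 x = 0 \<Longrightarrow> f4 x = 0 \<Longrightarrow> x = (\<lambda>_. 0)"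
  shows "regular_degseq d1 d2 d3 d4"
proof -
  have *: "\<exists>p. homog_of_deg m p \<and> symmetric_poly p \<and> (\<forall>x. peval p x = 0 \<longrightarrow> f x = 0)"
    if ff: "form m f" "symf f" for m f
  proof -
    obtain f' a where f': "form m f'" "symf f'" "f' a \<noteq> 0" "\<And>x. f' x = 0 \<Longrightarrow> f x = 0"
      using form_nonzero_variant[OF ff] by metis
    obtain p where "homog_of_deg m p" "symmetric_poly p" "peval p = f'"
      using symf_homog_polyE[OF f'(1,3,2)] .
    with f'(4) show ?thesis by blast
  qed
  from *[OF assms(1,5)] *[OF assms(2,6)] *[OF assms(3,7)] *[OF assms(4,8)]
  obtain p1 p2 p3 p4 where
    p: "homog_of_deg d1 p1" "homog_of_deg d2 p2" "homog_of_deg d3 p3" "homog_of_deg d4 p4"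
      "symmetric_poly p1" "symmetric_poly p2" "symmetric_poly p3" "symmetric_poly p4"
    and pz: "\<And>x. peval p1 x = 0 \<Longrightarrow> f1 x = 0" "\<And>x. peval p2 x = 0 \<Longrightarrow> f2 x = 0"
      "\<And>x. peval p3 x = 0 \<Longrightarrow> f3 x = 0" "\<And>x. peval p4 x = 0 \<Longrightarrow> f4 x = 0"
    by blast
  have "only_origin [p1, p2, p3, p4]" using pz z by (simp add: only_origin_def)
  with p assms show ?thesis unfolding regular_degseq_def by blast
qed

lemma regular_degseqE:
  assumes "regular_degseq d1 d2 d3 d4"
  obtains f1 f2 f3 f4 where "form d1 f1" "form d2 f2" "form d3 f3" "form d4 f4"
    "symf f1" "symf f2" "symf f3" "symf f4"
    "\<And>x. f1 x = 0 \<Longrightarrow> f2 x = 0 \<Longrightarrow> f3 x = 0 \<Longrightarrow> f4 x = 0 \<Longrightarrow> x = (\<lambda>_. 0)"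
proof -
  from assms obtain p1 p2 p3 p4 where
    p: "homog_of_deg d1 p1" "homog_of_deg d2 p2" "homog_of_deg d3 p3" "homog_of_deg d4 p4"
      "symmetric_poly p1" "symmetric_poly p2" "symmetric_poly p3" "symmetric_poly p4"
      "only_origin [p1, p2, p3, p4]"
    unfolding regular_degseq_def by blast
  show ?thesis
    by (rule that[of "peval p1" "peval p2" "peval p3" "peval p4"])
      (use p homog_symf in \<open>auto simp: only_origin_def\<close>)
qed

lemma three_forms_common_zero:
  assumes f: "form m f" "0 < m" and g: "form n g" "0 < n"
  obtains x where "E1 x = 0" "x \<noteq> (\<lambda>_. 0)" "f x = 0" "g x = 0"
proof -
  \<comment> \<open>A basis of the space \<open>E1 x = 0\<close>.\<close>
  let ?a = "pt 1 0 0 (-1) :: 4 \<Rightarrow> complex" and ?b = "pt 0 1 0 (-1)" and ?c = "pt 0 0 1 (-1)"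
  obtain u v w where *: "u \<noteq> 0 \<or> v \<noteq> 0 \<or> w \<noteq> 0"
    "f (\<lambda>i. u * ?a i + v * ?b i + w * ?c i) = 0" "g (\<lambda>i. u * ?a i + v * ?b i + w * ?c i) = 0"
    using form_common_zero[OF f(1) g(1) f(2) g(2), of ?a ?b ?c] by blast
  let ?x = "\<lambda>i. u * ?a i + v * ?b i + w * ?c i"
  have "E1 ?x = 0" by (simp add: E1_def algebra_simps)
  moreover have "?x \<noteq> (\<lambda>_. 0)"
  proof
    assume "?x = (\<lambda>_. 0)"
    from fun_cong[OF this, of 0] fun_cong[OF this, of 1] fun_cong[OF this, of 2] * show False by simp
  qed
  ultimately show ?thesis using that *(2,3) by blast
qed

theorem equiv_seq_imp:
  assumes h1: "form a h1" and h2: "form a h2" and eq: "equiv_pair h1 h2"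
    and f1: "form c f1" "symf f1" and f2: "form d f2" "symf f2"
    and pos: "0 < a" "0 < c" "0 < d"
    and z: "\<And>x. h1 x = 0 \<Longrightarrow> h2 x = 0 \<Longrightarrow> f1 x = 0 \<Longrightarrow> f2 x = 0 \<Longrightarrow> x = (\<lambda>_. 0)"
  shows "((a = 2 \<or> a = 4) \<and> (c, d) \<noteq> (1, 1)) \<or> (5 \<le> a \<and> regular_degseq (a - 2) (a - 4) c d)"
proof -
  obtain F G where F: "polyfun F" "symf F" "\<And>c x. c\<^sup>2 * F (\<lambda>i. c * x i) = c ^ a * F x"
    and G: "polyfun G" "symf G" "\<And>c x. c ^ 4 * G (\<lambda>i. c * x i) = c ^ a * G x"
    and h: "\<And>x. h1 x = SA x * (F x + G x * (res1 x + res3 x))"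
      "\<And>x. h2 x = SB x * (F x + G x * (res2 x + res3 x))"
    using equiv_pair_structure[OF h1 h2 eq] by metis
  have a1: "a \<noteq> 1"
  proof
    assume a: "a = 1"
    have "F x = 0" "G x = 0" for x
      using polyfun_shifted_form(2)[OF F(1,3), of x] polyfun_shifted_form(2)[OF G(1,3), of x] a by simp_all
    then have "h1 x = 0" "h2 x = 0" for x by (simp_all add: h)
    then show False using three_forms_common_zero[OF f1(1) pos(2) f2(1) pos(3)] z by metis
  qed
  have a3: "a \<noteq> 3"
  proof
    assume a: "a = 3"
    have G0: "G x = 0" for x
      using polyfun_shifted_form(2)[OF G(1,3), of x] a by simp
    have "form 1 F" using polyfun_shifted_form(1)[OF F(1,3)] a by simp
    then have "F x = 0" if "E1 x = 0" for x
      using symmetric_linear_form_zero F(2) that by blast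
    then have "h1 x = 0" "h2 x = 0" if "E1 x = 0" for x using that by (simp_all add: h G0)
    then show False using three_forms_common_zero[OF f1(1) pos(2) f2(1) pos(3)] z by metis
  qed
  have cd: "(c, d) \<noteq> (1, 1)"
  proof
    assume "(c, d) = (1, 1)"
    then have l: "f1 x = 0" "f2 x = 0" if "E1 x = 0" for x
      using symmetric_linear_form_zero f1 f2 that by blast+
    \<comment> \<open>A basis of the plane \<open>E1 x = 0\<close>, \<open>x 0 = x 3\<close>. Both
      linear forms vanish on it and \<open>h1 = h2\<close> there, so a single equation remains in
      two unknowns.\<close>
    let ?a = "pt 1 0 (-2) 1 :: 4 \<Rightarrow> complex" and ?b = "pt 0 1 (-1) 0"
    obtain u v where *: "u \<noteq> 0 \<or> v \<noteq> 0" "h1 (\<lambda>i. u * ?a i + v * ?b i) = 0"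
      using form_zero_line[OF h1 pos(1), of ?a ?b] by blast
    let ?x = "\<lambda>i. u * ?a i + v * ?b i"
    have "h2 ?x = 0" using equiv_pair_transpose(5)[OF eq, of ?x] *(2) by simp
    moreover have "E1 ?x = 0" by (simp add: E1_def algebra_simps)
    ultimately have "?x = (\<lambda>_. 0)" using z *(2) l by blast
    from fun_cong[OF this, of 0] fun_cong[OF this, of 1] * show False by simp
  qed
  have "regular_degseq (a - 2) (a - 4) c d" if a: "5 \<le> a"
  proof (rule regular_degseqI)
    show "form (a - 2) F" "form (a - 4) G"
      using polyfun_shifted_form(1)[OF F(1,3)] polyfun_shifted_form(1)[OF G(1,3)] a by simp_all
    show "x = (\<lambda>_. 0)" if "F x = 0" "G x = 0" "f1 x = 0" "f2 x = 0" for x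
      using z[of x] that by (simp add: h)
  qed (use a pos f1 f2 F(2) G(2) in auto)
  moreover have "a = 2 \<or> a = 4 \<or> 5 \<le> a" using pos(1) a1 a3 by linarith
  ultimately show ?thesis using cd by blast
qed

lemma peval_perm_lc:
  assumes "supp_deg m p" "supp_deg m q" "supp_deg m r" "bij \<sigma>"
  shows "perm_act \<sigma> r = lc \<alpha> p \<beta> q \<longleftrightarrow>
    (\<forall>x. peval r (x \<circ> \<sigma>) = \<alpha> * peval p x + \<beta> * peval q x)"
proof
  assume "perm_act \<sigma> r = lc \<alpha> p \<beta> q"
  then show "\<forall>x. peval r (x \<circ> \<sigma>) = \<alpha> * peval p x + \<beta> * peval q x"
    using peval_perm_act[OF assms(4,3)] peval_lc[OF assms(1,2)] by metis
next
  assume "\<forall>x. peval r (x \<circ> \<sigma>) = \<alpha> * peval p x + \<beta> * peval q x"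
  then show "perm_act \<sigma> r = lc \<alpha> p \<beta> q"
    by (intro peval_inj[of m] supp_deg_perm_act supp_deg_lc assms)
      (simp add: peval_perm_act[OF assms(4,3)] peval_lc[OF assms(1,2)])
qed

theorem type_seq_imp:
  assumes t: "type_S22_44_seq a c d g1 g2 f1 f2" and pos: "0 < a" "0 < c" "0 < d"
  shows "((a = 2 \<or> a = 4) \<and> (c, d) \<noteq> (1, 1)) \<or> (5 \<le> a \<and> regular_degseq (a - 2) (a - 4) c d)"
proof -
  from t have g: "supp_deg a g1" "supp_deg a g2" and rep: "rep_S22 g1 g2"
    and f: "homog_of_deg c f1" "homog_of_deg d f2" "symmetric_poly f1" "symmetric_poly f2"
    and o: "only_origin [g1, g2, f1, f2]"
    by (auto simp: type_S22_44_seq_def homog_of_deg_iff)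
  from rep obtain p q r t where pq: "p * t - q * r \<noteq> 0"
    and act: "\<And>\<sigma> \<alpha> \<beta> \<gamma> \<delta>. bij \<sigma> \<Longrightarrow>
      perm_act \<sigma> spechtA = lc \<alpha> spechtA \<beta> spechtB \<Longrightarrow>
      perm_act \<sigma> spechtB = lc \<gamma> spechtA \<delta> spechtB \<Longrightarrow>
      perm_act \<sigma> (lc p g1 q g2) = lc \<alpha> (lc p g1 q g2) \<beta> (lc r g1 t g2) \<and>
      perm_act \<sigma> (lc r g1 t g2) = lc \<gamma> (lc p g1 q g2) \<delta> (lc r g1 t g2)"
    unfolding rep_S22_def by blast
  define H1 H2 where "H1 = lc p g1 q g2" and "H2 = lc r g1 t g2"
  have H: "supp_deg a H1" "supp_deg a H2" unfolding H1_def H2_def by (intro supp_deg_lc g)+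
  have eq: "equiv_pair (peval H1) (peval H2)"
    unfolding equiv_pair_def
  proof (intro allI impI)
    fix \<sigma> \<alpha> \<beta> \<gamma> \<delta>
    assume "bij \<sigma>" "\<forall>x. SA (x \<circ> \<sigma>) = \<alpha> * SA x + \<beta> * SB x" "\<forall>x. SB (x \<circ> \<sigma>) = \<gamma> * SA x + \<delta> * SB x"
    note \<sigma> = this
    have "perm_act \<sigma> spechtA = lc \<alpha> spechtA \<beta> spechtB" "perm_act \<sigma> spechtB = lc \<gamma> spechtA \<delta> spechtB"
      using \<sigma> peval_perm_lc[OF specht_eval(1,2,1) \<sigma>(1)] peval_perm_lc[OF specht_eval(1,2,2) \<sigma>(1)]
      by (simp_all add: specht_eval)
    then have "perm_act \<sigma> H1 = lc \<alpha> H1 \<beta> H2" "perm_act \<sigma> H2 = lc \<gamma> H1 \<delta> H2"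
      using act[OF \<sigma>(1)] unfolding H1_def H2_def by blast+
    then show "(\<forall>x. peval H1 (x \<circ> \<sigma>) = \<alpha> * peval H1 x + \<beta> * peval H2 x) \<and>
        (\<forall>x. peval H2 (x \<circ> \<sigma>) = \<gamma> * peval H1 x + \<delta> * peval H2 x)"
      using peval_perm_lc[OF H(1,2,1) \<sigma>(1)] peval_perm_lc[OF H(1,2,2) \<sigma>(1)] by blast
  qed
  show ?thesis
  proof (rule equiv_seq_imp[OF form_peval[OF H(1)] form_peval[OF H(2)] eq _ _ _ _ pos])
    show "form c (peval f1)" "symf (peval f1)" "form d (peval f2)" "symf (peval f2)"
      using homog_symf f by auto
    fix x assume x: "peval H1 x = 0" "peval H2 x = 0" "peval f1 x = 0" "peval f2 x = 0"
    then have e: "p * peval g1 x + q * peval g2 x = 0" "r * peval g1 x + t * peval g2 x = 0"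
      by (simp_all add: H1_def H2_def peval_lc[OF g])
    \<comment> \<open>Cramer's rule: the change of basis is invertible, so \<open>H1\<close>,
      \<open>H2\<close> and \<open>g1\<close>, \<open>g2\<close> have the same common zeros.\<close>
    have "(p * t - q * r) * peval g1 x
        = t * (p * peval g1 x + q * peval g2 x) - q * (r * peval g1 x + t * peval g2 x)"
      "(p * t - q * r) * peval g2 x
        = p * (r * peval g1 x + t * peval g2 x) - r * (p * peval g1 x + q * peval g2 x)"
      by (simp_all add: algebra_simps)
    then have "peval g1 x = 0" "peval g2 x = 0" using pq e by simp_all
    then show "x = (\<lambda>_. 0)" using o x by (simp add: only_origin_def)
  qed
qed

subsection \<open>Necessary conditions on regular degree sequences\<close>

lemma bij_pt:
  fixes a b c d :: 4
  assumes "distinct [a, b, c, d]"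
  shows "bij (pt a b c d)"
proof -
  have "\<forall>i j. pt a b c d i = pt a b c d j \<longrightarrow> i = j"
    unfolding all_four using assms by auto
  then have "inj (pt a b c d)" by (auto simp: inj_def)
  then show ?thesis by (simp add: bij_def finite_UNIV_inj_surj)
qed

lemma comp_pt: "x \<circ> pt a b c d = pt (x a) (x b) (x c) (x d)"
  by (simp add: pt_def fun_eq_iff)

lemma symf_pt: "symf f \<Longrightarrow> distinct [a, b, c, d] \<Longrightarrow> f (pt (x a) (x b) (x c) (x d)) = f x"
  using bij_pt[of a b c d] comp_pt[of x a b c d] unfolding symf_def by metis

text \<open>At an eigenvector of a permutation, symmetry and homogeneity give
  \<open>f x = c ^ m * f x\<close>.\<close>

lemma symf_eigen_zero:
  assumes "form m f" "symf f" "bij \<sigma>" "x \<circ> \<sigma> = (\<lambda>i. c * x i)" "c ^ m \<noteq> 1"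
  shows "f x = 0"
proof -
  have "f x = f (x \<circ> \<sigma>)" using assms(2,3) by (simp add: symf_def)
  also have "\<dots> = c ^ m * f x" unfolding assms(4) by (rule form_scale[OF assms(1)])
  finally have "(c ^ m - 1) * f x = 0" by (simp add: algebra_simps)
  then show ?thesis using assms(5) by simp
qed

lemma regular_degseq_common_zero:
  assumes "regular_degseq d1 d2 d3 d4" "x \<noteq> (\<lambda>_. 0)"
  shows "\<exists>m\<in>{d1, d2, d3, d4}. \<exists>f. form m f \<and> symf f \<and> f x \<noteq> 0"
  using assms(1)
proof (rule regular_degseqE)
  fix f1 f2 f3 f4
  assume "form d1 f1" "form d2 f2" "form d3 f3" "form d4 f4" "symf f1" "symf f2" "symf f3" "symf f4"
    and "\<And>x. f1 x = 0 \<Longrightarrow> f2 x = 0 \<Longrightarrow> f3 x = 0 \<Longrightarrow> f4 x = 0 \<Longrightarrow> x = (\<lambda>_. 0)"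
  then show ?thesis using assms(2) by blast
qed

lemma regular_degseq_3_dvd:
  assumes "regular_degseq d1 d2 d3 d4"
  shows "3 dvd d1 \<or> 3 dvd d2 \<or> 3 dvd d3 \<or> 3 dvd d4"
proof -
  define w where "w = Complex (- 1 / 2) (sqrt 3 / 2)"
  have w2: "w\<^sup>2 = - 1 - w"
    by (simp add: w_def complex_eq_iff power2_eq_square field_simps)
  have w3: "w ^ 3 = 1"
  proof -
    have "w ^ 3 = w * w\<^sup>2" by (simp add: power3_eq_cube power2_eq_square)
    also have "\<dots> = w * (- 1 - w)" by (simp only: w2)
    also have "\<dots> = - w - w\<^sup>2" by (simp add: algebra_simps power2_eq_square)
    also have "\<dots> = 1" by (simp add: w2)
    finally show ?thesis .
  qed
  have w1: "w \<noteq> 1" by (simp add: w_def complex_eq_iff)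
  have w21: "w\<^sup>2 \<noteq> 1" by (simp add: w2) (simp add: w_def complex_eq_iff)
  have wm: "3 dvd m" if "w ^ m = 1" for m
  proof -
    have "w ^ m = w ^ (3 * (m div 3) + m mod 3)" by simp
    also have "\<dots> = w ^ (m mod 3)" unfolding power_add power_mult w3 by simp
    finally have e: "w ^ (m mod 3) = 1" using that by simp
    have "m mod 3 = 0 \<or> m mod 3 = 1 \<or> m mod 3 = 2" by linarith
    then have "m mod 3 = 0" using e w1 w21 by auto
    then show ?thesis by auto
  qed
  \<comment> \<open>An eigenvector of a 3-cycle whose eigenvalue \<open>w\<close> is a primitive
    cube root of unity.\<close>
  let ?x = "pt 0 1 w (w\<^sup>2)"
  have "?x \<noteq> (\<lambda>_. 0)"
  proof
    assume "?x = (\<lambda>_. 0)"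
    from fun_cong[OF this, of 1] show False by simp
  qed
  from regular_degseq_common_zero[OF assms this] obtain m f
    where m: "m \<in> {d1, d2, d3, d4}" "form m f" "symf f" "f ?x \<noteq> 0" by blast
  have "?x \<circ> pt 0 2 3 1 = (\<lambda>i. w * ?x i)"
    unfolding comp_pt using w3 by (simp add: fun_eq_iff all_four power2_eq_square power3_eq_cube mult.assoc)
  then have "w ^ m = 1"
    using symf_eigen_zero[OF m(2,3), of "pt 0 2 3 1" ?x w] bij_pt[of 0 2 3 1] m(4) by auto
  then show ?thesis using wm m(1) by auto
qed

lemma regular_degseq_4_dvd:
  assumes "regular_degseq d1 d2 d3 d4"
  shows "4 dvd d1 \<or> 4 dvd d2 \<or> 4 dvd d3 \<or> 4 dvd d4"
proof -
  have wm: "4 dvd m" if "\<i> ^ m = 1" for m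
  proof -
    have "\<i> ^ m = \<i> ^ (4 * (m div 4) + m mod 4)" by simp
    also have "\<dots> = \<i> ^ (m mod 4)" unfolding power_add power_mult by simp
    finally have e: "\<i> ^ (m mod 4) = 1" using that by simp
    have "m mod 4 = 0 \<or> m mod 4 = 1 \<or> m mod 4 = 2 \<or> m mod 4 = 3" by linarith
    then have "m mod 4 = 0" using e by (auto simp: power3_eq_cube complex_eq_iff)
    then show ?thesis by auto
  qed
  \<comment> \<open>An eigenvector of a 4-cycle with eigenvalue \<open>\<i>\<close>.\<close>
  let ?x = "pt 1 \<i> (- 1) (- \<i>)"
  have "?x \<noteq> (\<lambda>_. 0)"
  proof
    assume "?x = (\<lambda>_. 0)"
    from fun_cong[OF this, of 0] show False by simp
  qed
  from regular_degseq_common_zero[OF assms this] obtain m f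
    where m: "m \<in> {d1, d2, d3, d4}" "form m f" "symf f" "f ?x \<noteq> 0" by blast
  have "?x \<circ> pt 1 2 3 0 = (\<lambda>i. \<i> * ?x i)"
    unfolding comp_pt by (simp add: fun_eq_iff all_four)
  then have "\<i> ^ m = 1"
    using symf_eigen_zero[OF m(2,3), of "pt 1 2 3 0" ?x \<i>] bij_pt[of 1 2 3 0] m(4) by auto
  then show ?thesis using wm m(1) by auto
qed

text \<open>The points (u, v, -u, -v) form a two-dimensional eigenspace with eigenvalue -1, on which
  symmetric forms of odd degree vanish. With a third odd degree only one form would be left, and it
  has a nonzero zero on this plane.\<close>

lemma regular_degseq_even:
  assumes "regular_degseq d1 d2 d3 d4" "odd d1" "odd d2"
  shows "even d3" "even d4"
proof -
  have *: "even d3 \<and> even d4"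
    using assms(1)
  proof (rule regular_degseqE)
    fix f1 f2 f3 f4
    assume f: "form d1 f1" "form d2 f2" "form d3 f3" "form d4 f4"
      and s: "symf f1" "symf f2" "symf f3" "symf f4"
      and z: "\<And>x. f1 x = 0 \<Longrightarrow> f2 x = 0 \<Longrightarrow> f3 x = 0 \<Longrightarrow> f4 x = 0 \<Longrightarrow> x = (\<lambda>_. 0)"
    let ?x = "\<lambda>u v i. u * pt 1 0 (- 1) 0 i + v * pt 0 1 0 (- 1) i :: complex"
    have odd0: "g (?x u v) = 0" if "form m g" "symf g" "odd m" for m g u v
    proof (rule symf_eigen_zero[OF that(1,2) bij_pt[of 2 3 0 1], of _ "- 1"])
      show "?x u v \<circ> pt 2 3 0 1 = (\<lambda>i. - 1 * ?x u v i)"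
        unfolding comp_pt by (simp add: fun_eq_iff all_four)
    qed (use that(3) in auto)
    have nz: "?x u v \<noteq> (\<lambda>_. 0)" if "u \<noteq> 0 \<or> v \<noteq> 0" for u v
    proof
      assume "?x u v = (\<lambda>_. 0)"
      from fun_cong[OF this, of 0] fun_cong[OF this, of 1] that show False by simp
    qed
    have pos: "0 < d3" "0 < d4" using assms(1) by (auto simp: regular_degseq_def)
    obtain u v where "u \<noteq> 0 \<or> v \<noteq> 0" "f3 (?x u v) = 0"
      using form_zero_line[OF f(3) pos(1), of "pt 1 0 (- 1) 0" "pt 0 1 0 (- 1)"] by blast
    moreover obtain u' v' where "u' \<noteq> 0 \<or> v' \<noteq> 0" "f4 (?x u' v') = 0"
      using form_zero_line[OF f(4) pos(2), of "pt 1 0 (- 1) 0" "pt 0 1 0 (- 1)"] by blast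
    ultimately show ?thesis
      using odd0[OF f(1) s(1) assms(2)] odd0[OF f(2) s(2) assms(3)] odd0[OF f(3) s(3)]
        odd0[OF f(4) s(4)] z[of "?x u v"] z[of "?x u' v'"] nz by blast
  qed
  then show "even d3" "even d4" by auto
qed

lemma regular_degseq_not_1_1: "\<not> regular_degseq d1 d2 1 1"
proof
  assume r: "regular_degseq d1 d2 1 1"
  then have pos: "0 < d1" "0 < d2" by (auto simp: regular_degseq_def)
  show False
    using r
  proof (rule regular_degseqE)
    fix f1 f2 f3 f4
    assume f: "form d1 f1" "form d2 f2" "form 1 f3" "form 1 f4" "symf f3" "symf f4"
      and z: "\<And>x. f1 x = 0 \<Longrightarrow> f2 x = 0 \<Longrightarrow> f3 x = 0 \<Longrightarrow> f4 x = 0 \<Longrightarrow> x = (\<lambda>_. 0)"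
    obtain x where "E1 x = 0" "x \<noteq> (\<lambda>_. 0)" "f1 x = 0" "f2 x = 0"
      using three_forms_common_zero[OF f(1) pos(1) f(2) pos(2)] .
    then show False using z[of x] symmetric_linear_form_zero[OF f(3,5)]
        symmetric_linear_form_zero[OF f(4,6)] by blast
  qed
qed

subsection \<open>A criterion for sequences of type \<open>S\<^sup>(\<^sup>2\<^sup>,\<^sup>2\<^sup>)\<close>\<close>

lemma type_seqI:
  assumes h1: "form a h1" and h2: "form a h2" and eq: "equiv_pair h1 h2"
    and ind: "\<And>\<alpha> \<beta>. (\<And>x. \<alpha> * h1 x + \<beta> * h2 x = 0) \<Longrightarrow> \<alpha> = 0 \<and> \<beta> = 0"
    and f1: "form c f1" "symf f1" "f1 y1 \<noteq> 0" and f2: "form d f2" "symf f2" "f2 y2 \<noteq> 0"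
    and z: "\<And>x. h1 x = 0 \<Longrightarrow> h2 x = 0 \<Longrightarrow> f1 x = 0 \<Longrightarrow> f2 x = 0 \<Longrightarrow> x = (\<lambda>_. 0)"
  shows "\<exists>g1 g2 f1 f2. type_S22_44_seq a c d g1 g2 f1 f2"
proof -
  obtain p where p: "homog_of_deg c p" "symmetric_poly p" "peval p = f1"
    using symf_homog_polyE[OF f1(1,3,2)] .
  obtain q where q: "homog_of_deg d q" "symmetric_poly q" "peval q = f2"
    using symf_homog_polyE[OF f2(1,3,2)] .
  obtain g1 where g1: "supp_deg a g1" "h1 = peval g1" using form_imp_peval[OF h1] .
  obtain g2 where g2: "supp_deg a g2" "h2 = peval g2" using form_imp_peval[OF h2] .
  have li: "lin_indep2 g1 g2"
    unfolding lin_indep2_def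
  proof (intro allI impI)
    fix \<alpha> \<beta> assume "lc \<alpha> g1 \<beta> g2 = (\<lambda>_. 0)"
    then have "\<alpha> * h1 x + \<beta> * h2 x = 0" for x
      using peval_lc[OF g1(1) g2(1), of \<alpha> \<beta> x] by (simp add: g1(2) g2(2) peval_def[of "\<lambda>_. 0"])
    then show "\<alpha> = 0 \<and> \<beta> = 0" by (rule ind)
  qed
  have "g1 \<noteq> (\<lambda>_. 0)" "g2 \<noteq> (\<lambda>_. 0)"
    using li[unfolded lin_indep2_def, rule_format, of 1 0]
      li[unfolded lin_indep2_def, rule_format, of 0 1] by (auto simp: lc_def)
  then have hom: "homog_of_deg a g1" "homog_of_deg a g2" using g1 g2 by (auto simp: homog_of_deg_iff)
  have act: "perm_act \<sigma> g1 = lc \<alpha> g1 \<beta> g2 \<and> perm_act \<sigma> g2 = lc \<gamma> g1 \<delta> g2"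
    if "bij \<sigma>" "\<And>x. SA (x \<circ> \<sigma>) = \<alpha> * SA x + \<beta> * SB x" "\<And>x. SB (x \<circ> \<sigma>) = \<gamma> * SA x + \<delta> * SB x"
    for \<sigma> \<alpha> \<beta> \<gamma> \<delta>
    using equiv_pairD[OF eq that] peval_perm_lc[OF g1(1) g2(1) g1(1) that(1)]
      peval_perm_lc[OF g1(1) g2(1) g2(1) that(1)] by (simp add: g1(2) g2(2))
  have lc1: "lc 1 g1 0 g2 = g1" "lc 0 g1 1 g2 = g2" by (simp_all add: lc_def)
  have "\<exists>p q r t. p * t - q * r \<noteq> 0 \<and>
      (\<forall>\<sigma> \<alpha> \<beta> \<gamma> \<delta>. bij \<sigma> \<longrightarrow>
         perm_act \<sigma> spechtA = lc \<alpha> spechtA \<beta> spechtB \<longrightarrow>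
         perm_act \<sigma> spechtB = lc \<gamma> spechtA \<delta> spechtB \<longrightarrow>
         perm_act \<sigma> (lc p g1 q g2) = lc \<alpha> (lc p g1 q g2) \<beta> (lc r g1 t g2) \<and>
         perm_act \<sigma> (lc r g1 t g2) = lc \<gamma> (lc p g1 q g2) \<delta> (lc r g1 t g2))"
  \<comment> \<open>The identity change of basis: \<open>g1\<close>, \<open>g2\<close> already
    transform like the two Specht polynomials.\<close>
  proof (rule exI[of _ 1], rule exI[of _ 0], rule exI[of _ 0], rule exI[of _ 1], unfold lc1,
      intro conjI allI impI)
    fix \<sigma> \<alpha> \<beta> \<gamma> \<delta>
    assume s: "bij \<sigma>" "perm_act \<sigma> spechtA = lc \<alpha> spechtA \<beta> spechtB"
      "perm_act \<sigma> spechtB = lc \<gamma> spechtA \<delta> spechtB"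
    have "SA (x \<circ> \<sigma>) = \<alpha> * SA x + \<beta> * SB x" "SB (x \<circ> \<sigma>) = \<gamma> * SA x + \<delta> * SB x" for x
      using s(2,3) peval_perm_lc[OF specht_eval(1,2,1) s(1)] peval_perm_lc[OF specht_eval(1,2,2) s(1)]
      by (simp_all add: specht_eval)
    from act[OF s(1) this] show "perm_act \<sigma> g1 = lc \<alpha> g1 \<beta> g2" "perm_act \<sigma> g2 = lc \<gamma> g1 \<delta> g2"
      by auto
  qed simp
  moreover have "\<exists>\<alpha> \<beta> \<gamma> \<delta>. perm_act \<sigma> g1 = lc \<alpha> g1 \<beta> g2 \<and> perm_act \<sigma> g2 = lc \<gamma> g1 \<delta> g2"
    if b: "bij \<sigma>" for \<sigma>
  proof (rule specht_matrix[OF b])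
    fix \<alpha> \<beta> \<gamma> \<delta>
    assume "\<And>x. SA (x \<circ> \<sigma>) = \<alpha> * SA x + \<beta> * SB x" "\<And>x. SB (x \<circ> \<sigma>) = \<gamma> * SA x + \<delta> * SB x"
    from act[OF b this] show ?thesis by blast
  qed
  ultimately have "rep_S22 g1 g2" using li unfolding rep_S22_def by blast
  moreover have "only_origin [g1, g2, p, q]"
    using z by (simp add: only_origin_def p q g1 g2)
  ultimately have "type_S22_44_seq a c d g1 g2 p q"
    unfolding type_S22_44_seq_def using hom p q by blast
  then show ?thesis by blast
qed

lemma pt_line: "(\<lambda>i. u * pt a b c d i + v * pt a' b' c' d' i)
    = pt (u * a + v * a') (u * b + v * b') (u * c + v * c') (u * d + v * d' :: complex)"
  by (simp add: fun_eq_iff all_four)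

lemma pt_plane: "(\<lambda>i. u * pt a b c d i + v * pt a' b' c' d' i + w * pt a'' b'' c'' d'' i)
    = pt (u * a + v * a' + w * a'') (u * b + v * b' + w * b'')
      (u * c + v * c' + w * c'') (u * d + v * d' + w * d'' :: complex)"
  by (simp add: fun_eq_iff all_four)

text \<open>All data being symmetric, one position of the equal coordinates suffices in
  \<open>zero3\<close> and \<open>zero2\<close>. The factor multiplying \<open>G\<close> in
  \<open>zero2\<close> is \<open>res1 + res3\<close> at (p, p, r, t), where
  \<open>res2 = res3\<close>.\<close>

locale symmetric_pair =
  fixes a m n :: nat and F G f1 f2 :: "(4 \<Rightarrow> complex) \<Rightarrow> complex"
  assumes pos: "0 < m" "0 < n"
    and F: "polyfun F" "symf F" "\<And>c x. c\<^sup>2 * F (\<lambda>i. c * x i) = c ^ a * F x"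
    and G: "polyfun G" "symf G" "\<And>c x. c ^ 4 * G (\<lambda>i. c * x i) = c ^ a * G x"
    and f1: "form m f1" "symf f1" and f2: "form n f2" "symf f2"
    and zero3: "\<And>p q. f1 (pt p p p q) = 0 \<Longrightarrow> f2 (pt p p p q) = 0 \<Longrightarrow> p = 0 \<and> q = 0"
    and zero2: "\<And>p r t. f1 (pt p p r t) = 0 \<Longrightarrow> f2 (pt p p r t) = 0 \<Longrightarrow>
      F (pt p p r t) + G (pt p p r t) * (p * (r + t) + p\<^sup>2 + r * t) = 0 \<Longrightarrow> p = 0 \<and> r = 0 \<and> t = 0"
    and zero1: "\<And>x. F x = 0 \<Longrightarrow> G x = 0 \<Longrightarrow> f1 x = 0 \<Longrightarrow> f2 x = 0 \<Longrightarrow> x = (\<lambda>_. 0)"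
begin

definition h1 :: "(4 \<Rightarrow> complex) \<Rightarrow> complex" where
  "h1 x = SA x * (F x + G x * (res1 x + res3 x))"
definition h2 :: "(4 \<Rightarrow> complex) \<Rightarrow> complex" where
  "h2 x = SB x * (F x + G x * (res2 x + res3 x))"

lemma polyfun_h: "polyfun h1" "polyfun h2"
  unfolding h1_def[abs_def] h2_def[abs_def]
  by (rule polyfun.mult polyfun.add polyfun_res F(1) G(1))+

lemma scale_aux:
  fixes c s u v :: complex
  shows "(c\<^sup>2 * s) * (F (\<lambda>i. c * x i) + G (\<lambda>i. c * x i) * (c\<^sup>2 * u + c\<^sup>2 * v))
    = c ^ a * (s * (F x + G x * (u + v)))"
proof -
  have "(c\<^sup>2 * s) * (F (\<lambda>i. c * x i) + G (\<lambda>i. c * x i) * (c\<^sup>2 * u + c\<^sup>2 * v))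
      = s * (c\<^sup>2 * F (\<lambda>i. c * x i)) + s * ((c\<^sup>2 * c\<^sup>2) * G (\<lambda>i. c * x i)) * (u + v)"
    by (simp only: distrib_left distrib_right mult_ac)
  also have "c\<^sup>2 * c\<^sup>2 = c ^ 4" by (simp flip: power_add)
  finally show ?thesis unfolding F(3) G(3) by (simp only: distrib_left distrib_right mult_ac)
qed

lemma form_h: "form a h1" "form a h2"
  using polyfun_h scale_aux unfolding form_def by (simp_all add: h1_def h2_def res_scale)

lemma equiv_h: "equiv_pair h1 h2"
  unfolding equiv_pair_def
proof (intro allI impI)
  fix \<sigma> \<alpha> \<beta> \<gamma> \<delta>
  assume \<sigma>: "bij \<sigma>" and m: "\<forall>x. SA (x \<circ> \<sigma>) = \<alpha> * SA x + \<beta> * SB x"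
    "\<forall>x. SB (x \<circ> \<sigma>) = \<gamma> * SA x + \<delta> * SB x"
  show "(\<forall>x. h1 (x \<circ> \<sigma>) = \<alpha> * h1 x + \<beta> * h2 x) \<and> (\<forall>x. h2 (x \<circ> \<sigma>) = \<gamma> * h1 x + \<delta> * h2 x)"
  proof (rule specht_matrix[OF \<sigma>])
    fix \<alpha>' \<beta>' \<gamma>' \<delta>'
    assume m': "\<And>x. SA (x \<circ> \<sigma>) = \<alpha>' * SA x + \<beta>' * SB x" "\<And>x. SB (x \<circ> \<sigma>) = \<gamma>' * SA x + \<delta>' * SB x"
      and q: "\<And>x. SA (x \<circ> \<sigma>) * (res1 (x \<circ> \<sigma>) + res3 (x \<circ> \<sigma>)) =
        \<alpha>' * (SA x * (res1 x + res3 x)) + \<beta>' * (SB x * (res2 x + res3 x))"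
      "\<And>x. SB (x \<circ> \<sigma>) * (res2 (x \<circ> \<sigma>) + res3 (x \<circ> \<sigma>)) =
        \<gamma>' * (SA x * (res1 x + res3 x)) + \<delta>' * (SB x * (res2 x + res3 x))"
    have "\<alpha>' * SA x + \<beta>' * SB x = \<alpha> * SA x + \<beta> * SB x"
      "\<gamma>' * SA x + \<delta>' * SB x = \<gamma> * SA x + \<delta> * SB x" for x
      using m m'[of x] by simp_all
    note e = specht_matrix_unique[OF this(1)] specht_matrix_unique[OF this(2)]
    have s: "F (x \<circ> \<sigma>) = F x" "G (x \<circ> \<sigma>) = G x" for x using F(2) G(2) \<sigma> by (simp_all add: symf_def)
    have h: "h1 x = SA x * F x + G x * (SA x * (res1 x + res3 x))"
      "h2 x = SB x * F x + G x * (SB x * (res2 x + res3 x))" for x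
      by (simp_all add: h1_def h2_def algebra_simps)
    show ?thesis
      unfolding h s q e using m by (simp add: algebra_simps)
  qed
qed

lemma h_two_equal:
  "h1 (pt p p r t) = (p - r) * (p - t) * (F (pt p p r t) + G (pt p p r t) * (p * (r + t) + p\<^sup>2 + r * t))"
  "h2 (pt p p r t) = 0"
  by (simp_all add: h1_def h2_def SA_factor SB_factor res1_def res3_def algebra_simps power2_eq_square)

text \<open>On \<open>x 0 = x 1\<close> the form \<open>h2\<close> vanishes, so for nonzero \<alpha>
  so does \<open>h1\<close>, and after cancellation its last factor. But \<open>f1\<close> and
  \<open>f2\<close> have a nonzero common zero in this three-dimensional space, contradicting
  \<open>zero2\<close>.\<close>

lemma independent_aux:
  assumes "\<And>x. \<alpha> * h1 x + \<beta> * h2 x = 0"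
  shows "\<alpha> = 0"
proof (rule ccontr)
  assume "\<alpha> \<noteq> 0"
  then have h0: "h1 (pt p p r t) = 0" for p r t
    using assms[of "pt p p r t"] h_two_equal(2) by simp
  let ?K = "\<lambda>x. F x + G x * (res1 x + res2 x)"
  have K: "?K (pt p p r t) = F (pt p p r t) + G (pt p p r t) * (p * (r + t) + p\<^sup>2 + r * t)" for p r t
    by (simp add: res1_def res2_def algebra_simps power2_eq_square)
  have upd: "x(0 := x 1) = pt (x 1) (x 1) (x 2) (x 3)" for x :: "4 \<Rightarrow> complex"
    by (rule ext) (simp add: pt_def, metis UNIV_I UNIV_four insertE singletonD)
  have pk: "polyfun ?K" by (rule polyfun.mult polyfun.add polyfun_res F(1) G(1))+
  have "(\<lambda>x. ?K (x(0 := x 1))) = (\<lambda>_. 0)"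
  proof (rule polyfun_cancel[of "\<lambda>x. (x 1 - x 2) * (x 1 - x 3)" _ "pt 0 1 0 0"])
    show "polyfun (\<lambda>x. ?K (x(0 := x 1)))" by (rule polyfun_update[OF pk])
    show "(x 1 - x 2) * (x 1 - x 3) * ?K (x(0 := x 1)) = 0" for x
      unfolding upd K using h0[of "x 1" "x 2" "x 3"] unfolding h_two_equal .
  qed (intro polyfun_intros, simp)
  from fun_cong[OF this] have K0: "?K (pt p p r t) = 0" for p r t
    using upd[of "pt p p r t"] by (metis pt_simps(2-4))
  obtain u v w where *: "u \<noteq> 0 \<or> v \<noteq> 0 \<or> w \<noteq> 0" "f1 (pt u u v w) = 0" "f2 (pt u u v w) = 0"
    using form_common_zero[OF f1(1) f2(1) pos, of "pt 1 1 0 0" "pt 0 0 1 0" "pt 0 0 0 1"]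
    unfolding pt_plane by auto
  then show False using zero2[of u v w] K0[of u v w] K by auto
qed

lemma independent_h:
  assumes "\<And>x. \<alpha> * h1 x + \<beta> * h2 x = 0"
  shows "\<alpha> = 0 \<and> \<beta> = 0"
proof -
  \<comment> \<open>The transposition of 0 and 3 exchanges \<open>SA\<close> and \<open>SB\<close>,
    so the two coefficients change places.\<close>
  have b: "bij (pt 3 1 2 0 :: 4 \<Rightarrow> 4)" by (rule bij_pt) (use four_neq in auto)
  have "h1 (x \<circ> pt 3 1 2 0) = h2 x" "h2 (x \<circ> pt 3 1 2 0) = h1 x" for x
    using equiv_pairD[OF equiv_h b, of 0 1 1 0 x]
    by (simp_all add: SA_factor SB_factor algebra_simps)
  then have "\<beta> * h1 x + \<alpha> * h2 x = 0" for x
    using assms[of "x \<circ> pt 3 1 2 0"] by (simp add: add.commute)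
  then show ?thesis using independent_aux assms by blast
qed

text \<open>If one form were zero, a nonzero zero of the other among the points (u, u, u, v) would
  contradict \<open>zero3\<close>.\<close>

lemma f_nonzero: "\<exists>y. f1 y \<noteq> 0" "\<exists>y. f2 y \<noteq> 0"
proof -
  obtain u v where "u \<noteq> 0 \<or> v \<noteq> 0" "f1 (pt u u u v) = 0"
    using form_zero_line[OF f1(1) pos(1), of "pt 1 1 1 0" "pt 0 0 0 1"] unfolding pt_line by auto
  then show "\<exists>y. f2 y \<noteq> 0" using zero3 by blast
  obtain u v where "u \<noteq> 0 \<or> v \<noteq> 0" "f2 (pt u u u v) = 0"
    using form_zero_line[OF f2(1) pos(2), of "pt 1 1 1 0" "pt 0 0 0 1"] unfolding pt_line by auto
  then show "\<exists>y. f1 y \<noteq> 0" using zero3 by blast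
qed

lemma three_equal_zero:
  assumes "f1 x = 0" "f2 x = 0" "distinct [i, j, k, l]" "x i = x j" "x i = x k"
  shows "x i = 0 \<and> x l = 0"
  using zero3[of "x i" "x l"] symf_pt[OF f1(2) assms(3), of x] symf_pt[OF f2(2) assms(3), of x] assms
  by simp

lemma two_equal_zero:
  assumes "f1 x = 0" "f2 x = 0" "distinct [i, j, k, l]" "x i = x j"
    and "F x + G x * (x i * x k + x i * x l + (x i * x i + x k * x l)) = 0"
  shows "x i = 0 \<and> x k = 0 \<and> x l = 0"
proof (rule zero2)
  note s = symf_pt[OF _ assms(3), of _ x, unfolded assms(4)[symmetric]]
  show "f1 (pt (x i) (x i) (x k) (x l)) = 0" "f2 (pt (x i) (x i) (x k) (x l)) = 0"
    using s[OF f1(2)] s[OF f2(2)] assms(1,2) by simp_all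
  show "F (pt (x i) (x i) (x k) (x l)) + G (pt (x i) (x i) (x k) (x l)) *
      (x i * (x k + x l) + (x i)\<^sup>2 + x k * x l) = 0"
    using s[OF F(2)] s[OF G(2)] assms(5) by (simp add: power2_eq_square algebra_simps)
qed

lemma common_zero:
  assumes "h1 x = 0" "h2 x = 0" and f: "f1 x = 0" "f2 x = 0"
  shows "x = (\<lambda>_. 0)"
proof -
  note ne = four_neq four_neq[symmetric]
  have 1: "SA x = 0 \<or> F x + G x * (res1 x + res3 x) = 0"
    and 2: "SB x = 0 \<or> F x + G x * (res2 x + res3 x) = 0"
    using assms(1,2) by (simp_all add: h1_def h2_def)
  have two: "x = (\<lambda>_. 0)"
    if "distinct [i, j, k, l]" "{i, j, k, l} = UNIV" "x i = x j"
      "F x + G x * (x i * x k + x i * x l + (x i * x i + x k * x l)) = 0" for i j k l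
  proof
    fix m
    have "m \<in> {i, j, k, l}" using that(2) by blast
    then show "x m = 0" using two_equal_zero[OF f that(1,3,4)] that(3) by auto
  qed
  have three: "x = (\<lambda>_. 0)"
    if "distinct [i, j, k, l]" "{i, j, k, l} = UNIV" "x i = x j" "x i = x k" for i j k l
  proof
    fix m
    have "m \<in> {i, j, k, l}" using that(2) by blast
    then show "x m = 0" using three_equal_zero[OF f that(1,3,4)] that(3,4) by auto
  qed
  have u: "{0, 1, 2, 3} = (UNIV :: 4 set)" by (rule UNIV_four[symmetric])
  have perm: "{0, 2, 1, 3} = (UNIV :: 4 set)" "{1, 3, 0, 2} = (UNIV :: 4 set)"
    "{2, 3, 0, 1} = (UNIV :: 4 set)" "{0, 3, 1, 2} = (UNIV :: 4 set)" "{1, 2, 0, 3} = (UNIV :: 4 set)"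
    "{0, 2, 3, 1} = (UNIV :: 4 set)" "{0, 1, 3, 2} = (UNIV :: 4 set)" "{1, 2, 3, 0} = (UNIV :: 4 set)"
    unfolding u[symmetric] by auto
  consider "SA x = 0" "SB x = 0" | "SA x = 0" "F x + G x * (res2 x + res3 x) = 0"
    | "SB x = 0" "F x + G x * (res1 x + res3 x) = 0"
    | "F x + G x * (res1 x + res3 x) = 0" "F x + G x * (res2 x + res3 x) = 0"
    using 1 2 by blast
  then show ?thesis
  proof cases
    case 1
    \<comment> \<open>One equality from each factorisation always shares an index with the other, so
      three coordinates coincide.\<close>
    then have "x 0 = x 2 \<or> x 1 = x 3" "x 0 = x 1 \<or> x 2 = x 3" by (simp_all add: SA_factor SB_factor)
    then consider "x 0 = x 1" "x 0 = x 2" | "x 0 = x 2" "x 0 = x 3" | "x 0 = x 1" "x 0 = x 3"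
      | "x 1 = x 2" "x 1 = x 3" by auto
    then show ?thesis
      by cases (rule three[OF _ u] three[OF _ perm(6)] three[OF _ perm(7)] three[OF _ perm(8)];
          simp add: ne; fail)+
  next
    case 2
    then have "x 0 = x 2 \<or> x 1 = x 3" by (simp add: SA_factor)
    then show ?thesis
    proof
      assume "x 0 = x 2"
      then show ?thesis
        using 2(2) by (intro two[OF _ perm(1)]) (simp_all add: ne res2_def res3_def algebra_simps)
    next
      assume "x 1 = x 3"
      then show ?thesis
        using 2(2) by (intro two[OF _ perm(2)]) (simp_all add: ne res2_def res3_def algebra_simps)
    qed
  next
    case 3
    then have "x 0 = x 1 \<or> x 2 = x 3" by (simp add: SB_factor)
    then show ?thesis
    proof
      assume "x 0 = x 1"
      then show ?thesis
        using 3(2) by (intro two[OF _ u]) (simp_all add: ne res1_def res3_def algebra_simps)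
    next
      assume "x 2 = x 3"
      then show ?thesis
        using 3(2) by (intro two[OF _ perm(3)]) (simp_all add: ne res1_def res3_def algebra_simps)
    qed
  next
    case 4
    \<comment> \<open>Subtracting the two equations: either \<open>G\<close>, and with it
      \<open>F\<close>, vanishes and \<open>zero1\<close> applies, or two coordinates are
      equal.\<close>
    have "G x * (SA x - SB x)
        = (F x + G x * (res1 x + res3 x)) - (F x + G x * (res2 x + res3 x))"
      by (simp add: SA_def SB_def algebra_simps)
    then have "G x * (SA x - SB x) = 0" using 4 by simp
    then consider "G x = 0" | "x 0 = x 3" | "x 1 = x 2" by (auto simp: SA_SB_factor)
    then show ?thesis
    proof cases
      case 1
      then show ?thesis using 4(1) f zero1 by simp
    next
      case 2
      then show ?thesis
        using 4(1) by (intro two[OF _ perm(4)]) (simp_all add: ne res1_def res3_def algebra_simps)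
    next
      case 3
      then show ?thesis
        using 4(1) by (intro two[OF _ perm(5)]) (simp_all add: ne res1_def res3_def algebra_simps)
    qed
  qed
qed

theorem type_seq_exists: "\<exists>g1 g2 f1 f2. type_S22_44_seq a m n g1 g2 f1 f2"
proof -
  obtain y1 y2 where "f1 y1 \<noteq> 0" "f2 y2 \<noteq> 0" using f_nonzero by blast
  then show ?thesis
    using type_seqI[OF form_h equiv_h independent_h f1 _ f2 _ common_zero] by blast
qed

end

subsection \<open>Constructions\<close>

definition E2 :: "(4 \<Rightarrow> complex) \<Rightarrow> complex" where
  "E2 x = x 0 * x 1 + x 0 * x 2 + x 0 * x 3 + x 1 * x 2 + x 1 * x 3 + x 2 * x 3"
definition E3 :: "(4 \<Rightarrow> complex) \<Rightarrow> complex" where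
  "E3 x = x 0 * x 1 * x 2 + x 0 * x 1 * x 3 + x 0 * x 2 * x 3 + x 1 * x 2 * x 3"
definition E4 :: "(4 \<Rightarrow> complex) \<Rightarrow> complex" where
  "E4 x = x 0 * x 1 * x 2 * x 3"

lemma symf_E2: "symf E2" and symf_E3: "symf E3" and symf_E4: "symf E4"
proof -
  have "E2 (x \<circ> \<sigma>) = E2 x \<and> E3 (x \<circ> \<sigma>) = E3 x \<and> E4 (x \<circ> \<sigma>) = E4 x" if "bij \<sigma>" for \<sigma> x
    using bij_four[OF that]
    by (elim insertE emptyE) (simp_all add: E2_def E3_def E4_def)
  then show "symf E2" "symf E3" "symf E4" by (simp_all add: symf_def)
qed

lemma form_E2: "form 2 E2" and form_E3: "form 3 E3" and form_E4: "form 4 E4"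
proof -
  have q: "form 2 (\<lambda>x. x i * x j)" for i j
    by (rule form_mult'[OF form_intros(2) form_intros(2)]) simp
  have c: "form 3 (\<lambda>x. x i * x j * x k)" for i j k
    by (rule form_mult'[OF q form_intros(2)]) simp
  show "form 2 E2" "form 3 E3" unfolding E2_def[abs_def] E3_def[abs_def] by (intro form_intros(3) q c)+
  show "form 4 E4" unfolding E4_def[abs_def] by (rule form_mult'[OF c form_intros(2)]) simp
qed

lemma E_pt: "E1 (pt a b c d) = a + b + c + d"
  "E2 (pt a b c d) = a * b + a * c + a * d + b * c + b * d + c * d"
  "E3 (pt a b c d) = a * b * c + a * b * d + a * c * d + b * c * d"
  "E4 (pt a b c d) = a * b * c * d"
  by (simp_all add: E1_def E2_def E3_def E4_def)

text \<open>By Vieta each coordinate is a root of the monic quartic with these coefficients, here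
  T^4.\<close>

lemma E_zero:
  assumes "E1 x = 0" "E2 x = 0" "E3 x = 0" "E4 x = 0"
  shows "x = (\<lambda>_. 0)"
proof -
  have "\<forall>i. x i ^ 4 = E1 x * x i ^ 3 - E2 x * x i ^ 2 + E3 x * x i - E4 x"
    unfolding all_four
    by (simp add: E1_def E2_def E3_def E4_def algebra_simps power2_eq_square power3_eq_cube power4_eq_xxxx)
  then have "x i ^ 4 = 0" for i using assms by simp
  then show ?thesis by (simp add: fun_eq_iff)
qed

definition elem ::
  "(complex \<Rightarrow> complex \<Rightarrow> complex \<Rightarrow> complex \<Rightarrow> complex) \<Rightarrow> (4 \<Rightarrow> complex) \<Rightarrow> complex" where
  "elem f x = f (E1 x) (E2 x) (E3 x) (E4 x)"

lemma symf_elem: "symf (elem f)"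
  using symf_E1 symf_E2 symf_E3 symf_E4 by (simp add: symf_def elem_def)

text \<open>In \<open>zero2\<close>, \<open>s = r + t\<close> and \<open>w = r t\<close> for the point \<open>(p, p, r, t)\<close>.\<close>

lemma type_seq_elementary:
  assumes pos: "0 < m" "0 < n"
    and F: "form (b + 2) (elem F)" and G: "form b (elem G)" and f: "form m (elem f)" and g: "form n (elem g)"
    and zero3: "\<And>p q. f (3 * p + q) (3 * p\<^sup>2 + 3 * p * q) (p ^ 3 + 3 * p\<^sup>2 * q) (p ^ 3 * q) = 0 \<Longrightarrow>
      g (3 * p + q) (3 * p\<^sup>2 + 3 * p * q) (p ^ 3 + 3 * p\<^sup>2 * q) (p ^ 3 * q) = 0 \<Longrightarrow> p = 0 \<and> q = 0"
    and zero2: "\<And>p s w. f (2 * p + s) (p\<^sup>2 + 2 * p * s + w) (p\<^sup>2 * s + 2 * p * w) (p\<^sup>2 * w) = 0 \<Longrightarrow>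
      g (2 * p + s) (p\<^sup>2 + 2 * p * s + w) (p\<^sup>2 * s + 2 * p * w) (p\<^sup>2 * w) = 0 \<Longrightarrow>
      F (2 * p + s) (p\<^sup>2 + 2 * p * s + w) (p\<^sup>2 * s + 2 * p * w) (p\<^sup>2 * w) +
      G (2 * p + s) (p\<^sup>2 + 2 * p * s + w) (p\<^sup>2 * s + 2 * p * w) (p\<^sup>2 * w) * (p * s + p\<^sup>2 + w) = 0 \<Longrightarrow>
      p = 0 \<and> s = 0 \<and> w = 0"
    and zero1: "\<And>u v y z. F u v y z = 0 \<Longrightarrow> G u v y z = 0 \<Longrightarrow> f u v y z = 0 \<Longrightarrow> g u v y z = 0 \<Longrightarrow>
      u = 0 \<and> v = 0 \<and> y = 0 \<and> z = 0"
  shows "\<exists>g1 g2 f1 f2. type_S22_44_seq (b + 4) m n g1 g2 f1 f2"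
proof -
  have e3: "E1 (pt p p p q) = 3 * p + q" "E2 (pt p p p q) = 3 * p\<^sup>2 + 3 * p * q"
    "E3 (pt p p p q) = p ^ 3 + 3 * p\<^sup>2 * q" "E4 (pt p p p q) = p ^ 3 * q" for p q
    by (simp_all add: E_pt power2_eq_square power3_eq_cube)
  have e2: "E1 (pt p p r t) = 2 * p + (r + t)" "E2 (pt p p r t) = p\<^sup>2 + 2 * p * (r + t) + r * t"
    "E3 (pt p p r t) = p\<^sup>2 * (r + t) + 2 * p * (r * t)" "E4 (pt p p r t) = p\<^sup>2 * (r * t)" for p r t
    by (simp_all add: E_pt power2_eq_square algebra_simps)
  have "symmetric_pair (b + 4) m n (elem F) (elem G) (elem f) (elem g)"
  proof
    show "c\<^sup>2 * elem F (\<lambda>i. c * x i) = c ^ (b + 4) * elem F x" for c x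
    proof -
      have "b + 4 = 2 + (b + 2)" by simp
      then show ?thesis unfolding form_scale[OF F] by (simp only: power_add mult_ac)
    qed
    show "c ^ 4 * elem G (\<lambda>i. c * x i) = c ^ (b + 4) * elem G x" for c x
      unfolding form_scale[OF G] by (simp only: power_add mult_ac)
    show "p = 0 \<and> q = 0" if "elem f (pt p p p q) = 0" "elem g (pt p p p q) = 0" for p q
      using zero3 that unfolding elem_def e3 by blast
    show "p = 0 \<and> r = 0 \<and> t = 0"
      if "elem f (pt p p r t) = 0" "elem g (pt p p r t) = 0"
        "elem F (pt p p r t) + elem G (pt p p r t) * (p * (r + t) + p\<^sup>2 + r * t) = 0" for p r t
    proof -
      have "p = 0 \<and> r + t = 0 \<and> r * t = 0" using zero2 that unfolding elem_def e2 by blast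
      then show ?thesis by auto
    qed
    show "x = (\<lambda>_. 0)" if "elem F x = 0" "elem G x = 0" "elem f x = 0" "elem g x = 0" for x
      using zero1[OF that[unfolded elem_def]] E_zero by blast
  qed (rule pos symf_elem f g form_polyfun[OF F] form_polyfun[OF G])+
  then show ?thesis by (rule symmetric_pair.type_seq_exists)
qed

lemma form_monom:
  "k = i + 2 * j + 3 * l + 4 * r \<Longrightarrow> form k (\<lambda>x. E1 x ^ i * E2 x ^ j * E3 x ^ l * E4 x ^ r)"
  by (rule form_mult'[OF form_mult'[OF form_mult'[OF form_power[OF form_E1] form_power[OF form_E2] refl]
        form_power[OF form_E3] refl] form_power[OF form_E4]]) simp

lemma form_elem_add:
  "form k (elem f) \<Longrightarrow> form k (elem g) \<Longrightarrow> form k (elem (\<lambda>u v y z. f u v y z + g u v y z))"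
  using form_intros(3)[of k "elem f" "elem g"] by (simp add: elem_def[abs_def])

lemma form_elem_powers:
  "k = i \<Longrightarrow> form k (elem (\<lambda>u v y z. u ^ i))" "k = 2 * i \<Longrightarrow> form k (elem (\<lambda>u v y z. v ^ i))"
  "k = 3 * i \<Longrightarrow> form k (elem (\<lambda>u v y z. y ^ i))" "k = 4 * i \<Longrightarrow> form k (elem (\<lambda>u v y z. z ^ i))"
  "k = 2 * i + 3 * j \<Longrightarrow> form k (elem (\<lambda>u v y z. v ^ i * y ^ j))"
  "k = 3 * i + 4 * j \<Longrightarrow> form k (elem (\<lambda>u v y z. y ^ i * z ^ j))"
  using form_monom[of k i 0 0 0] form_monom[of k 0 i 0 0] form_monom[of k 0 0 i 0]
    form_monom[of k 0 0 0 i] form_monom[of k 0 i j 0] form_monom[of k 0 0 i j]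
  by (simp_all add: elem_def[abs_def])

subsubsection \<open>Even \<open>b\<close>\<close>

text \<open>The choice \<open>f\<^sub>1 = e\<^sub>1\<^sup>m\<close> restricts everything to \<open>e\<^sub>1 = 0\<close>, that is \<open>q = - 3 p\<close> and \<open>s = - 2 p\<close>.\<close>

lemma type_seq_linear:
  assumes pos: "0 < m" "0 < n"
    and F: "form (b + 2) (elem F)" and G: "form b (elem G)" and g: "form n (elem g)"
    and zero3: "\<And>p. g 0 (- 6 * p\<^sup>2) (- 8 * p ^ 3) (- 3 * p ^ 4) = 0 \<Longrightarrow> p = 0"
    and zero2: "\<And>p w. g 0 (w - 3 * p\<^sup>2) (2 * p * (w - p\<^sup>2)) (p\<^sup>2 * w) = 0 \<Longrightarrow>
      F 0 (w - 3 * p\<^sup>2) (2 * p * (w - p\<^sup>2)) (p\<^sup>2 * w) +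
      G 0 (w - 3 * p\<^sup>2) (2 * p * (w - p\<^sup>2)) (p\<^sup>2 * w) * (w - p\<^sup>2) = 0 \<Longrightarrow> p = 0 \<and> w = 0"
    and zero1: "\<And>v y z. F 0 v y z = 0 \<Longrightarrow> G 0 v y z = 0 \<Longrightarrow> g 0 v y z = 0 \<Longrightarrow> v = 0 \<and> y = 0 \<and> z = 0"
  shows "\<exists>g1 g2 f1 f2. type_S22_44_seq (b + 4) m n g1 g2 f1 f2"
proof (rule type_seq_elementary[OF pos F G _ g, where f = "\<lambda>u v y z. u ^ m"])
  show "form m (elem (\<lambda>u v y z. u ^ m))" by (rule form_elem_powers) simp
  show "p = 0 \<and> q = 0" if "(3 * p + q) ^ m = 0"
    "g (3 * p + q) (3 * p\<^sup>2 + 3 * p * q) (p ^ 3 + 3 * p\<^sup>2 * q) (p ^ 3 * q) = 0" for p q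
  proof -
    have 0: "3 * p + q = 0" using that(1) by simp
    then have q: "q = - 3 * p" by (simp add: eq_neg_iff_add_eq_0 add.commute)
    have "3 * p\<^sup>2 + 3 * p * q = - 6 * p\<^sup>2" "p ^ 3 + 3 * p\<^sup>2 * q = - 8 * p ^ 3" "p ^ 3 * q = - 3 * p ^ 4"
      unfolding q by (simp_all add: algebra_simps power2_eq_square power3_eq_cube power4_eq_xxxx)
    note e = this
    have "p = 0" by (rule zero3[OF that(2)[unfolded e 0]])
    then show ?thesis using q by simp
  qed
  show "p = 0 \<and> s = 0 \<and> w = 0"
    if "(2 * p + s) ^ m = 0" "g (2 * p + s) (p\<^sup>2 + 2 * p * s + w) (p\<^sup>2 * s + 2 * p * w) (p\<^sup>2 * w) = 0"
      "F (2 * p + s) (p\<^sup>2 + 2 * p * s + w) (p\<^sup>2 * s + 2 * p * w) (p\<^sup>2 * w) +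
       G (2 * p + s) (p\<^sup>2 + 2 * p * s + w) (p\<^sup>2 * s + 2 * p * w) (p\<^sup>2 * w) * (p * s + p\<^sup>2 + w) = 0" for p s w
  proof -
    have "2 * p + s = 0" using that(1) by simp
    then have s: "s = - 2 * p" by (simp add: eq_neg_iff_add_eq_0 add.commute)
    have e: "2 * p + s = 0" "p\<^sup>2 + 2 * p * s + w = w - 3 * p\<^sup>2" "p\<^sup>2 * s + 2 * p * w = 2 * p * (w - p\<^sup>2)"
      "p * s + p\<^sup>2 + w = w - p\<^sup>2"
      unfolding s by (simp_all add: algebra_simps power2_eq_square)
    show ?thesis using zero2[OF that(2,3)[unfolded e]] s by simp
  qed
  show "u = 0 \<and> v = 0 \<and> y = 0 \<and> z = 0"
    if "F u v y z = 0" "G u v y z = 0" "u ^ m = 0" "g u v y z = 0" for u v y z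
  proof -
    have "u = 0" using that(3) by simp
    then show ?thesis using zero1[of v y z] that by simp
  qed
qed

lemma nat_factor_zero: "p ^ k * of_nat N = (0::complex) \<Longrightarrow> 0 < N \<Longrightarrow> p = 0"
  by simp

text \<open>With f2 a power of e3, the dangerous points on e1 = 0 have p = 0 or w = p^2. For p = 0
  only the power of e2 survives, and for w = p^2 the factor w - p^2 removes \<open>G\<close>.
  Exactly one of b and b + 2 is divisible by 4; that degree receives the power of e4, the other one
  the power of e2.\<close>

lemma type_seq_even_3_dvd:
  assumes b: "even b" "0 < b" and m: "0 < m" and n: "3 dvd n" "0 < n"
  shows "\<exists>g1 g2 f1 f2. type_S22_44_seq (b + 4) m n g1 g2 f1 f2"
proof -
  obtain k where k: "n = 3 * k" "0 < k" using n by auto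
  have f2: "form n (elem (\<lambda>u v y z. y ^ k))" using k by (intro form_elem_powers) simp
  show ?thesis
  proof (cases "4 dvd b")
    case True
    then obtain l where l: "b = 4 * l" "0 < l" using b by auto
    show ?thesis
    proof (rule type_seq_linear[OF m n(2) _ _ f2,
          where F = "\<lambda>u v y z. v ^ (2 * l + 1)" and G = "\<lambda>u v y z. z ^ l"])
      show "form (b + 2) (elem (\<lambda>u v y z. v ^ (2 * l + 1)))" "form b (elem (\<lambda>u v y z. z ^ l))"
        using l by (auto intro!: form_elem_powers simp del: power_Suc power_add)
      fix p w :: complex
      assume *: "(2 * p * (w - p\<^sup>2)) ^ k = 0"
        "(w - 3 * p\<^sup>2) ^ (2 * l + 1) + (p\<^sup>2 * w) ^ l * (w - p\<^sup>2) = 0"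
      then consider "p = 0" | "w = p\<^sup>2" by auto
      then show "p = 0 \<and> w = 0"
      proof cases
        case 1 then show ?thesis using *(2) l by (auto simp: power_0_left)
      next
        case 2 then show ?thesis using *(2) by auto
      qed
    qed (use k l in auto)
  next
    case False
    with b have "4 dvd b + 2" by presburger
    then obtain l where l: "b + 2 = 4 * l" "0 < l" by (metis dvdE gr0I mult_0_right add_is_0 zero_neq_numeral)
    then have l': "b = 2 * (2 * l - 1)" by simp
    show ?thesis
    proof (rule type_seq_linear[OF m n(2) _ _ f2,
          where F = "\<lambda>u v y z. z ^ l" and G = "\<lambda>u v y z. v ^ (2 * l - 1)"])
      show "form (b + 2) (elem (\<lambda>u v y z. z ^ l))" "form b (elem (\<lambda>u v y z. v ^ (2 * l - 1)))"
        using l l' by (auto intro!: form_elem_powers)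
      fix p w :: complex
      assume *: "(2 * p * (w - p\<^sup>2)) ^ k = 0"
        "(p\<^sup>2 * w) ^ l + (w - 3 * p\<^sup>2) ^ (2 * l - 1) * (w - p\<^sup>2) = 0"
      then consider "p = 0" | "w = p\<^sup>2" by auto
      then show "p = 0 \<and> w = 0"
      proof cases
        case 1 then show ?thesis using *(2) l by (auto simp: power_0_left)
      next
        case 2 then show ?thesis using *(2) by auto
      qed
    qed (use k l in auto)
  qed
qed

lemma sum_2_3:
  fixes n :: nat
  assumes "2 \<le> n"
  obtains i j where "n = 2 * i + 3 * j"
proof (cases "even n")
  case True
  then show ?thesis using that[of "n div 2" 0] by simp
next
  case False
  with assms have "n = 2 * ((n - 3) div 2) + 3 * 1" by presburger
  then show ?thesis by (rule that)
qed

text \<open>The choice F = e2, G = 1 turns the last condition into w = 2 p^2, where e2 = -p^2 and e3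
  = 2 p^3 are nonzero unless p = 0.\<close>

lemma type_seq_4:
  assumes m: "0 < m" and n: "2 \<le> n"
  shows "\<exists>g1 g2 f1 f2. type_S22_44_seq 4 m n g1 g2 f1 f2"
proof -
  obtain i j where ij: "n = 2 * i + 3 * j" using sum_2_3[OF n] .
  have n0: "0 < n" using n by simp
  have f2: "form n (elem (\<lambda>u v y z. v ^ i * y ^ j))" using ij by (intro form_elem_powers)
  have "\<exists>g1 g2 f1 f2. type_S22_44_seq (0 + 4) m n g1 g2 f1 f2"
  proof (rule type_seq_linear[OF m n0 _ _ f2, where F = "\<lambda>u v y z. v ^ 1" and G = "\<lambda>u v y z. 1"])
    show "form (0 + 2) (elem (\<lambda>u v y z. v ^ 1))" by (rule form_elem_powers(2)) simp
    show "form 0 (elem (\<lambda>u v y z. 1))" unfolding elem_def[abs_def] by (rule form_intros(1))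
    fix p w :: complex
    assume *: "(w - 3 * p\<^sup>2) ^ i * (2 * p * (w - p\<^sup>2)) ^ j = 0" "(w - 3 * p\<^sup>2) ^ 1 + 1 * (w - p\<^sup>2) = 0"
    then have "2 * (w - 2 * p\<^sup>2) = 0" by (simp add: algebra_simps)
    then have w: "w = 2 * p\<^sup>2" by simp
    show "p = 0 \<and> w = 0" using *(1) unfolding w by auto
  qed auto
  then show ?thesis by simp
qed

text \<open>Here the pair is A, B itself: F = 1 and G = 0 make \<open>zero2\<close> and
  \<open>zero1\<close> vacuous, and only points with three equal coordinates need attention. The
  scheme with b = a - 4 does not reach this degree.\<close>

lemma type_seq_2:
  assumes m: "0 < m" and n: "2 \<le> n"
  shows "\<exists>g1 g2 f1 f2. type_S22_44_seq 2 m n g1 g2 f1 f2"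
proof -
  obtain i j where ij: "n = 2 * i + 3 * j" using sum_2_3[OF n] .
  have "symmetric_pair 2 m n (\<lambda>x. 1) (\<lambda>x. 0) (elem (\<lambda>u v y z. u ^ m)) (elem (\<lambda>u v y z. v ^ i * y ^ j))"
  proof
    show "p = 0 \<and> q = 0" if "elem (\<lambda>u v y z. u ^ m) (pt p p p q) = 0"
      "elem (\<lambda>u v y z. v ^ i * y ^ j) (pt p p p q) = 0" for p q
    proof -
      have "q + 3 * p = 0" using that(1) by (simp add: elem_def E_pt algebra_simps)
      then have q: "q = - 3 * p" by (simp add: eq_neg_iff_add_eq_0)
      show ?thesis using that(2) unfolding elem_def E_pt q by (auto simp: algebra_simps)
    qed
  qed (use m n ij in \<open>auto intro!: form_elem_powers polyfun.const symf_elem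
      simp: symf_def[of "\<lambda>x. 0"] symf_def[of "\<lambda>x. 1"]\<close>)
  then show ?thesis by (rule symmetric_pair.type_seq_exists)
qed

text \<open>With f2 = e2^i e3^j the points w = 3 p^2, where e2 = 0, become dangerous as well. There
  e3 = 4 p^3, e4 = 3 p^4 and w - p^2 = 2 p^2, so every remaining term is a positive multiple of the
  same power of p. For p = 0 only a power of e2 survives; for w = p^2, where e3 = 0, only one pure
  power in \<open>F\<close> does.\<close>

lemma type_seq_even_3_dvd_b:
  assumes b: "even b" "0 < b" "3 dvd b \<or> 3 dvd b + 2" and m: "0 < m" and n: "2 \<le> n"
  shows "\<exists>g1 g2 f1 f2. type_S22_44_seq (b + 4) m n g1 g2 f1 f2"
proof -
  obtain i j where ij: "n = 2 * i + 3 * j" using sum_2_3[OF n] .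
  have n0: "0 < n" using n by simp
  have f2: "form n (elem (\<lambda>u v y z. v ^ i * y ^ j))" using ij by (intro form_elem_powers)
  note lin = type_seq_linear[OF m n0 _ _ f2]
  have zero3: "p = 0" if "(- 6 * p\<^sup>2) ^ i * (- 8 * p ^ 3) ^ j = 0" for p :: complex
    using that by auto
  have cs: "v = 0 \<or> y = 0" if "v ^ i * y ^ j = 0" for v y :: complex using that by auto
  have cases2: "p = 0 \<or> w = p\<^sup>2 \<or> w = 3 * p\<^sup>2"
    if "(w - 3 * p\<^sup>2) ^ i * (2 * p * (w - p\<^sup>2)) ^ j = 0" for p w :: complex
    using that by auto
  have v0: "3 * p\<^sup>2 - 3 * p\<^sup>2 = 0" "2 * p * (2 * p\<^sup>2) = 4 * p ^ 3" "p\<^sup>2 * (3 * p\<^sup>2) = 3 * p ^ 4"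
    "3 * p\<^sup>2 - p\<^sup>2 = 2 * p\<^sup>2" for p :: complex
    by (simp_all add: algebra_simps power2_eq_square power3_eq_cube power4_eq_xxxx)
  have pw: "(4 * p ^ 3) ^ r = 4 ^ r * p ^ (3 * r)" "(3 * p ^ 4) ^ r = 3 ^ r * p ^ (4 * r)" for p :: complex and r
    by (simp_all add: power_mult_distrib power_mult)
  have "\<exists>k. b = 12 * (k + 1) \<or> b = 12 * k + 4 \<or> b = 12 * k + 6 \<or> b = 12 * k + 10"
    using b by presburger
  then obtain k where "b = 12 * (k + 1) \<or> b = 12 * k + 4 \<or> b = 12 * k + 6 \<or> b = 12 * k + 10" ..
  then consider "b = 12 * (k + 1)" | "b = 12 * k + 4" | "b = 12 * k + 6" | "b = 12 * k + 10" by blast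
  then show ?thesis
  proof cases
    case 1
    show ?thesis
    \<comment> \<open>The degree b + 2 is divisible neither by 3 nor by 4, so \<open>F\<close> has
      no pure power of e3 or e4 available; the mixed term is what excludes common zeros with e2 = 0.
      In the last case the same happens to \<open>G\<close>.\<close>
    proof (rule lin[where F = "\<lambda>u v y z. v ^ (6 * k + 7) + y\<^sup>2 * z ^ (3 * k + 2)"
          and G = "\<lambda>u v y z. z ^ (3 * k + 3) + y ^ (4 * k + 4)"])
      show "form (b + 2) (elem (\<lambda>u v y z. v ^ (6 * k + 7) + y\<^sup>2 * z ^ (3 * k + 2)))"
        "form b (elem (\<lambda>u v y z. z ^ (3 * k + 3) + y ^ (4 * k + 4)))"
        using 1 by (intro form_elem_add form_elem_powers; simp)+
      fix p w :: complex
      assume *: "(w - 3 * p\<^sup>2) ^ i * (2 * p * (w - p\<^sup>2)) ^ j = 0"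
        "(w - 3 * p\<^sup>2) ^ (6 * k + 7) + (2 * p * (w - p\<^sup>2))\<^sup>2 * (p\<^sup>2 * w) ^ (3 * k + 2) +
         ((p\<^sup>2 * w) ^ (3 * k + 3) + (2 * p * (w - p\<^sup>2)) ^ (4 * k + 4)) * (w - p\<^sup>2) = 0"
      from cases2[OF *(1)] show "p = 0 \<and> w = 0"
      proof (elim disjE)
        assume "w = 3 * p\<^sup>2"
        note e = *(2)[unfolded this v0 pw]
        have "p ^ (12 * k + 14) * of_nat (16 * 3 ^ (3 * k + 2) + 2 * (3 ^ (3 * k + 3) + 4 ^ (4 * k + 4))) = 0"
          using e by (simp add: power_add algebra_simps power_0_left)
        then have "p = 0" by (rule nat_factor_zero) simp
        then show ?thesis using \<open>w = 3 * p\<^sup>2\<close> by simp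
      qed (use *(2) in \<open>auto simp: power_0_left\<close>)
    next
      show "v = 0 \<and> y = 0 \<and> z = 0"
        if "v ^ (6 * k + 7) + y\<^sup>2 * z ^ (3 * k + 2) = 0" "z ^ (3 * k + 3) + y ^ (4 * k + 4) = 0" "v ^ i * y ^ j = 0" for v y z :: complex
        using cs[OF that(3)] that(1,2) by (auto simp: power_0_left)
    qed (rule zero3)
  next
    case 2
    show ?thesis
    proof (rule lin[where F = "\<lambda>u v y z. v ^ (6 * k + 3) + y ^ (4 * k + 2)" and G = "\<lambda>u v y z. z ^ (3 * k + 1)"])
      show "form (b + 2) (elem (\<lambda>u v y z. v ^ (6 * k + 3) + y ^ (4 * k + 2)))"
        "form b (elem (\<lambda>u v y z. z ^ (3 * k + 1)))"
        using 2 by (intro form_elem_add form_elem_powers; simp)+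
      fix p w :: complex
      assume *: "(w - 3 * p\<^sup>2) ^ i * (2 * p * (w - p\<^sup>2)) ^ j = 0"
        "(w - 3 * p\<^sup>2) ^ (6 * k + 3) + (2 * p * (w - p\<^sup>2)) ^ (4 * k + 2) +
         (p\<^sup>2 * w) ^ (3 * k + 1) * (w - p\<^sup>2) = 0"
      from cases2[OF *(1)] show "p = 0 \<and> w = 0"
      proof (elim disjE)
        assume "w = 3 * p\<^sup>2"
        note e = *(2)[unfolded this v0 pw]
        have "p ^ (12 * k + 6) * of_nat (4 ^ (4 * k + 2) + 2 * 3 ^ (3 * k + 1)) = 0"
          using e by (simp add: power_add algebra_simps power_0_left)
        then have "p = 0" by (rule nat_factor_zero) simp
        then show ?thesis using \<open>w = 3 * p\<^sup>2\<close> by simp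
      qed (use *(2) in \<open>auto simp: power_0_left\<close>)
    next
      show "v = 0 \<and> y = 0 \<and> z = 0"
        if "v ^ (6 * k + 3) + y ^ (4 * k + 2) = 0" "z ^ (3 * k + 1) = 0" "v ^ i * y ^ j = 0" for v y z :: complex
        using cs[OF that(3)] that(1,2) by (auto simp: power_0_left)
    qed (rule zero3)
  next
    case 3
    show ?thesis
    proof (rule lin[where F = "\<lambda>u v y z. z ^ (3 * k + 2)" and G = "\<lambda>u v y z. v ^ (6 * k + 3) + y ^ (4 * k + 2)"])
      show "form (b + 2) (elem (\<lambda>u v y z. z ^ (3 * k + 2)))"
        "form b (elem (\<lambda>u v y z. v ^ (6 * k + 3) + y ^ (4 * k + 2)))"
        using 3 by (intro form_elem_add form_elem_powers; simp)+
      fix p w :: complex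
      assume *: "(w - 3 * p\<^sup>2) ^ i * (2 * p * (w - p\<^sup>2)) ^ j = 0"
        "(p\<^sup>2 * w) ^ (3 * k + 2) +
         ((w - 3 * p\<^sup>2) ^ (6 * k + 3) + (2 * p * (w - p\<^sup>2)) ^ (4 * k + 2)) * (w - p\<^sup>2) = 0"
      from cases2[OF *(1)] show "p = 0 \<and> w = 0"
      proof (elim disjE)
        assume "w = 3 * p\<^sup>2"
        note e = *(2)[unfolded this v0 pw]
        have "p ^ (12 * k + 8) * of_nat (3 ^ (3 * k + 2) + 2 * 4 ^ (4 * k + 2)) = 0"
          using e by (simp add: power_add algebra_simps power_0_left)
        then have "p = 0" by (rule nat_factor_zero) simp
        then show ?thesis using \<open>w = 3 * p\<^sup>2\<close> by simp
      qed (use *(2) in \<open>auto simp: power_0_left\<close>)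
    next
      show "v = 0 \<and> y = 0 \<and> z = 0"
        if "z ^ (3 * k + 2) = 0" "v ^ (6 * k + 3) + y ^ (4 * k + 2) = 0" "v ^ i * y ^ j = 0" for v y z :: complex
        using cs[OF that(3)] that(1,2) by (auto simp: power_0_left)
    qed (rule zero3)
  next
    case 4
    show ?thesis
    proof (rule lin[where F = "\<lambda>u v y z. z ^ (3 * k + 3) + y ^ (4 * k + 4)"
          and G = "\<lambda>u v y z. v ^ (6 * k + 5) + y\<^sup>2 * z ^ (3 * k + 1)"])
      show "form (b + 2) (elem (\<lambda>u v y z. z ^ (3 * k + 3) + y ^ (4 * k + 4)))"
        "form b (elem (\<lambda>u v y z. v ^ (6 * k + 5) + y\<^sup>2 * z ^ (3 * k + 1)))"
        using 4 by (intro form_elem_add form_elem_powers; simp)+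
      fix p w :: complex
      assume *: "(w - 3 * p\<^sup>2) ^ i * (2 * p * (w - p\<^sup>2)) ^ j = 0"
        "(p\<^sup>2 * w) ^ (3 * k + 3) + (2 * p * (w - p\<^sup>2)) ^ (4 * k + 4) +
         ((w - 3 * p\<^sup>2) ^ (6 * k + 5) + (2 * p * (w - p\<^sup>2))\<^sup>2 * (p\<^sup>2 * w) ^ (3 * k + 1)) * (w - p\<^sup>2) = 0"
      from cases2[OF *(1)] show "p = 0 \<and> w = 0"
      proof (elim disjE)
        assume "w = 3 * p\<^sup>2"
        note e = *(2)[unfolded this v0 pw]
        have "p ^ (12 * k + 12) * of_nat (3 ^ (3 * k + 3) + 4 ^ (4 * k + 4) + 2 * (16 * 3 ^ (3 * k + 1))) = 0"
          using e by (simp add: power_add algebra_simps power_0_left)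
        then have "p = 0" by (rule nat_factor_zero) simp
        then show ?thesis using \<open>w = 3 * p\<^sup>2\<close> by simp
      qed (use *(2) in \<open>auto simp: power_0_left\<close>)
    next
      show "v = 0 \<and> y = 0 \<and> z = 0"
        if "z ^ (3 * k + 3) + y ^ (4 * k + 4) = 0" "v ^ (6 * k + 5) + y\<^sup>2 * z ^ (3 * k + 1) = 0" "v ^ i * y ^ j = 0" for v y z :: complex
        using cs[OF that(3)] that(1,2) by (auto simp: power_0_left)
    qed (rule zero3)
  qed
qed

subsubsection \<open>Odd \<open>b\<close>\<close>

lemma form_elem_cmult: "form k (elem f) \<Longrightarrow> form k (elem (\<lambda>u v y z. t * f u v y z))"
  using form_intros(6)[of k "elem f" t] by (simp add: elem_def[abs_def])

lemma form_elem_diff: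
  "form k (elem f) \<Longrightarrow> form k (elem g) \<Longrightarrow> form k (elem (\<lambda>u v y z. f u v y z - g u v y z))"
  using form_intros(4)[of k "elem f" "elem g"] by (simp add: elem_def[abs_def])

lemma form_elem_power:
  "form k (elem f) \<Longrightarrow> k * r = l \<Longrightarrow> form l (elem (\<lambda>u v y z. f u v y z ^ r))"
  using form_power'[of k "elem f" r l] by (simp add: elem_def[abs_def])

text \<open>The factor 4 makes the zeros for w = 0 rational: 4 (p^2 + 2 p s) - (2 p + s)^2 = s (4 p
  - s).\<close>

lemma form_quadric: "form (2 * r) (elem (\<lambda>u v y z. (4 * v ^ 1 - u ^ 2) ^ r))"
proof -
  have "form 2 (elem (\<lambda>u v y z. 4 * v ^ 1))" by (rule form_elem_cmult[OF form_elem_powers(2)]) simp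
  moreover have "form 2 (elem (\<lambda>u v y z. u ^ 2))" by (rule form_elem_powers(1)) simp
  ultimately have "form 2 (elem (\<lambda>u v y z. 4 * v ^ 1 - u ^ 2))" by (rule form_elem_diff)
  then show ?thesis by (rule form_elem_power) (rule refl)
qed

text \<open>With \<open>f\<^sub>1 = (4 e\<^sub>2 - e\<^sub>1\<^sup>2)\<^sup>\<mu>\<close> and \<open>f\<^sub>2 = e\<^sub>4\<^sup>\<nu>\<close> the points \<open>(p, p, r, t)\<close> to be excluded are, in terms of
  \<open>(p, s, w)\<close>, \<open>(0, s, s\<^sup>2/4)\<close>, \<open>(p, 0, 0)\<close> and \<open>(p, 4 p, 0)\<close>.\<close>

lemma type_seq_quadric:
  assumes pos: "0 < \<mu>" "0 < \<nu>"
    and F: "form (b + 2) (elem F)" and G: "form b (elem G)"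
    and z1: "\<And>s. F s (s\<^sup>2 / 4) 0 0 + G s (s\<^sup>2 / 4) 0 0 * (s\<^sup>2 / 4) = 0 \<Longrightarrow> s = 0"
    and z2: "\<And>p. F (2 * p) (p\<^sup>2) 0 0 + G (2 * p) (p\<^sup>2) 0 0 * p\<^sup>2 = 0 \<Longrightarrow> p = 0"
    and z3: "\<And>p. F (6 * p) (9 * p\<^sup>2) (4 * p ^ 3) 0 + G (6 * p) (9 * p\<^sup>2) (4 * p ^ 3) 0 * (5 * p\<^sup>2) = 0 \<Longrightarrow> p = 0"
    and z4: "\<And>u v y. F u v y 0 = 0 \<Longrightarrow> G u v y 0 = 0 \<Longrightarrow> u = 0 \<and> y = 0"
  shows "\<exists>g1 g2 f1 f2. type_S22_44_seq (b + 4) (2 * \<mu>) (4 * \<nu>) g1 g2 f1 f2"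
proof (rule type_seq_elementary[OF _ _ F G, where f = "\<lambda>u v y z. (4 * v ^ 1 - u ^ 2) ^ \<mu>"
      and g = "\<lambda>u v y z. z ^ \<nu>"])
  show "form (2 * \<mu>) (elem (\<lambda>u v y z. (4 * v ^ 1 - u ^ 2) ^ \<mu>))" by (rule form_quadric)
  show "form (4 * \<nu>) (elem (\<lambda>u v y z. z ^ \<nu>))" by (rule form_elem_powers) simp
  fix p q :: complex
  assume *: "(4 * (3 * p\<^sup>2 + 3 * p * q) ^ 1 - (3 * p + q) ^ 2) ^ \<mu> = 0" "(p ^ 3 * q) ^ \<nu> = 0"
  have 1: "4 * (3 * p\<^sup>2 + 3 * p * q) = (3 * p + q) ^ 2" using *(1) by simp
  have "p = 0 \<or> q = 0" using *(2) by auto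
  then show "p = 0 \<and> q = 0"
  proof
    assume "p = 0" then show ?thesis using 1 by simp
  next
    assume q: "q = 0"
    then have "3 * p\<^sup>2 = 0" using 1 by (simp add: power_mult_distrib)
    then show ?thesis using q by simp
  qed
next
  fix p s w :: complex
  assume *: "(4 * (p\<^sup>2 + 2 * p * s + w) ^ 1 - (2 * p + s) ^ 2) ^ \<mu> = 0" "(p\<^sup>2 * w) ^ \<nu> = 0"
    and F0: "F (2 * p + s) (p\<^sup>2 + 2 * p * s + w) (p\<^sup>2 * s + 2 * p * w) (p\<^sup>2 * w) +
      G (2 * p + s) (p\<^sup>2 + 2 * p * s + w) (p\<^sup>2 * s + 2 * p * w) (p\<^sup>2 * w) * (p * s + p\<^sup>2 + w) = 0"
  have 1: "4 * (p\<^sup>2 + 2 * p * s + w) = (2 * p + s) ^ 2" using *(1) by simp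
  have "p = 0 \<or> w = 0" using *(2) by auto
  then show "p = 0 \<and> s = 0 \<and> w = 0"
  proof
    assume p: "p = 0"
    then have w: "w = s\<^sup>2 / 4" using 1 by (simp add: field_simps)
    have "s = 0" by (rule z1) (use F0[unfolded p w] in simp)
    then show ?thesis using p w by simp
  next
    assume w: "w = 0"
    have "s * (4 * p - s) = 0" using 1 w by (simp add: algebra_simps power2_eq_square)
    then consider "s = 0" | "s = 4 * p" by auto
    then show ?thesis
    proof cases
      case 1
      then have "p = 0" using F0 w by - (rule z2, simp)
      then show ?thesis using 1 w by simp
    next
      case 2
      have e: "2 * p + s = 6 * p" "p\<^sup>2 + 2 * p * s + w = 9 * p\<^sup>2" "p\<^sup>2 * s + 2 * p * w = 4 * p ^ 3"
        "p\<^sup>2 * w = 0" "p * s + p\<^sup>2 + w = 5 * p\<^sup>2"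
        unfolding 2 w by (simp_all add: power2_eq_square power3_eq_cube)
      have "p = 0" using F0[unfolded e] by (rule z3)
      then show ?thesis using 2 w by simp
    qed
  qed
next
  fix u v y z :: complex
  assume *: "F u v y z = 0" "G u v y z = 0" "(4 * v ^ 1 - u ^ 2) ^ \<mu> = 0" "z ^ \<nu> = 0"
  then have z: "z = 0" by simp
  have "u = 0 \<and> y = 0" using z4[of u v y] *(1,2) unfolding z by blast
  then show "u = 0 \<and> v = 0 \<and> y = 0 \<and> z = 0" using *(3) z by simp
qed (use pos in auto)

text \<open>Whichever of b and b + 2 is a multiple of 3 receives a power of e3, the other a power of
  e1. The first two kinds of dangerous points have e3 = 0, leaving the power of e1; at (p, 4 p, 0)
  both terms are positive multiples of the same power of p.\<close>

lemma type_seq_odd_3_dvd_b: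
  assumes b: "0 < b" "3 dvd b \<or> 3 dvd b + 2" and pos: "0 < \<mu>" "0 < \<nu>"
  shows "\<exists>g1 g2 f1 f2. type_S22_44_seq (b + 4) (2 * \<mu>) (4 * \<nu>) g1 g2 f1 f2"
  using b(2)
proof
  assume "3 dvd b"
  then obtain k where k: "b = 3 * k" "0 < k" using b(1) by auto
  show ?thesis
  proof (rule type_seq_quadric[OF pos, where F = "\<lambda>u v y z. u ^ (b + 2)" and G = "\<lambda>u v y z. y ^ k"])
    show "form (b + 2) (elem (\<lambda>u v y z. u ^ (b + 2)))" "form b (elem (\<lambda>u v y z. y ^ k))"
      using k(1) by (intro form_elem_powers; simp)+
    fix p :: complex
    assume e: "(6 * p) ^ (b + 2) + (4 * p ^ 3) ^ k * (5 * p\<^sup>2) = 0"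
    have "(4 * p ^ 3) ^ k = 4 ^ k * p ^ b" by (simp add: k(1) power_mult_distrib power_mult)
    with e have "p ^ (b + 2) * of_nat (6 ^ (b + 2) + 5 * 4 ^ k) = 0"
      by (simp add: power_mult_distrib power_add algebra_simps power2_eq_square)
    then show "p = 0" by (rule nat_factor_zero) simp
  qed (use k in \<open>auto simp: power_0_left\<close>)
next
  assume "3 dvd b + 2"
  then obtain k where k: "b + 2 = 3 * k" by auto
  then have k0: "0 < k" using b(1) by (cases k) auto
  show ?thesis
  proof (rule type_seq_quadric[OF pos, where F = "\<lambda>u v y z. y ^ k" and G = "\<lambda>u v y z. u ^ b"])
    show "form (b + 2) (elem (\<lambda>u v y z. y ^ k))" "form b (elem (\<lambda>u v y z. u ^ b))"
      using k by (intro form_elem_powers; simp)+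
    fix p :: complex
    assume e: "(4 * p ^ 3) ^ k + (6 * p) ^ b * (5 * p\<^sup>2) = 0"
    have "(4 * p ^ 3) ^ k = 4 ^ k * p ^ (b + 2)" unfolding k by (simp add: power_mult_distrib power_mult)
    with e have "p ^ (b + 2) * of_nat (4 ^ k + 5 * 6 ^ b) = 0"
      by (simp add: power_mult_distrib power_add algebra_simps power2_eq_square)
    then show "p = 0" by (rule nat_factor_zero) simp
  qed (use b k0 in \<open>auto simp: power_0_left\<close>)
qed

text \<open>Each point of \<open>S\<close> excludes just one scalar, and 0 is excluded too.\<close>

lemma generic_scalar:
  fixes f g :: "complex \<Rightarrow> complex"
  assumes "finite S" "\<And>x. x \<in> S \<Longrightarrow> g x \<noteq> 0"
  obtains t where "t \<noteq> 0" "\<And>x. x \<in> S \<Longrightarrow> f x + t * g x \<noteq> 0"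
proof -
  have "finite (insert 0 ((\<lambda>x. - f x / g x) ` S))" using assms(1) by simp
  then obtain t where t: "t \<notin> insert 0 ((\<lambda>x. - f x / g x) ` S)"
    using ex_new_if_finite[OF infinite_UNIV_char_0] by blast
  have "f x + t * g x \<noteq> 0" if x: "x \<in> S" for x
  proof
    assume "f x + t * g x = 0"
    then have "t * g x = - f x" by (simp add: eq_neg_iff_add_eq_0 add.commute)
    then have "t = - f x / g x" using assms(2)[OF x] by (simp add: field_simps)
    then show False using t x by blast
  qed
  with t that show ?thesis by blast
qed

text \<open>The roots of \<open>R\<close> are the ratios \<open>s / p\<close> of the points \<open>(p, p, r, t)\<close> where \<open>f\<^sub>1, f\<^sub>2\<close> vanish; a generic
  multiple \<open>t e\<^sub>1\<^sup>b\<close> as \<open>G\<close> avoids them.\<close>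

lemma type_seq_odd_12_dvd:
  assumes b: "b + 2 = 3 * i + 4 * j" "0 < i" "0 < j" "0 < b" and pos: "0 < \<mu>" "0 < \<nu>"
  shows "\<exists>g1 g2 f1 f2. type_S22_44_seq (b + 4) (2 * \<mu>) (12 * \<nu>) g1 g2 f1 f2"
proof -
  \<comment> \<open>Dehomogenised e3^4 + e4^3: with s = p x and w = p^2 (x^2/4 - x) from the
    quadric, e3 = p^3 (x^2/2 - x) and e4 = p^4 (x^2/4 - x).\<close>
  define R :: "complex poly" where "R = [:0, - 1, 1 / 2:] ^ 4 + [:0, - 1, 1 / 4:] ^ 3"
  have R: "poly R x = (x\<^sup>2 / 2 - x) ^ 4 + (x\<^sup>2 / 4 - x) ^ 3" for x
    by (simp add: R_def algebra_simps power2_eq_square)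
  have "R \<noteq> 0"
  proof
    assume "R = 0"
    then have "poly R 2 = 0" by simp
    then show False unfolding R by simp
  qed
  then have fin: "finite {x. poly R x = 0}" by (rule poly_roots_finite)
  \<comment> \<open>The cofactor of \<open>t\<close> must not vanish at a root of \<open>R\<close>.
    At x = -2 the value of \<open>R\<close> is 283, and modulo x^2 = -4 it reduces to x -
    53.\<close>
  have nz: "(2 + x) ^ b * (1 + x\<^sup>2 / 4) \<noteq> 0" if "x \<in> {x. poly R x = 0}" for x
  proof
    assume "(2 + x) ^ b * (1 + x\<^sup>2 / 4) = 0"
    then consider "2 + x = 0" | "1 + x\<^sup>2 / 4 = 0" by auto
    then show False
    proof cases
      case 1
      then have "x = - 2" by (simp add: eq_neg_iff_add_eq_0 add.commute)
      then show False using that by (simp add: R)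
    next
      case 2
      then have x2: "x\<^sup>2 = - 4" by (simp add: add_divide_eq_iff field_simps eq_neg_iff_add_eq_0)
      have "(x\<^sup>2 / 2 - x) ^ 4 + (x\<^sup>2 / 4 - x) ^ 3 = (- 2 - x) ^ 4 + (- 1 - x) ^ 3"
        unfolding x2 by simp
      also have "\<dots> = x\<^sup>2 * x\<^sup>2 + 7 * (x\<^sup>2 * x) + 21 * x\<^sup>2 + 29 * x + 15"
        by (simp add: algebra_simps power2_eq_square power3_eq_cube power4_eq_xxxx)
      also have "\<dots> = x - 53" unfolding x2 by simp
      finally have "x = 53" using that by (simp add: R)
      then show False using x2 by simp
    qed
  qed
  obtain t where t: "t \<noteq> 0" "\<And>x. x \<in> {x. poly R x = 0} \<Longrightarrow>
      (x\<^sup>2 / 2 - x) ^ i * (x\<^sup>2 / 4 - x) ^ j + t * ((2 + x) ^ b * (1 + x\<^sup>2 / 4)) \<noteq> 0"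
    by (rule generic_scalar[OF fin, where f = "\<lambda>x. (x\<^sup>2 / 2 - x) ^ i * (x\<^sup>2 / 4 - x) ^ j"
          and g = "\<lambda>x. (2 + x) ^ b * (1 + x\<^sup>2 / 4)"]) (rule nz, assumption, rule that)
  show ?thesis
  \<comment> \<open>In the intended application no pure power of e2, e3 or e4 has degree b or b + 2.
    The product in \<open>F\<close> kills e3 or e4, and e3^4 + e4^3 then kills the other.\<close>
  proof (rule type_seq_elementary[where F = "\<lambda>u v y z. y ^ i * z ^ j" and G = "\<lambda>u v y z. t * u ^ b"
        and f = "\<lambda>u v y z. (4 * v ^ 1 - u ^ 2) ^ \<mu>" and g = "\<lambda>u v y z. (y ^ 4 + z ^ 3) ^ \<nu>"])
    show "form (2 * \<mu>) (elem (\<lambda>u v y z. (4 * v ^ 1 - u ^ 2) ^ \<mu>))" by (rule form_quadric)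
    show "form (12 * \<nu>) (elem (\<lambda>u v y z. (y ^ 4 + z ^ 3) ^ \<nu>))"
      by (rule form_elem_power[OF form_elem_add[of 12]]; (intro form_elem_powers)?; simp)
    show "form (b + 2) (elem (\<lambda>u v y z. y ^ i * z ^ j))" using b(1) by (rule form_elem_powers)
    show "form b (elem (\<lambda>u v y z. t * u ^ b))" by (intro form_elem_cmult form_elem_powers refl)
    fix p q :: complex
    assume *: "(4 * (3 * p\<^sup>2 + 3 * p * q) ^ 1 - (3 * p + q) ^ 2) ^ \<mu> = 0"
      "((p ^ 3 + 3 * p\<^sup>2 * q) ^ 4 + (p ^ 3 * q) ^ 3) ^ \<nu> = 0"
    have q2: "q\<^sup>2 = 6 * (p * q) + 3 * p\<^sup>2" using *(1) by (simp add: algebra_simps power2_eq_square)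
    have "p = 0"
    proof (rule ccontr)
      assume p: "p \<noteq> 0"
      have sq: "(p + 3 * q)\<^sup>2 = 28 * p\<^sup>2 + 60 * (p * q)"
      proof -
        have "(p + 3 * q)\<^sup>2 = p\<^sup>2 + 6 * (p * q) + 9 * q\<^sup>2" by (simp add: algebra_simps power2_eq_square)
        then show ?thesis unfolding q2 by simp
      qed
      have "(p + 3 * q) ^ 4 = ((p + 3 * q)\<^sup>2)\<^sup>2" by simp
      also have "\<dots> = 784 * (p\<^sup>2 * p\<^sup>2) + 3360 * (p\<^sup>2 * (p * q)) + 3600 * (p\<^sup>2 * q\<^sup>2)"
        unfolding sq by (simp add: algebra_simps power2_eq_square)
      also have "\<dots> = p ^ 3 * (11584 * p + 24960 * q)"
        unfolding q2 by (simp add: algebra_simps power2_eq_square power3_eq_cube)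
      finally have f4: "(p + 3 * q) ^ 4 = p ^ 3 * (11584 * p + 24960 * q)" .
      have "q ^ 3 = q * q\<^sup>2" by (simp add: power2_eq_square power3_eq_cube)
      also have "\<dots> = q * (6 * (p * q) + 3 * p\<^sup>2)" by (simp only: q2)
      also have "\<dots> = 6 * (p * q\<^sup>2) + 3 * (p\<^sup>2 * q)" by (simp add: algebra_simps power2_eq_square)
      also have "\<dots> = p\<^sup>2 * (39 * q + 18 * p)"
        unfolding q2 by (simp add: algebra_simps power2_eq_square)
      finally have q3: "q ^ 3 = p\<^sup>2 * (39 * q + 18 * p)" .
      have "(p ^ 3 + 3 * p\<^sup>2 * q) ^ 4 + (p ^ 3 * q) ^ 3 = p ^ 8 * (p + 3 * q) ^ 4 + p ^ 9 * q ^ 3"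
      proof -
        have "p ^ 3 + 3 * p\<^sup>2 * q = p\<^sup>2 * (p + 3 * q)" by (simp add: algebra_simps power2_eq_square power3_eq_cube)
        then show ?thesis by (simp add: power_mult_distrib flip: power_mult)
      qed
      also have "\<dots> = p ^ 11 * (11602 * p + 24999 * q)"
      proof -
        have "p ^ 8 * (p ^ 3 * A) = p ^ 11 * A" "p ^ 9 * (p\<^sup>2 * A) = p ^ 11 * A" for A
          by (simp_all flip: power_add mult.assoc)
        then have "p ^ 8 * (p + 3 * q) ^ 4 + p ^ 9 * q ^ 3
            = p ^ 11 * ((11584 * p + 24960 * q) + (39 * q + 18 * p))"
          unfolding f4 q3 by (simp only: distrib_left)
        then show ?thesis by (simp add: algebra_simps)
      qed
      finally have "11602 * p + 24999 * q = 0" using *(2) p by simp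
      then have Q: "24999 * q = - 11602 * p" by (simp add: eq_neg_iff_add_eq_0 add.commute)
      \<comment> \<open>The relation q^2 - 6 p q - 3 p^2 = 0 times 24999^2. Inserting the linear
        relation leaves a nonzero multiple of p^2, so the two relations are incompatible for nonzero
        p.\<close>
      have "0 = (24999 * q)\<^sup>2 - 149994 * p * (24999 * q) - 1874850003 * p\<^sup>2"
        by (simp add: power_mult_distrib q2 algebra_simps)
      also have "\<dots> = (- 11602 * p)\<^sup>2 - 149994 * p * (- 11602 * p) - 1874850003 * p\<^sup>2" by (simp only: Q)
      also have "\<dots> = - 13211 * p\<^sup>2" by (simp add: power2_eq_square algebra_simps)
      finally have "p\<^sup>2 = 0" by simp
      then show False using p by simp
    qed
    then show "p = 0 \<and> q = 0" using q2 by simp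
  next
    fix p s w :: complex
    assume *: "(4 * (p\<^sup>2 + 2 * p * s + w) ^ 1 - (2 * p + s) ^ 2) ^ \<mu> = 0"
      "((p\<^sup>2 * s + 2 * p * w) ^ 4 + (p\<^sup>2 * w) ^ 3) ^ \<nu> = 0"
      "(p\<^sup>2 * s + 2 * p * w) ^ i * (p\<^sup>2 * w) ^ j + t * (2 * p + s) ^ b * (p * s + p\<^sup>2 + w) = 0"
    have w4: "4 * w = s\<^sup>2 - 4 * p * s" using *(1) by (simp add: algebra_simps power2_eq_square)
    have w: "w = (s\<^sup>2 - 4 * p * s) / 4" by (simp flip: w4)
    have "p = 0"
    proof (rule ccontr)
      assume p: "p \<noteq> 0"
      define x where "x = s / p"
      have s: "s = p * x" using p by (simp add: x_def)
      have e: "p\<^sup>2 * s + 2 * p * w = p ^ 3 * (x\<^sup>2 / 2 - x)" "p\<^sup>2 * w = p ^ 4 * (x\<^sup>2 / 4 - x)"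
        "2 * p + s = p * (2 + x)" "p * s + p\<^sup>2 + w = p\<^sup>2 * (1 + x\<^sup>2 / 4)"
        unfolding w s by (simp_all add: field_simps power2_eq_square power3_eq_cube power4_eq_xxxx)
      have "(p ^ 3 * (x\<^sup>2 / 2 - x)) ^ 4 + (p ^ 4 * (x\<^sup>2 / 4 - x)) ^ 3 = 0"
        using *(2) unfolding e by simp
      then have "p ^ 12 * poly R x = 0"
        unfolding R power_mult_distrib power_mult[symmetric] by (simp add: algebra_simps)
      then have "x \<in> {x. poly R x = 0}" using p by simp
      note tx = t(2)[OF this]
      have "p ^ (b + 2) * ((x\<^sup>2 / 2 - x) ^ i * (x\<^sup>2 / 4 - x) ^ j + t * ((2 + x) ^ b * (1 + x\<^sup>2 / 4)))
        = (p ^ 3 * (x\<^sup>2 / 2 - x)) ^ i * (p ^ 4 * (x\<^sup>2 / 4 - x)) ^ j + t * (p * (2 + x)) ^ b * (p\<^sup>2 * (1 + x\<^sup>2 / 4))"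
      proof -
        have 1: "p ^ (b + 2) = (p ^ 3) ^ i * (p ^ 4) ^ j" unfolding b(1) by (simp add: power_add power_mult)
        have 2: "p ^ (b + 2) = p ^ b * p\<^sup>2" by (rule power_add)
        have e: "p ^ (b + 2) * (X * Y + t * (X' * Y')) = (p ^ 3) ^ i * X * ((p ^ 4) ^ j * Y) + t * (p ^ b * X') * (p\<^sup>2 * Y')"
          for X Y X' Y'
        proof -
          have "p ^ (b + 2) * (X * Y) = (p ^ 3) ^ i * X * ((p ^ 4) ^ j * Y)" by (simp only: 1 mult_ac)
          moreover have "p ^ (b + 2) * (t * (X' * Y')) = t * (p ^ b * X') * (p\<^sup>2 * Y')"
            by (simp only: 2 mult_ac)
          ultimately show ?thesis by (simp only: distrib_left)
        qed
        show ?thesis unfolding power_mult_distrib by (rule e)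
      qed
      then show False using *(3)[unfolded e] tx p by simp
    qed
    \<comment> \<open>For p = 0 both e3 and e4 vanish and w = s^2/4, so the last equation is
      \<open>t\<close> times a power of s.\<close>
    then show "p = 0 \<and> s = 0 \<and> w = 0" using *(3) w t(1) b by (auto simp: power_0_left)
  next
    fix u v y z :: complex
    assume *: "y ^ i * z ^ j = 0" "t * u ^ b = 0" "(4 * v ^ 1 - u ^ 2) ^ \<mu> = 0" "(y ^ 4 + z ^ 3) ^ \<nu> = 0"
    then have "u = 0" "y = 0 \<or> z = 0" "y ^ 4 + z ^ 3 = 0" "4 * v = u\<^sup>2" using t(1) by auto
    then show "u = 0 \<and> v = 0 \<and> y = 0 \<and> z = 0" by auto
  qed (use pos in auto)
qed

text \<open>Since f2 is a power of e4, either p = 0 or w = 0. For p = 0 also e3 = 0, and what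
  remains is w^3 + s^6 = 0 with s^b w = 0. For w = 0 the ratio x = s/p is a root of
  \<open>R\<close>, and a generic \<open>t\<close> avoids the finitely many bad values.\<close>

lemma type_seq_odd_6_dvd:
  assumes b: "b = 2 * \<beta> + 1" "0 < \<beta>" and pos: "0 < \<mu>" "0 < \<nu>"
  shows "\<exists>g1 g2 f1 f2. type_S22_44_seq (b + 4) (6 * \<mu>) (4 * \<nu>) g1 g2 f1 f2"
proof -
  \<comment> \<open>Dehomogenised e3^2 + e2^3 + e1^6 at w = 0: there e3 = p^3 x, e2 = p^2 (1 + 2 x)
    and e1 = p (2 + x).\<close>
  define R :: "complex poly" where "R = [:0, 1:] ^ 2 + [:1, 2:] ^ 3 + [:2, 1:] ^ 6"
  have R: "poly R x = x\<^sup>2 + (1 + 2 * x) ^ 3 + (2 + x) ^ 6" for x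
    by (simp add: R_def algebra_simps)
  have "R \<noteq> 0"
  proof
    assume "R = 0"
    then have "poly R 0 = 0" by simp
    then show False unfolding R by simp
  qed
  then have fin: "finite {x. poly R x = 0}" by (rule poly_roots_finite)
  have nz: "(2 + x) ^ b * (x + 1) \<noteq> 0" if "x \<in> {x. poly R x = 0}" for x
  proof
    assume "(2 + x) ^ b * (x + 1) = 0"
    then have "x + 2 = 0 \<or> x + 1 = 0" by (auto simp: add.commute)
    then have "x = - 2 \<or> x = - 1" by (simp add: eq_neg_iff_add_eq_0)
    \<comment> \<open>\<open>R\<close> takes the values -23 at -2 and 1 at -1.\<close>
    then show False using that by (auto simp: R)
  qed
  obtain t where t: "t \<noteq> 0" "\<And>x. x \<in> {x. poly R x = 0} \<Longrightarrow>
      (1 + 2 * x) ^ \<beta> * x + t * ((2 + x) ^ b * (x + 1)) \<noteq> 0"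
    by (rule generic_scalar[OF fin, where f = "\<lambda>x. (1 + 2 * x) ^ \<beta> * x"
          and g = "\<lambda>x. (2 + x) ^ b * (x + 1)"]) (rule nz, assumption, rule that)
  show ?thesis
  proof (rule type_seq_elementary[where F = "\<lambda>u v y z. v ^ \<beta> * y ^ 1" and G = "\<lambda>u v y z. t * u ^ b"
        and f = "\<lambda>u v y z. (y ^ 2 + v ^ 3 + u ^ 6) ^ \<mu>" and g = "\<lambda>u v y z. z ^ \<nu>"])
    show "form (6 * \<mu>) (elem (\<lambda>u v y z. (y ^ 2 + v ^ 3 + u ^ 6) ^ \<mu>))"
      by (rule form_elem_power[OF form_elem_add[OF form_elem_add[of 6]]]; (intro form_elem_powers)?; simp)
    show "form (4 * \<nu>) (elem (\<lambda>u v y z. z ^ \<nu>))" by (rule form_elem_powers) simp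
    show "form (b + 2) (elem (\<lambda>u v y z. v ^ \<beta> * y ^ 1))" by (rule form_elem_powers) (simp add: b(1))
    show "form b (elem (\<lambda>u v y z. t * u ^ b))" by (intro form_elem_cmult form_elem_powers refl)
    fix p q :: complex
    assume *: "((p ^ 3 + 3 * p\<^sup>2 * q) ^ 2 + (3 * p\<^sup>2 + 3 * p * q) ^ 3 + (3 * p + q) ^ 6) ^ \<mu> = 0"
      "(p ^ 3 * q) ^ \<nu> = 0"
    have 1: "(p ^ 3 + 3 * p\<^sup>2 * q) ^ 2 + (3 * p\<^sup>2 + 3 * p * q) ^ 3 + (3 * p + q) ^ 6 = 0" using *(1) by simp
    have "p = 0 \<or> q = 0" using *(2) by auto
    then show "p = 0 \<and> q = 0"
    proof
      assume "p = 0" then show ?thesis using 1 by simp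
    next
      assume q: "q = 0"
      then have "757 * p ^ 6 = 0" using 1 by (simp add: power_mult_distrib flip: power_mult)
      then show ?thesis using q by simp
    qed
  next
    fix p s w :: complex
    assume *: "((p\<^sup>2 * s + 2 * p * w) ^ 2 + (p\<^sup>2 + 2 * p * s + w) ^ 3 + (2 * p + s) ^ 6) ^ \<mu> = 0"
      "(p\<^sup>2 * w) ^ \<nu> = 0"
      "(p\<^sup>2 + 2 * p * s + w) ^ \<beta> * (p\<^sup>2 * s + 2 * p * w) ^ 1 + t * (2 * p + s) ^ b * (p * s + p\<^sup>2 + w) = 0"
    have 1: "(p\<^sup>2 * s + 2 * p * w) ^ 2 + (p\<^sup>2 + 2 * p * s + w) ^ 3 + (2 * p + s) ^ 6 = 0" using *(1) by simp
    have pw: "p = 0 \<or> w = 0" using *(2) by auto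
    have "p = 0"
    proof (rule ccontr)
      assume p: "p \<noteq> 0"
      then have w: "w = 0" using pw by simp
      define x where "x = s / p"
      have s: "s = p * x" using p by (simp add: x_def)
      have e: "p\<^sup>2 * s + 2 * p * w = p ^ 3 * x" "p\<^sup>2 + 2 * p * s + w = p\<^sup>2 * (1 + 2 * x)"
        "2 * p + s = p * (2 + x)" "p * s + p\<^sup>2 + w = p\<^sup>2 * (x + 1)"
        unfolding w s by (simp_all add: algebra_simps power2_eq_square power3_eq_cube)
      have "(p ^ 3 * x) ^ 2 + (p\<^sup>2 * (1 + 2 * x)) ^ 3 + (p * (2 + x)) ^ 6 = 0"
        using 1 unfolding e .
      then have "p ^ 6 * poly R x = 0"
        unfolding R power_mult_distrib power_mult[symmetric] by (simp add: algebra_simps)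
      then have "x \<in> {x. poly R x = 0}" using p by simp
      note tx = t(2)[OF this]
      have "p ^ (b + 2) * ((1 + 2 * x) ^ \<beta> * x + t * ((2 + x) ^ b * (x + 1)))
        = (p\<^sup>2 * (1 + 2 * x)) ^ \<beta> * (p ^ 3 * x) ^ 1 + t * (p * (2 + x)) ^ b * (p\<^sup>2 * (x + 1))"
      proof -
        have 1: "p ^ (b + 2) = (p\<^sup>2) ^ \<beta> * p ^ 3"
          by (simp add: b(1) power_add power_mult power2_eq_square power3_eq_cube)
        have 2: "p ^ (b + 2) = p ^ b * p\<^sup>2" by (rule power_add)
        have e: "p ^ (b + 2) * (X * Y + t * (X' * Y')) = (p\<^sup>2) ^ \<beta> * X * (p ^ 3 * Y) + t * (p ^ b * X') * (p\<^sup>2 * Y')"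
          for X Y X' Y'
        proof -
          have "p ^ (b + 2) * (X * Y) = (p\<^sup>2) ^ \<beta> * X * (p ^ 3 * Y)" by (simp only: 1 mult_ac)
          moreover have "p ^ (b + 2) * (t * (X' * Y')) = t * (p ^ b * X') * (p\<^sup>2 * Y')"
            by (simp only: 2 mult_ac)
          ultimately show ?thesis by (simp only: distrib_left)
        qed
        show ?thesis unfolding power_mult_distrib power_one_right by (rule e)
      qed
      then show False using *(3)[unfolded e] tx p by simp
    qed
    then show "p = 0 \<and> s = 0 \<and> w = 0" using *(3) 1 t(1) by auto
  next
    fix u v y z :: complex
    assume *: "v ^ \<beta> * y ^ 1 = 0" "t * u ^ b = 0" "(y ^ 2 + v ^ 3 + u ^ 6) ^ \<mu> = 0" "z ^ \<nu> = 0"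
    then have "u = 0" "v = 0 \<or> y = 0" "y ^ 2 + v ^ 3 + u ^ 6 = 0" "z = 0" using t(1) by auto
    then show "u = 0 \<and> v = 0 \<and> y = 0 \<and> z = 0" by auto
  qed (use pos in auto)
qed

lemma type_seq_odd:
  assumes b: "odd b" and m: "even m" "0 < m" and n: "4 dvd n" "0 < n"
    and 3: "3 dvd b + 2 \<or> 3 dvd b \<or> 3 dvd m \<or> 3 dvd n"
  shows "\<exists>g1 g2 f1 f2. type_S22_44_seq (b + 4) m n g1 g2 f1 f2"
proof -
  obtain \<mu> where \<mu>: "m = 2 * \<mu>" "0 < \<mu>" using m by (auto elim!: evenE)
  obtain \<nu> where \<nu>: "n = 4 * \<nu>" "0 < \<nu>" using n by auto
  have b0: "0 < b" using b by (cases b) auto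
  consider "3 dvd b \<or> 3 dvd b + 2" | "\<not> 3 dvd b" "\<not> 3 dvd b + 2" "3 dvd n"
    | "\<not> 3 dvd b" "\<not> 3 dvd b + 2" "3 dvd m" using 3 by blast
  then show ?thesis
  proof cases
    case 1
    then show ?thesis using type_seq_odd_3_dvd_b[OF b0 1 \<mu>(2) \<nu>(2)] \<mu> \<nu> by simp
  next
    case 2
    then have "12 dvd n" using n(1) by presburger
    then obtain k where k: "n = 12 * k" "0 < k" using n(2) by auto
    \<comment> \<open>An odd b with neither b nor b + 2 divisible by 3 is 5 modulo 6. The two
      residues modulo 12 give b + 2 = 3 i + 4 (3 l + 1) with i = 1 or i = 3.\<close>
    have "\<exists>k. b = 12 * k + 5 \<or> b = 12 * k + 11" using 2(1,2) b by presburger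
    then obtain l where "b = 12 * l + 5 \<or> b = 12 * l + 11" ..
    then have "b + 2 = 3 * 1 + 4 * (3 * l + 1) \<or> b + 2 = 3 * 3 + 4 * (3 * l + 1)" by auto
    then have "\<exists>i. b + 2 = 3 * i + 4 * (3 * l + 1) \<and> 0 < i"
      by (elim disjE) (intro exI[of _ 1], simp, intro exI[of _ 3], simp)
    then obtain i where i: "b + 2 = 3 * i + 4 * (3 * l + 1)" "0 < i" by blast
    have "0 < 3 * l + 1" by simp
    from type_seq_odd_12_dvd[OF i this b0 \<mu>(2) k(2)] show ?thesis using \<mu> k by simp
  next
    case 3
    then have "6 dvd m" using m(1) divides_mult[of 3 m 2] by simp
    then obtain k where k: "m = 6 * k" "0 < k" using m(2) by auto
    \<comment> \<open>For b = 1 the degree b + 2 = 3 would be divisible by 3; hence the exponent of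
      e2 in \<open>F\<close> is positive.\<close>
    have "b \<noteq> 1" using 3(2) by presburger
    then have "b = 2 * (b div 2) + 1" "0 < b div 2"
      using b b0 by (simp_all add: div_greater_zero_iff)
    from type_seq_odd_6_dvd[OF this k(2) \<nu>(2)] show ?thesis using k \<nu> by simp
  qed
qed

lemma type_seq_swap:
  "type_S22_44_seq a c d g1 g2 f1 f2 \<Longrightarrow> type_S22_44_seq a d c g1 g2 f2 f1"
  unfolding type_S22_44_seq_def only_origin_def by (auto simp: insert_commute)

lemma regular_degseq_imp_type_seq:
  assumes r: "regular_degseq (b + 2) b c d"
  shows "\<exists>g1 g2 f1 f2. type_S22_44_seq (b + 4) c d g1 g2 f1 f2"
proof -
  have pos: "0 < b" "0 < c" "0 < d" using r by (auto simp: regular_degseq_def)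
  have cd: "2 \<le> c \<or> 2 \<le> d"
  proof (rule ccontr)
    assume "\<not> ?thesis"
    then have "c = 1" "d = 1" using pos by linarith+
    then show False using r regular_degseq_not_1_1 by blast
  qed
  note d3 = regular_degseq_3_dvd[OF r]
  show ?thesis
  proof (cases "even b")
    case True
    consider "3 dvd d" | "3 dvd c" | "3 dvd b \<or> 3 dvd b + 2" "2 \<le> d" | "3 dvd b \<or> 3 dvd b + 2" "2 \<le> c"
      using d3 cd by blast
    then show ?thesis
    proof cases
      case 1
      then show ?thesis using type_seq_even_3_dvd[OF True pos(1,2) _ pos(3)] by blast
    next
      case 2
      then show ?thesis using type_seq_even_3_dvd[OF True pos(1,3) _ pos(2)] type_seq_swap by blast
    next
      case 3
      then show ?thesis using type_seq_even_3_dvd_b[OF True pos(1) _ pos(2)] by blast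
    next
      case 4
      then show ?thesis using type_seq_even_3_dvd_b[OF True pos(1) _ pos(3)] type_seq_swap by blast
    qed
  next
    case False
    \<comment> \<open>Both b and b + 2 are odd, so c and d are even and the multiple of 4 is one of
      them.\<close>
    have ev: "even c" "even d" using regular_degseq_even[OF r] False by simp_all
    have "\<not> 4 dvd b" "\<not> 4 dvd b + 2" using False by presburger+
    then have "4 dvd c \<or> 4 dvd d" using regular_degseq_4_dvd[OF r] by blast
    then show ?thesis
    proof
      assume "4 dvd d"
      then show ?thesis using type_seq_odd[OF False ev(1) pos(2) _ pos(3)] d3 by blast
    next
      assume "4 dvd c"
      then show ?thesis using type_seq_odd[OF False ev(2) pos(3) _ pos(2)] d3 type_seq_swap by blast
    qed
  qed
qed

theorem theorem4p5:
  fixes a c d :: nat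
  assumes "0 < a" and "0 < c" and "0 < d"
  shows "(\<exists>g1 g2 f1 f2. type_S22_44_seq a c d g1 g2 f1 f2) \<longleftrightarrow>
           (((a = 2 \<or> a = 4) \<and> (c, d) \<noteq> (1, 1)) \<or>
            (5 \<le> a \<and> regular_degseq (a - 2) (a - 4) c d))"
proof
  assume "\<exists>g1 g2 f1 f2. type_S22_44_seq a c d g1 g2 f1 f2"
  then show "((a = 2 \<or> a = 4) \<and> (c, d) \<noteq> (1, 1)) \<or> (5 \<le> a \<and> regular_degseq (a - 2) (a - 4) c d)"
    using type_seq_imp[OF _ assms] by (elim exE)
next
  assume "((a = 2 \<or> a = 4) \<and> (c, d) \<noteq> (1, 1)) \<or> (5 \<le> a \<and> regular_degseq (a - 2) (a - 4) c d)"
  then show "\<exists>g1 g2 f1 f2. type_S22_44_seq a c d g1 g2 f1 f2"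
  proof
    assume *: "(a = 2 \<or> a = 4) \<and> (c, d) \<noteq> (1, 1)"
    then have "2 \<le> d \<or> 2 \<le> c" using assms(2,3) by auto
    then show ?thesis
      using * type_seq_2[OF assms(2)] type_seq_2[OF assms(3)] type_seq_4[OF assms(2)]
        type_seq_4[OF assms(3)] type_seq_swap by blast
  next
    assume *: "5 \<le> a \<and> regular_degseq (a - 2) (a - 4) c d"
    then have "5 \<le> a" by blast
    then have "a = (a - 4) + 4" "a - 2 = (a - 4) + 2" by arith+
    with * have "regular_degseq ((a - 4) + 2) (a - 4) c d" by metis
    from regular_degseq_imp_type_seq[OF this] show ?thesis using \<open>a = (a - 4) + 4\<close> by simp
  qed
qed

end
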